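(* Let $\mathcal H$ be a separable real Hilbert space, $\mu_0=\mathcal N(0,Q)$, and let $x\mapsto D(x)$ be a field of self-adjoint, positive, bounded operators on $\mathcal H$ such that $d_-I\le D(x)\le d_+I$ for all $x\in\mathcal H$ with constants $0<d_-\le d_+<\infty$, and such that $x\mapsto D(x)^{1/2}$ is globally Lipschitz in the operator norm. Assume there exist $0<c_A\le C_A<\infty$ such that for all $x,\xi\in\mathcal H$ $$c_A\|Q^{1/2}\xi\|^2\le\|Q^{1/2}D(x)^{1/2}\xi\|^2\le C_A\|Q^{1/2}\xi\|^2 .$$ Then the form $(\mathcal E_A,\mathcal{FC}_b^\infty)$, $$\mathcal E_A(u,v)=\int_{\mathcal H}\langle Q^{1/2}D(x)^{1/2}\nabla u(x),Q^{1/2}D(x)^{1/2}\nabla v(x)\rangle\,d\mu_0(x),$$ is closable in $L^2(\mu_0)$, its closure is a symmetric Markovian Dirichlet form, and $$c_A\int\|Q^{1/2}\nabla u\|^2\,d\mu_0\le\mathcal E_A(u,u)\le C_A\int\|Q^{1/2}\nabla u\|^2\,d\mu_0 \qquad (u\in\mathcal{FC}_b^\infty).$$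
   Context: $\mu_0=\mathcal N(0,Q)$ is the centered Gaussian measure on $\mathcal H$ with trace-class self-adjoint covariance $Q$, where $Qe_k=q_ke_k$ for an orthonormal basis $(e_k)$, $q_k>0$, $\sum_kq_k<\infty$. No commutation of $D(x)$ and $Q$ is assumed. $\mathcal{FC}_b^\infty$ is the class of smooth cylindrical functions $u(x)=f(\langle x,h_1\rangle,\dots,\langle x,h_m\rangle)$ with $m\in\mathbb N$, $f\in C_b^\infty(\mathbb R^m)$, $h_i\in\mathcal H$; $\nabla u$ is the $\mathcal H$-gradient. *)

theory Defs
  imports "HOL-Probability.Probability"
begin

text \<open>
  A separable real Hilbert space is a type of sort \<open>{real_inner, polish_space}\<close>
  (\<open>polish_space\<close> is \<open>complete_space + second_countable_topology\<close>, and a metric space is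
  separable iff it is second countable). Finite-dimensional spaces are included.
\<close>

definition self_adjoint :: "('a::real_inner \<Rightarrow>\<^sub>L 'a) \<Rightarrow> bool" where
  "self_adjoint A \<longleftrightarrow> (\<forall>\<xi> \<eta>. A \<xi> \<bullet> \<eta> = \<xi> \<bullet> A \<eta>)"

definition positive_op :: "('a::real_inner \<Rightarrow>\<^sub>L 'a) \<Rightarrow> bool" where
  "positive_op A \<longleftrightarrow> self_adjoint A \<and> (\<forall>\<xi>. 0 \<le> A \<xi> \<bullet> \<xi>)"

text \<open>On a Hilbert space a positive bounded operator has exactly one positive square root.\<close>

definition op_sqrt :: "('a::real_inner \<Rightarrow>\<^sub>L 'a) \<Rightarrow> 'a \<Rightarrow>\<^sub>L 'a" where
  "op_sqrt A = (THE B. positive_op B \<and> B o\<^sub>L B = A)"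

text \<open>The index set \<open>K\<close> is finite if the space is finite-dimensional, and infinite otherwise.\<close>

definition orthonormal_basis :: "nat set \<Rightarrow> (nat \<Rightarrow> 'a::real_inner) \<Rightarrow> bool" where
  "orthonormal_basis K e \<longleftrightarrow>
     (\<forall>j\<in>K. \<forall>k\<in>K. e j \<bullet> e k = (if j = k then 1 else 0)) \<and> closure (span (e ` K)) = UNIV"

text \<open>A Borel probability measure is determined by its Fourier transform.\<close>

definition centered_gaussian ::
    "'a::{real_inner, polish_space} measure \<Rightarrow> ('a \<Rightarrow>\<^sub>L 'a) \<Rightarrow> bool" where
  "centered_gaussian \<mu> Q \<longleftrightarrow>
     prob_space \<mu> \<and> sets \<mu> = sets borel \<and>
     (\<forall>h. (CLINT x|\<mu>. iexp (x \<bullet> h)) = complex_of_real (exp (- (Q h \<bullet> h) / 2)))"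

text \<open>
  As the dimension \<open>m\<close> varies, a function on \<open>\<real>\<^sup>m\<close> is encoded as a function of a sequence
  that depends on the first \<open>m\<close> entries only. For such functions, continuity in the product
  topology on \<open>nat \<Rightarrow> real\<close> is continuity on \<open>\<real>\<^sup>m\<close>.
\<close>

definition depends_on_first :: "nat \<Rightarrow> ((nat \<Rightarrow> real) \<Rightarrow> real) \<Rightarrow> bool" where
  "depends_on_first m f \<longleftrightarrow> (\<forall>y z. (\<forall>i<m. y i = z i) \<longrightarrow> f y = f z)"

definition partial_deriv :: "nat \<Rightarrow> ((nat \<Rightarrow> real) \<Rightarrow> real) \<Rightarrow> (nat \<Rightarrow> real) \<Rightarrow> real" where
  "partial_deriv i f = (\<lambda>y. deriv (\<lambda>t. f (y(i := t))) (y i))"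

text \<open>
  All partial derivatives of all orders (order zero included) exist, and they are continuous
  and bounded. The list \<open>is\<close> gives the variables of an iterated partial derivative.
\<close>

definition Cb_infinity :: "nat \<Rightarrow> ((nat \<Rightarrow> real) \<Rightarrow> real) set" where
  "Cb_infinity m = {f. depends_on_first m f \<and>
     (\<forall>is. set is \<subseteq> {..<m} \<longrightarrow>
        continuous_on UNIV (foldr partial_deriv is f) \<and>
        bounded (range (foldr partial_deriv is f)) \<and>
        (\<forall>i<m. \<forall>y. (\<lambda>t. foldr partial_deriv is f (y(i := t))) differentiable (at (y i))))}"

definition FCb_infinity :: "('a::real_inner \<Rightarrow> real) set" where
  "FCb_infinity = {u. \<exists>m f h. f \<in> Cb_infinity m \<and> u = (\<lambda>x. f (\<lambda>i. x \<bullet> h i))}"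

definition grad :: "('a::real_inner \<Rightarrow> real) \<Rightarrow> 'a \<Rightarrow> 'a" where
  "grad u x = (THE g. GDERIV u x :> g)"

text \<open>
  Elements of \<open>L\<^sup>2(M)\<close> are represented by square-integrable measurable functions. A form is
  given by its domain, a set of such representatives, and its values on representatives.
\<close>

definition L2_space :: "'x measure \<Rightarrow> ('x \<Rightarrow> real) set" where
  "L2_space M = {u \<in> borel_measurable M. integrable M (\<lambda>x. (u x)\<^sup>2)}"

definition L2_converges :: "'x measure \<Rightarrow> (nat \<Rightarrow> 'x \<Rightarrow> real) \<Rightarrow> ('x \<Rightarrow> real) \<Rightarrow> bool" where
  "L2_converges M U u \<longleftrightarrow> (\<lambda>n. LINT x|M. (U n x - u x)\<^sup>2) \<longlonglongrightarrow> 0"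

definition L2_Cauchy :: "'x measure \<Rightarrow> (nat \<Rightarrow> 'x \<Rightarrow> real) \<Rightarrow> bool" where
  "L2_Cauchy M U \<longleftrightarrow>
     (\<forall>\<epsilon>>0. \<exists>N. \<forall>m\<ge>N. \<forall>n\<ge>N. (LINT x|M. (U m x - U n x)\<^sup>2) < \<epsilon>)"

type_synonym 'x form = "('x \<Rightarrow> real) \<Rightarrow> ('x \<Rightarrow> real) \<Rightarrow> real"

definition form_Cauchy :: "'x form \<Rightarrow> (nat \<Rightarrow> 'x \<Rightarrow> real) \<Rightarrow> bool" where
  "form_Cauchy E U \<longleftrightarrow>
     (\<forall>\<epsilon>>0. \<exists>N. \<forall>m\<ge>N. \<forall>n\<ge>N. E (\<lambda>x. U m x - U n x) (\<lambda>x. U m x - U n x) < \<epsilon>)"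

definition symmetric_form :: "'x measure \<Rightarrow> ('x \<Rightarrow> real) set \<Rightarrow> 'x form \<Rightarrow> bool" where
  "symmetric_form M Dom E \<longleftrightarrow>
     Dom \<subseteq> L2_space M \<and>
     (\<lambda>x. 0) \<in> Dom \<and>
     (\<forall>a b. \<forall>u\<in>Dom. \<forall>v\<in>Dom. (\<lambda>x. a * u x + b * v x) \<in> Dom) \<and>
     (\<forall>a b. \<forall>u\<in>Dom. \<forall>v\<in>Dom. \<forall>w\<in>Dom.
        E (\<lambda>x. a * u x + b * v x) w = a * E u w + b * E v w) \<and>
     (\<forall>u\<in>Dom. \<forall>v\<in>Dom. E u v = E v u) \<and>
     (\<forall>u\<in>Dom. 0 \<le> E u u)"

text \<open>
  Constant sequences show that \<open>E u u = 0\<close> whenever \<open>u\<close> in the domain of a closable form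
  vanishes almost everywhere, so that such a form is well defined on \<open>L\<^sup>2\<close> classes.
\<close>

definition closable :: "'x measure \<Rightarrow> ('x \<Rightarrow> real) set \<Rightarrow> 'x form \<Rightarrow> bool" where
  "closable M Dom E \<longleftrightarrow>
     symmetric_form M Dom E \<and>
     (\<forall>U. (\<forall>n. U n \<in> Dom) \<and> form_Cauchy E U \<and> L2_converges M U (\<lambda>x. 0) \<longrightarrow>
        (\<lambda>n. E (U n) (U n)) \<longlonglongrightarrow> 0)"

definition approximates ::
    "'x measure \<Rightarrow> ('x \<Rightarrow> real) set \<Rightarrow> 'x form \<Rightarrow> (nat \<Rightarrow> 'x \<Rightarrow> real) \<Rightarrow> ('x \<Rightarrow> real) \<Rightarrow> bool" where
  "approximates M Dom E U u \<longleftrightarrow>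
     (\<forall>n. U n \<in> Dom) \<and> form_Cauchy E U \<and> L2_converges M U u"

definition closure_domain :: "'x measure \<Rightarrow> ('x \<Rightarrow> real) set \<Rightarrow> 'x form \<Rightarrow> ('x \<Rightarrow> real) set" where
  "closure_domain M Dom E = {u \<in> L2_space M. \<exists>U. approximates M Dom E U u}"

text \<open>For a closable form the limit exists and does not depend on the approximating sequences.\<close>

definition closure_form :: "'x measure \<Rightarrow> ('x \<Rightarrow> real) set \<Rightarrow> 'x form \<Rightarrow> 'x form" where
  "closure_form M Dom E u v =
     (THE c. \<forall>U V. approximates M Dom E U u \<and> approximates M Dom E V v \<longrightarrow>
        (\<lambda>n. E (U n) (V n)) \<longlonglongrightarrow> c)"

text \<open>The domain of a closed form is complete for the squared norm \<open>\<parallel>u\<parallel>\<^sup>2 + E u u\<close>.\<close>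

definition closed_form :: "'x measure \<Rightarrow> ('x \<Rightarrow> real) set \<Rightarrow> 'x form \<Rightarrow> bool" where
  "closed_form M Dom E \<longleftrightarrow>
     symmetric_form M Dom E \<and>
     (\<forall>U. (\<forall>n. U n \<in> Dom) \<and> form_Cauchy E U \<and> L2_Cauchy M U \<longrightarrow>
        (\<exists>u\<in>Dom. L2_converges M U u \<and>
           (\<lambda>n. E (\<lambda>x. U n x - u x) (\<lambda>x. U n x - u x)) \<longlonglongrightarrow> 0))"

text \<open>
  A symmetric Dirichlet form is a densely defined closed form on \<open>L\<^sup>2(M)\<close> on which the unit
  contraction operates. The second condition says that it lives on \<open>L\<^sup>2\<close> classes.
\<close>

definition symmetric_Dirichlet_form :: "'x measure \<Rightarrow> ('x \<Rightarrow> real) set \<Rightarrow> 'x form \<Rightarrow> bool" where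
  "symmetric_Dirichlet_form M Dom E \<longleftrightarrow>
     closed_form M Dom E \<and>
     (\<forall>u\<in>Dom. \<forall>v\<in>borel_measurable M. (AE x in M. u x = v x) \<longrightarrow>
        v \<in> Dom \<and> (\<forall>w\<in>Dom. E v w = E u w)) \<and>
     (\<forall>u\<in>L2_space M. \<exists>U. (\<forall>n. U n \<in> Dom) \<and> L2_converges M U u) \<and>
     (\<forall>u\<in>Dom. (\<lambda>x. min (max (u x) 0) 1) \<in> Dom \<and>
        E (\<lambda>x. min (max (u x) 0) 1) (\<lambda>x. min (max (u x) 0) 1) \<le> E u u)"

definition form_A_density ::
    "('a::real_inner \<Rightarrow>\<^sub>L 'a) \<Rightarrow> ('a \<Rightarrow> 'a \<Rightarrow>\<^sub>L 'a) \<Rightarrow> ('a \<Rightarrow> real) \<Rightarrow> ('a \<Rightarrow> real) \<Rightarrow> 'a \<Rightarrow> real" where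
  "form_A_density Q D u v x =
     op_sqrt Q (op_sqrt (D x) (grad u x)) \<bullet> op_sqrt Q (op_sqrt (D x) (grad v x))"

definition form_A ::
    "'a measure \<Rightarrow> ('a::real_inner \<Rightarrow>\<^sub>L 'a) \<Rightarrow> ('a \<Rightarrow> 'a \<Rightarrow>\<^sub>L 'a) \<Rightarrow> 'a form" where
  "form_A \<mu> Q D u v = (LINT x|\<mu>. form_A_density Q D u v x)"

end

theory Submission
  imports Defs
begin

text \<open>
  Gaussian integration by parts, \<open>\<integral> \<langle>Q h, \<nabla>w\<rangle> d\<mu>\<^sub>0 = \<integral> w \<langle>x, h\<rangle> d\<mu>\<^sub>0\<close>, is derived from the Fourier
  transform alone: trigonometric functions generate all bounded Borel functions under bounded
  pointwise limits, so an integrated version of the formula has to be checked for them only, and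
  the same closure principle shows that \<open>FCb_infinity\<close> is dense in \<open>L\<^sup>2\<close>. Applied to \<open>u\<close> times the
  coefficients of \<open>\<nabla>v\<close>, the formula yields \<open>\<integral> \<langle>Q \<nabla>u, \<nabla>v\<rangle> d\<mu>\<^sub>0 = \<integral> u l d\<mu>\<^sub>0\<close> with \<open>l \<in> L\<^sup>2\<close>
  depending on \<open>v\<close>. Hence the form with \<open>D = I\<close> is closable, and by the two-sided comparison so is
  \<open>\<E>\<^sub>A\<close>. The unit contraction is a uniform limit of smooth functions with derivative in \<open>[0, 1]\<close>,
  under which the energy density decreases pointwise; lower semicontinuity of the closure on \<open>L\<^sup>2\<close>
  gives the Markov property.
\<close>

section \<open>Smooth cylindrical functions\<close>

text \<open>Integrating \<open>form_A\<close> by parts directly would put derivatives on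
  \<open>op_sqrt (D x)\<close>. The comparison confines this step to the constant operator
  \<open>Q\<close>, where only coefficients of a cylindrical gradient are differentiated. The
  derivative formula is not stable under bounded pointwise limits, because a limit of smooth
  functions may have no gradient. The shift identity over a finite distance \<open>T\<close>
  contains no derivative, survives such limits, and returns the formula as \<open>T\<close> tends to
  0. Smoothed contractions have controlled energies, but the energies of their differences are not
  controlled, so they need not form a Cauchy sequence for the form. Lower semicontinuity bridges
  this gap: \<open>L2\<close> balls are convex, hence midpoints of near-minimisers compete in the
  same minimisation. Closures are formed on representatives, so \<open>L2\<close> completeness,
  independence of approximating sequences and invariance under null sets are proved for functions,
  with squared distances in place of norms.\<close>

lemma Cb_infinity_coinduct:
  assumes "f \<in> S"
    and S: "\<And>g. g \<in> S \<Longrightarrow> depends_on_first m g \<and> continuous_on UNIV g \<and> bounded (range g) \<and>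
      (\<forall>i<m. (\<forall>y. (\<lambda>t. g (y(i := t))) differentiable (at (y i))) \<and> partial_deriv i g \<in> S)"
  shows "f \<in> Cb_infinity m"
proof -
  \<comment> \<open>Induction on the list keeps every iterated derivative inside \<open>S\<close>.
    Membership in \<open>Cb_infinity m\<close> is thus reduced to an invariant set whose members are
    differentiated only once.\<close>
  have "foldr partial_deriv is f \<in> S" if "set is \<subseteq> {..<m}" for "is"
    using that by (induction "is") (use assms in auto)
  then show ?thesis
    using assms unfolding Cb_infinity_def by blast
qed

lemma Cb_infinity_iterated:
  assumes "f \<in> Cb_infinity m" "set is \<subseteq> {..<m}"
  shows "continuous_on UNIV (foldr partial_deriv is f)"
    and "bounded (range (foldr partial_deriv is f))"
    and "\<forall>i<m. \<forall>y. (\<lambda>t. foldr partial_deriv is f (y(i := t))) differentiable (at (y i))"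
  using assms unfolding Cb_infinity_def mem_Collect_eq by blast+

lemma Cb_infinity_depends: "f \<in> Cb_infinity m \<Longrightarrow> depends_on_first m f"
  unfolding Cb_infinity_def mem_Collect_eq by blast

lemma Cb_infinity_continuous: "f \<in> Cb_infinity m \<Longrightarrow> continuous_on UNIV f"
  using Cb_infinity_iterated(1)[of f m "[]"] by simp

lemma Cb_infinity_bounded: "f \<in> Cb_infinity m \<Longrightarrow> bounded (range f)"
  using Cb_infinity_iterated(2)[of f m "[]"] by simp

lemma Cb_infinity_partial_deriv:
  assumes f: "f \<in> Cb_infinity m" and i: "i < m"
  shows "partial_deriv i f \<in> Cb_infinity m"
proof -
  have "partial_deriv i f y = partial_deriv i f z" if "\<forall>j<m. y j = z j" for y z
  proof -
    have "f (y(i := t)) = f (z(i := t))" for t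
      using Cb_infinity_depends[OF f, unfolded depends_on_first_def, rule_format, of "y(i := t)"
          "z(i := t)"] that
      by simp
    then show ?thesis
      using that i by (simp add: partial_deriv_def)
  qed
  \<comment> \<open>\<open>foldr\<close> differentiates in the last variable of the list first, so
    \<open>i\<close> goes to the end of the list and not to its head.\<close>
  moreover have "foldr partial_deriv is (partial_deriv i f) = foldr partial_deriv (is @ [i]) f"
      for "is"
    by simp
  ultimately show ?thesis
    using Cb_infinity_iterated[OF f, of "_ @ [i]"] i
    unfolding Cb_infinity_def depends_on_first_def mem_Collect_eq by auto
qed

text \<open>The definition speaks of the point \<open>y i\<close> only; applying it to
  \<open>y(i := s)\<close> reaches every point of the coordinate line through \<open>y\<close>, as
  the mean value theorem requires.\<close>

lemma Cb_infinity_partial: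
  assumes "f \<in> Cb_infinity m" "i < m"
  shows "((\<lambda>t. f (y(i := t))) has_real_derivative partial_deriv i f (y(i := s))) (at s)"
proof -
  have "\<forall>i<m. \<forall>y. (\<lambda>t. f (y(i := t))) differentiable (at (y i))"
    using Cb_infinity_iterated(3)[OF assms(1), of "[]"]
    by (simp only: foldr.simps id_apply list.set empty_subsetI True_implies_equals)
  from this[THEN spec[of _ i], THEN mp, OF assms(2), THEN spec[of _ "y(i := s)"]]
  have "(\<lambda>t. f (y(i := t))) differentiable (at s)"
    by (simp only: fun_upd_upd fun_upd_same)
  then show ?thesis
    by (simp only: partial_deriv_def fun_upd_upd fun_upd_same flip:
        DERIV_deriv_iff_real_differentiable)
qed

lemma Cb_infinity_differentiable:
  assumes "f \<in> Cb_infinity m" "i < m"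
  shows "(\<lambda>t. f (y(i := t))) differentiable (at s)"
  using Cb_infinity_partial[OF assms] real_differentiable_def by blast

section \<open>Algebras of functions closed under partial derivatives\<close>

inductive_set alg_hull :: "('b \<Rightarrow> real) set \<Rightarrow> ('b \<Rightarrow> real) set" for G where
  gen: "g \<in> G \<Longrightarrow> g \<in> alg_hull G"
| const: "(\<lambda>y. c) \<in> alg_hull G"
| add: "f \<in> alg_hull G \<Longrightarrow> g \<in> alg_hull G \<Longrightarrow> (\<lambda>y. f y + g y) \<in> alg_hull G"
| mult: "f \<in> alg_hull G \<Longrightarrow> g \<in> alg_hull G \<Longrightarrow> (\<lambda>y. f y * g y) \<in> alg_hull G"

lemma partial_deriv_eqI:
  assumes "\<And>y. ((\<lambda>t. f (y(i := t))) has_real_derivative D y) (at (y i))"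
  shows "partial_deriv i f = D"
  unfolding partial_deriv_def using assms by (auto intro!: ext DERIV_imp_deriv)

lemma bounded_range_add:
  fixes f g :: "'b \<Rightarrow> real"
  assumes "bounded (range f)" "bounded (range g)"
  shows "bounded (range (\<lambda>y. f y + g y))"
  using assms bounded_plus_comp by auto

lemma bounded_range_mult:
  fixes f g :: "'b \<Rightarrow> real"
  assumes "bounded (range f)" "bounded (range g)"
  shows "bounded (range (\<lambda>y. f y * g y))"
proof -
  obtain a b where "\<And>y. \<bar>f y\<bar> \<le> a" "\<And>y. \<bar>g y\<bar> \<le> b"
    using assms by (auto simp: bounded_iff)
  then have "\<bar>f y * g y\<bar> \<le> a * b" for y
    unfolding abs_mult by (rule mult_mono') simp_all
  then show ?thesis
    by (auto simp: bounded_iff)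
qed

text \<open>Partial derivatives of generators may be arbitrary elements of the generated algebra;
  this is what makes the hull, and not only the generators, closed under them.\<close>

lemma alg_hull_subset_Cb_infinity:
  assumes G: "\<And>g. g \<in> G \<Longrightarrow> depends_on_first m g \<and> continuous_on UNIV g \<and> bounded (range g)"
    and D: "\<And>g i. g \<in> G \<Longrightarrow> i < m \<Longrightarrow> \<exists>g'\<in>alg_hull G. \<forall>y.
      ((\<lambda>t. g (y(i := t))) has_real_derivative g' y) (at (y i))"
  shows "alg_hull G \<subseteq> Cb_infinity m"
proof
  have 1: "depends_on_first m f \<and> continuous_on UNIV f \<and> bounded (range f)" if "f \<in> alg_hull G"
      for f
    using that
  proof induction
    case (add f g)
    moreover from this have "depends_on_first m (\<lambda>y. f y + g y)"
      unfolding depends_on_first_def by metis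
    ultimately show ?case
      by (auto intro: continuous_on_add bounded_range_add)
  next
    case (mult f g)
    moreover from this have "depends_on_first m (\<lambda>y. f y * g y)"
      unfolding depends_on_first_def by metis
    ultimately show ?case
      by (auto intro: continuous_on_mult bounded_range_mult)
  qed (use G in \<open>auto simp: depends_on_first_def\<close>)
  have 2: "\<exists>f'\<in>alg_hull G. \<forall>y. ((\<lambda>t. f (y(i := t))) has_real_derivative f' y) (at (y i))"
    if "f \<in> alg_hull G" "i < m" for f i
    using that(1)
  proof induction
    case (gen g)
    then show ?case
      using D \<open>i < m\<close> by blast
  next
    case (const c)
    show ?case
      by (rule bexI[of _ "\<lambda>y. 0"]) (auto intro: alg_hull.const)
  next
    case (add f g)
    then obtain f' g' where "f' \<in> alg_hull G" "g' \<in> alg_hull G"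
      "\<And>y. ((\<lambda>t. f (y(i := t))) has_real_derivative f' y) (at (y i))"
      "\<And>y. ((\<lambda>t. g (y(i := t))) has_real_derivative g' y) (at (y i))"
      by blast
    then show ?case
      by (intro bexI[of _ "\<lambda>y. f' y + g' y"] allI DERIV_add alg_hull.add)
  next
    case (mult f g)
    then obtain f' g' where *: "f' \<in> alg_hull G" "g' \<in> alg_hull G"
      "\<And>y. ((\<lambda>t. f (y(i := t))) has_real_derivative f' y) (at (y i))"
      "\<And>y. ((\<lambda>t. g (y(i := t))) has_real_derivative g' y) (at (y i))"
      by blast
    show ?case
    proof (intro bexI[of _ "\<lambda>y. f' y * g y + g' y * f y"] allI)
      show "((\<lambda>t. f (y(i := t)) * g (y(i := t))) has_real_derivative f' y * g y + g' y * f y)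
          (at (y i))" for y
        using DERIV_mult[OF *(3,4)[of y]] by simp
    qed (intro alg_hull.add alg_hull.mult * mult.hyps)
  qed
  fix f assume "f \<in> alg_hull G"
  then show "f \<in> Cb_infinity m"
  proof (rule Cb_infinity_coinduct, intro conjI allI impI)
    fix g i y assume g: "g \<in> alg_hull G" and i: "i < m"
    obtain g' where g': "g' \<in> alg_hull G"
      "\<And>y. ((\<lambda>t. g (y(i := t))) has_real_derivative g' y) (at (y i))"
      using 2[OF g i] by blast
    then show "(\<lambda>t. g (y(i := t))) differentiable (at (y i))"
      using real_differentiable_def by blast
    have "partial_deriv i g = g'"
      by (rule partial_deriv_eqI) (rule g')
    then show "partial_deriv i g \<in> alg_hull G"
      using g' by simp
  qed (use 1 in auto)
qed

text \<open>With \<open>Cb_infinity m\<close> as generating set, derivatives of generators are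
  generators. Closure under constants, sums and products follows at once, with no Leibniz formula
  for iterated derivatives.\<close>

lemma alg_hull_Cb_infinity: "alg_hull (Cb_infinity m) \<subseteq> Cb_infinity m"
proof (rule alg_hull_subset_Cb_infinity)
  fix g i assume g: "g \<in> Cb_infinity m" and i: "i < m"
  have "((\<lambda>t. g (y(i := t))) has_real_derivative partial_deriv i g y) (at (y i))" for y
    using Cb_infinity_partial[OF g i, of y "y i"] by simp
  then show "\<exists>g'\<in>alg_hull (Cb_infinity m).
      \<forall>y. ((\<lambda>t. g (y(i := t))) has_real_derivative g' y) (at (y i))"
    using Cb_infinity_partial_deriv[OF g i] by (auto intro: alg_hull.gen)
qed (simp add: Cb_infinity_continuous Cb_infinity_bounded Cb_infinity_depends)

lemma Cb_infinity_const: "(\<lambda>y. c) \<in> Cb_infinity m"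
  using alg_hull_Cb_infinity alg_hull.const by blast

lemma Cb_infinity_add:
  "f \<in> Cb_infinity m \<Longrightarrow> g \<in> Cb_infinity m \<Longrightarrow> (\<lambda>y. f y + g y) \<in> Cb_infinity m"
  using alg_hull_Cb_infinity alg_hull.add alg_hull.gen by blast

lemma Cb_infinity_mult:
  "f \<in> Cb_infinity m \<Longrightarrow> g \<in> Cb_infinity m \<Longrightarrow> (\<lambda>y. f y * g y) \<in> Cb_infinity m"
  using alg_hull_Cb_infinity alg_hull.mult alg_hull.gen by blast

lemma Cb_infinity_sum:
  "(\<And>i. i \<in> I \<Longrightarrow> f i \<in> Cb_infinity m) \<Longrightarrow> (\<lambda>y. \<Sum>i\<in>I. f i y) \<in> Cb_infinity m"
proof (induction I rule: infinite_finite_induct)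
  case (insert i I)
  then show ?case
    using Cb_infinity_add[of "f i" m "\<lambda>y. \<Sum>i\<in>I. f i y"] by simp
qed (simp_all add: Cb_infinity_const)

text \<open>The two are treated together because each is, up to sign, the derivative of the other;
  the algebra generated by one alone is not closed under differentiation.\<close>

lemma Cb_infinity_cos: "(\<lambda>y. cos (y 0)) \<in> Cb_infinity 1"
  and Cb_infinity_sin: "(\<lambda>y. sin (y 0)) \<in> Cb_infinity 1"
proof -
  let ?c = "\<lambda>y::nat \<Rightarrow> real. cos (y 0)" and ?s = "\<lambda>y::nat \<Rightarrow> real. sin (y 0)"
  have "alg_hull {?c, ?s} \<subseteq> Cb_infinity 1"
  proof (rule alg_hull_subset_Cb_infinity)
    fix g :: "(nat \<Rightarrow> real) \<Rightarrow> real" and i :: nat assume "g \<in> {?c, ?s}" "i < 1"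
    then consider "g = ?c" "i = 0" | "g = ?s" "i = 0" by auto
    then show "\<exists>g'\<in>alg_hull {?c, ?s}. \<forall>y. ((\<lambda>t. g (y(i := t))) has_real_derivative g' y) (at (y i))"
    proof cases
      case 1
      have "(\<lambda>y. (-1) * ?s y) \<in> alg_hull {?c, ?s}"
        by (intro alg_hull.mult alg_hull.const alg_hull.gen) auto
      then show ?thesis
        using 1 by (auto intro!: bexI[of _ "\<lambda>y. (-1) * ?s y"] derivative_eq_intros)
    next
      case 2
      have "?c \<in> alg_hull {?c, ?s}"
        by (intro alg_hull.gen) auto
      then show ?thesis
        using 2 by (auto intro!: bexI[of _ ?c] derivative_eq_intros)
    qed
  qed (auto simp: depends_on_first_def bounded_iff intro!: continuous_intros exI[of _ 1])
  then show "?c \<in> Cb_infinity 1" "?s \<in> Cb_infinity 1"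
    by (auto intro: alg_hull.gen)
qed

text \<open>Variables beyond \<open>m\<close> contribute the derivative 0, which lies in
  \<open>Cb_infinity m\<close>; hence \<open>Cb_infinity m\<close> is an invariant set for the
  larger dimension too.\<close>

lemma Cb_infinity_mono:
  assumes "f \<in> Cb_infinity m" "m \<le> n"
  shows "f \<in> Cb_infinity n"
proof -
  have dep: "g (y(i := t)) = g y" if "g \<in> Cb_infinity m" "\<not> i < m" for g y i t
    using Cb_infinity_depends[OF that(1)] that(2) unfolding depends_on_first_def
    by (metis fun_upd_other)
  show ?thesis
    using assms(1)
  proof (rule Cb_infinity_coinduct, intro conjI allI impI)
    fix g i y assume g: "g \<in> Cb_infinity m"
    show "continuous_on UNIV g" "bounded (range g)"
      by (rule Cb_infinity_continuous[OF g], rule Cb_infinity_bounded[OF g])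
    show "depends_on_first n g"
      using Cb_infinity_depends[OF g] \<open>m \<le> n\<close> unfolding depends_on_first_def
      by (meson order_less_le_trans)
    show "(\<lambda>t. g (y(i := t))) differentiable (at (y i))"
    proof (cases "i < m")
      case True
      then show ?thesis by (rule Cb_infinity_differentiable[OF g])
    qed (simp add: dep[OF g])
    show "partial_deriv i g \<in> Cb_infinity m"
    proof (cases "i < m")
      case False
      then have "partial_deriv i g = (\<lambda>y. 0)"
        by (intro partial_deriv_eqI) (simp add: dep[OF g])
      then show ?thesis
        by (simp add: Cb_infinity_const)
    qed (rule Cb_infinity_partial_deriv[OF g])
  qed
qed

text \<open>Makes room for the variables of another function in front, as
  \<open>FCb_infinity_pair\<close> requires. A shifted function is constant in the first
  \<open>n\<close> variables, and variable \<open>n + j\<close> takes the part of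
  \<open>j\<close>.\<close>

lemma Cb_infinity_shift:
  assumes "f \<in> Cb_infinity m"
  shows "(\<lambda>y. f (\<lambda>i. y (n + i))) \<in> Cb_infinity (n + m)"
proof (rule Cb_infinity_coinduct[where S = "{\<lambda>y. g (\<lambda>i. y (n + i)) | g. g \<in> Cb_infinity m}"])
  fix h assume "h \<in> {\<lambda>y. g (\<lambda>i. y (n + i)) | g. g \<in> Cb_infinity m}"
  then obtain g where g: "g \<in> Cb_infinity m" and h: "h = (\<lambda>y. g (\<lambda>i. y (n + i)))"
    by blast
  have dep: "depends_on_first (n + m) h"
    using Cb_infinity_depends[OF g] unfolding depends_on_first_def h by
        (metis nat_add_left_cancel_less)
  have cont: "continuous_on UNIV h"
    unfolding h using Cb_infinity_continuous[OF g]
    by (rule continuous_on_compose2) (auto intro!: continuous_on_coordinatewise_then_product)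
  have bdd: "bounded (range h)"
    by (rule bounded_subset[OF Cb_infinity_bounded[OF g]]) (auto simp: h)
  have D: "\<exists>g'\<in>Cb_infinity m. \<forall>y. ((\<lambda>t. h (y(i := t))) has_real_derivative g' (\<lambda>i. y (n + i)))
      (at (y i))"
    if "i < n + m" for i
  proof (cases "i < n")
    case True
    then have const: "h (y(i := t)) = h y" for y t
      by (simp add: h)
    show ?thesis
      by (intro bexI[OF _ Cb_infinity_const[of 0]] allI) (simp only: const DERIV_const)
  next
    case False
    define j where "j = i - n"
    have j: "i = n + j" "j < m"
      using False that by (auto simp: j_def)
    have "h (y(i := t)) = g ((\<lambda>i. y (n + i))(j := t))" for y t
      unfolding h by (rule arg_cong[of _ _ g]) (auto simp: j)
    then have "((\<lambda>t. h (y(i := t))) has_real_derivative partial_deriv j g (\<lambda>i. y (n + i)))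
        (at (y i))" for y
      using Cb_infinity_partial[OF g \<open>j < m\<close>, of "\<lambda>i. y (n + i)" "y i"] j
      by (simp add: fun_upd_idem)
    then show ?thesis
      by (intro bexI[of _ "partial_deriv j g"] allI Cb_infinity_partial_deriv[OF g \<open>j < m\<close>])
  qed
  show "depends_on_first (n + m) h \<and> continuous_on UNIV h \<and> bounded (range h) \<and>
      (\<forall>i<n + m. (\<forall>y. (\<lambda>t. h (y(i := t))) differentiable (at (y i))) \<and>
        partial_deriv i h \<in> {\<lambda>y. g (\<lambda>i. y (n + i)) | g. g \<in> Cb_infinity m})"
  proof (intro conjI allI impI dep cont bdd)
    fix i y assume "i < n + m"
    from D[OF this] obtain g' where "g' \<in> Cb_infinity m" and
      "\<forall>y. ((\<lambda>t. h (y(i := t))) has_real_derivative g' (\<lambda>i. y (n + i))) (at (y i))" ..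
    note g' = this(1) this(2)[THEN spec]
    show "(\<lambda>t. h (y(i := t))) differentiable (at (y i))"
      unfolding real_differentiable_def by (rule exI, rule g'(2))
    have "partial_deriv i h = (\<lambda>y. g' (\<lambda>i. y (n + i)))"
      by (rule partial_deriv_eqI, rule g'(2))
    then show "partial_deriv i h \<in> {\<lambda>y. g (\<lambda>i. y (n + i)) | g. g \<in> Cb_infinity m}"
      using g'(1) by blast
  qed
qed (use assms in auto)

text \<open>A smooth substitute for the positive part \<open>max t 0\<close>, from which the smooth
  unit contraction is built.\<close>

definition softplus :: "real \<Rightarrow> real" where
  "softplus t = ln (1 + exp t)"

definition sigmoid :: "real \<Rightarrow> real" where
  "sigmoid t = exp t / (1 + exp t)"

lemma DERIV_softplus: "(softplus has_real_derivative sigmoid t) (at t)"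
  unfolding softplus_def sigmoid_def
  by (auto intro!: derivative_eq_intros simp: add_pos_pos)

text \<open>The logistic equation: the derivative is a polynomial in \<open>sigmoid\<close>, so
  adjoining \<open>sigmoid\<close> and \<open>softplus\<close> to an algebra keeps it closed under
  derivatives.\<close>

lemma DERIV_sigmoid: "(sigmoid has_real_derivative sigmoid t * (1 - sigmoid t)) (at t)"
proof -
  have "1 + exp t \<noteq> 0" "1 + exp t > 0" by (simp_all add: add_pos_pos add_eq_0_iff)
      (smt (verit) exp_gt_zero)+
  then show ?thesis
    unfolding sigmoid_def
    by (auto intro!: derivative_eq_intros simp: field_simps)
qed

text \<open>By the logistic equation, \<open>Cb_infinity m\<close> together with the two composites
  generates an algebra closed under derivatives. \<open>softplus\<close> is unbounded; the composite
  is bounded because \<open>a * f y + b\<close> stays in a compact interval.\<close>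

lemma Cb_infinity_softplus:
  assumes f: "f \<in> Cb_infinity m"
  shows "(\<lambda>y. softplus (a * f y + b)) \<in> Cb_infinity m"
proof -
  define G where "G = Cb_infinity m \<union> {\<lambda>y. sigmoid (a * f y + b), \<lambda>y. softplus (a * f y + b)}"
  obtain B where B: "\<And>y. \<bar>f y\<bar> \<le> B"
    using Cb_infinity_bounded[OF f] by (auto simp: bounded_iff)
  have bdd: "a * f y + b \<in> {-(\<bar>a\<bar> * B + \<bar>b\<bar>)..\<bar>a\<bar> * B + \<bar>b\<bar>}" for y
  proof -
    have "\<bar>a * f y + b\<bar> \<le> \<bar>a\<bar> * B + \<bar>b\<bar>"
      using mult_left_mono[OF B[of y], of "\<bar>a\<bar>"] abs_triangle_ineq[of "a * f y" b]
      by (simp add: abs_mult)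
    then show ?thesis by auto
  qed
  have comp: "depends_on_first m (\<lambda>y. p (a * f y + b)) \<and> continuous_on UNIV (\<lambda>y. p (a * f y + b)) \<and>
      bounded (range (\<lambda>y. p (a * f y + b)))" if p: "continuous_on UNIV p" for p :: "real \<Rightarrow> real"
  proof (intro conjI)
    show "depends_on_first m (\<lambda>y. p (a * f y + b))"
      using Cb_infinity_depends[OF f] unfolding depends_on_first_def by metis
    show "continuous_on UNIV (\<lambda>y. p (a * f y + b))"
      using p by (rule continuous_on_compose2)
          (auto intro!: continuous_intros Cb_infinity_continuous[OF f])
    have "compact (p ` {-(\<bar>a\<bar> * B + \<bar>b\<bar>)..\<bar>a\<bar> * B + \<bar>b\<bar>})"
      using p by (intro compact_continuous_image) (auto intro: continuous_on_subset)
    then show "bounded (range (\<lambda>y. p (a * f y + b)))"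
      by (rule bounded_subset[OF compact_imp_bounded]) (intro image_subsetI imageI bdd)
  qed
  have cont: "continuous_on UNIV softplus" "continuous_on UNIV sigmoid"
    by (auto intro!: DERIV_continuous_on[OF has_field_derivative_at_within] DERIV_softplus
        DERIV_sigmoid)
  have Gin: "f \<in> alg_hull G" "(\<lambda>y. sigmoid (a * f y + b)) \<in> alg_hull G"
    "\<And>g. g \<in> Cb_infinity m \<Longrightarrow> g \<in> alg_hull G"
    using f by (auto intro!: alg_hull.gen simp: G_def)
  have "alg_hull G \<subseteq> Cb_infinity m"
  proof (rule alg_hull_subset_Cb_infinity)
    show "depends_on_first m g \<and> continuous_on UNIV g \<and> bounded (range g)" if "g \<in> G" for g
      using that comp[OF cont(1)] comp[OF cont(2)] unfolding G_def by
          (auto simp: Cb_infinity_continuous Cb_infinity_bounded Cb_infinity_depends)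
    fix g i assume "g \<in> G" and i: "i < m"
    have D: "((\<lambda>t. g (y(i := t))) has_real_derivative partial_deriv i g y) (at (y i))"
      if "g \<in> Cb_infinity m" for g y
      using Cb_infinity_partial[OF that i, of y "y i"] by simp
    have Df: "((\<lambda>t. a * f (y(i := t)) + b) has_real_derivative a * partial_deriv i f y) (at (y i))"
        for y
      by (auto intro!: derivative_eq_intros D f)
    have pf: "(\<lambda>y. a * partial_deriv i f y) \<in> alg_hull G"
      by (intro alg_hull.mult alg_hull.const Gin Cb_infinity_partial_deriv[OF f i])
    from \<open>g \<in> G\<close> consider "g \<in> Cb_infinity m" | "g = (\<lambda>y. sigmoid (a * f y + b))"
      | "g = (\<lambda>y. softplus (a * f y + b))"
      by (auto simp: G_def)
    then show "\<exists>g'\<in>alg_hull G. \<forall>y. ((\<lambda>t. g (y(i := t))) has_real_derivative g' y) (at (y i))"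
    proof cases
      case 1
      then show ?thesis
        using D Cb_infinity_partial_deriv[OF 1 i] Gin by blast
    next
      case 2
      let ?s = "\<lambda>y. sigmoid (a * f y + b)"
      have "((\<lambda>t. g (y(i := t))) has_real_derivative
          ?s y * (1 + (-1) * ?s y) * (a * partial_deriv i f y)) (at (y i))" for y
        unfolding 2 using DERIV_chain2[OF DERIV_sigmoid Df[of y]] by simp
      moreover have "(\<lambda>y. ?s y * (1 + (-1) * ?s y) * (a * partial_deriv i f y)) \<in> alg_hull G"
        by (intro alg_hull.mult[OF _ pf] alg_hull.mult[of ?s] alg_hull.add Gin
            alg_hull.mult[of "\<lambda>_. -1"] alg_hull.const)
      ultimately show ?thesis
        by (intro bexI[of _ "\<lambda>y. ?s y * (1 + (-1) * ?s y) * (a * partial_deriv i f y)"] allI)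
    next
      case 3
      let ?s = "\<lambda>y. sigmoid (a * f y + b)"
      have "((\<lambda>t. g (y(i := t))) has_real_derivative ?s y * (a * partial_deriv i f y)) (at (y i))"
          for y
        unfolding 3 using DERIV_chain2[OF DERIV_softplus Df[of y]] by simp
      moreover have "(\<lambda>y. ?s y * (a * partial_deriv i f y)) \<in> alg_hull G"
        by (intro alg_hull.mult[OF _ pf] Gin)
      ultimately show ?thesis
        by (intro bexI[of _ "\<lambda>y. ?s y * (a * partial_deriv i f y)"] allI)
    qed
  qed
  then show ?thesis
    by (auto intro!: alg_hull.gen simp: G_def)
qed

section \<open>Differentiability of cylindrical functions\<close>

lemma tendsto_coordinatewise:
  fixes F :: "'b \<Rightarrow> 'i \<Rightarrow> 'c::topological_space"
  assumes "\<And>i. ((\<lambda>x. F x i) \<longlongrightarrow> l i) A"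
  shows "(F \<longlongrightarrow> l) A"
proof -
  have "limitin (product_topology (\<lambda>i. euclidean) UNIV) F l A"
    using assms by (simp add: limitin_componentwise)
  then show ?thesis
    by (simp add: euclidean_product_topology)
qed

text \<open>Telescoping over the coordinates reduces differentiability to the mean value theorem in
  one variable; the intermediate points converge coordinatewise.\<close>

lemma Cb_infinity_cylinder_has_derivative:
  fixes h :: "nat \<Rightarrow> 'a::real_inner"
  assumes f: "f \<in> Cb_infinity m"
  shows "((\<lambda>x. f (\<lambda>i. x \<bullet> h i)) has_derivative
    (\<lambda>d. \<Sum>i<m. partial_deriv i f (\<lambda>i. x \<bullet> h i) * (d \<bullet> h i))) (at x)"
proof -
  define z where "z = (\<lambda>y i. y \<bullet> h i)"
  \<comment> \<open>A path from \<open>x\<close> (at \<open>j = 0\<close>) to \<open>y\<close> (at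
    \<open>j = m\<close>) that changes one inner product per step, so that each increment of
    \<open>f\<close> runs along one coordinate line.\<close>
  define w where "w = (\<lambda>y j i. if i < j then y \<bullet> h i else x \<bullet> h i)"
  have "\<exists>\<xi>. \<bar>\<xi> - x \<bullet> h j\<bar> \<le> \<bar>y \<bullet> h j - x \<bullet> h j\<bar> \<and>
      f (w y (Suc j)) - f (w y j) = (y \<bullet> h j - x \<bullet> h j) * partial_deriv j f ((w y j)(j := \<xi>))"
    if j: "j < m" for j y
  proof -
    define g where "g = (\<lambda>t. f ((w y j)(j := t)))"
    define g' where "g' = (\<lambda>t. partial_deriv j f ((w y j)(j := t)))"
    have D: "(g has_real_derivative g' s) (at s)" for s
      unfolding g_def g'_def by (rule Cb_infinity_partial[OF f j])
    have g: "f (w y (Suc j)) = g (y \<bullet> h j)" "f (w y j) = g (x \<bullet> h j)"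
      unfolding g_def by (auto simp: w_def intro!: arg_cong[of _ _ f])
    have "\<exists>\<xi>. \<bar>\<xi> - a\<bar> \<le> \<bar>b - a\<bar> \<and> g b - g a = (b - a) * g' \<xi>" for a b
    proof (cases a b rule: linorder_cases)
      case less
      then obtain \<xi> where "a < \<xi>" "\<xi> < b" "g b - g a = (b - a) * g' \<xi>"
        using MVT2[OF less D] by blast
      then show ?thesis by (intro exI[of _ \<xi>]) auto
    next
      case greater
      then obtain \<xi> where "b < \<xi>" "\<xi> < a" "g a - g b = (a - b) * g' \<xi>"
        using MVT2[OF greater D] by blast
      then show ?thesis by (intro exI[of _ \<xi>]) (auto simp: algebra_simps)
    qed auto
    then show ?thesis
      unfolding g unfolding g'_def .
  qed
  then obtain \<xi> where \<xi>: "\<And>j y. j < m \<Longrightarrow> \<bar>\<xi> j y - x \<bullet> h j\<bar> \<le> \<bar>y \<bullet> h j - x \<bullet> h j\<bar>"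
    "\<And>j y. j < m \<Longrightarrow> f (w y (Suc j)) - f (w y j) =
      (y \<bullet> h j - x \<bullet> h j) * partial_deriv j f ((w y j)(j := \<xi> j y))"
    by metis
  have h_lim: "((\<lambda>y. y \<bullet> h i) \<longlongrightarrow> x \<bullet> h i) (at x)" for i
    by (intro tendsto_intros)
  have w_lim: "((\<lambda>y. (w y j)(j := \<xi> j y)) \<longlongrightarrow> z x) (at x)" if j: "j < m" for j
  proof (rule tendsto_coordinatewise)
    fix i
    have "((\<lambda>y. \<xi> j y - x \<bullet> h j) \<longlongrightarrow> 0) (at x)"
    proof (rule Lim_null_comparison)
      show "((\<lambda>y. \<bar>y \<bullet> h j - x \<bullet> h j\<bar>) \<longlongrightarrow> 0) (at x)"
        using tendsto_rabs[OF tendsto_diff[OF h_lim[of j] tendsto_const[of "x \<bullet> h j"]]] by simp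
    qed (use \<xi>(1)[OF j] in auto)
    then have "(\<xi> j \<longlongrightarrow> x \<bullet> h j) (at x)"
      by (simp add: LIM_zero_iff)
    then show "((\<lambda>y. ((w y j)(j := \<xi> j y)) i) \<longlongrightarrow> z x i) (at x)"
      using h_lim[of i] by (cases "i = j"; cases "i < j") (auto simp: w_def z_def)
  qed
  have p_lim: "((\<lambda>y. partial_deriv j f ((w y j)(j := \<xi> j y)) - partial_deriv j f (z x)) \<longlongrightarrow> 0) (at x)"
    if j: "j < m" for j
  proof -
    have "isCont (partial_deriv j f) (z x)"
      using Cb_infinity_continuous[OF Cb_infinity_partial_deriv[OF f j]]
      by (simp add: continuous_on_eq_continuous_at)
    then show ?thesis
      using isCont_tendsto_compose w_lim[OF j] LIM_zero by blast
  qed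
  \<comment> \<open>Cauchy--Schwarz for \<open>(y - x) \<bullet> h j\<close> bounds the error of the
    linearisation by \<open>r y * norm (y - x)\<close>; continuity of the partial derivatives makes
    \<open>r\<close> vanish at \<open>x\<close>.\<close>
  define r where "r = (\<lambda>y. \<Sum>j<m. \<bar>partial_deriv j f ((w y j)(j := \<xi> j y)) - partial_deriv j f (z x)\<bar>
      * norm (h j))"
  have r_lim: "(r \<longlongrightarrow> 0) (at x)"
    unfolding r_def
    by (rule tendsto_eq_rhs, rule tendsto_sum, rule tendsto_mult_right, rule tendsto_rabs, rule
        p_lim) auto
  have expand: "f (z y) - f (z x) - (\<Sum>i<m. partial_deriv i f (z x) * ((y - x) \<bullet> h i)) =
      (\<Sum>j<m. (partial_deriv j f ((w y j)(j := \<xi> j y)) - partial_deriv j f (z x)) * ((y - x) \<bullet> h j))"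
          for y
  proof -
    have "f (z y) = f (w y m)"
      using Cb_infinity_depends[OF f] unfolding depends_on_first_def by (auto simp: z_def w_def)
    moreover have "f (z x) = f (w y 0)"
      by (simp add: z_def w_def)
    ultimately have "f (z y) - f (z x) = (\<Sum>j<m. f (w y (Suc j)) - f (w y j))"
      using sum_lessThan_telescope[of "\<lambda>j. f (w y j)" m] by simp
    also have "\<dots> = (\<Sum>j<m. ((y - x) \<bullet> h j) * partial_deriv j f ((w y j)(j := \<xi> j y)))"
      by (intro sum.cong) (auto simp: \<xi>(2) inner_diff_left)
    finally show ?thesis
      by (simp add: left_diff_distrib right_diff_distrib sum_subtractf mult.commute)
  qed
  have bound: "norm (f (z y) - f (z x) - (\<Sum>i<m. partial_deriv i f (z x) * ((y - x) \<bullet> h i))) \<le> r y *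
      norm (y - x)" for y
    unfolding expand r_def sum_distrib_right real_norm_def
    by (rule order_trans[OF sum_abs], rule sum_mono)
      (auto simp: abs_mult Cauchy_Schwarz_ineq2 mult.assoc mult.commute[of "norm (h _)"] intro!:
          mult_left_mono)
  have z_eq: "(\<lambda>i. y \<bullet> h i) = z y" for y
    by (simp add: z_def)
  show ?thesis
    unfolding has_derivative_within z_eq
  proof (intro conjI)
    show "bounded_linear (\<lambda>d. \<Sum>i<m. partial_deriv i f (z x) * (d \<bullet> h i))"
      by (intro bounded_linear_sum bounded_linear_const_mult bounded_linear_inner_left)
    show "((\<lambda>y. (1 / norm (y - x)) *\<^sub>R (f (z y) - (f (z x) +
        (\<Sum>i<m. partial_deriv i f (z x) * ((y - x) \<bullet> h i))))) \<longlongrightarrow> 0) (at x)"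
    proof (rule Lim_null_comparison[OF _ r_lim])
      show "\<forall>\<^sub>F y in at x. norm ((1 / norm (y - x)) *\<^sub>R (f (z y) - (f (z x) +
          (\<Sum>i<m. partial_deriv i f (z x) * ((y - x) \<bullet> h i))))) \<le> r y"
        unfolding eventually_at
        using bound by (auto intro!: exI[of _ 1] simp: diff_diff_eq[symmetric] divide_simps)
    qed
  qed
qed

lemma Cb_infinity_cylinder_GDERIV:
  assumes f: "f \<in> Cb_infinity m"
  shows "GDERIV (\<lambda>x. f (\<lambda>i. x \<bullet> h i)) x :> (\<Sum>i<m. partial_deriv i f (\<lambda>i. x \<bullet> h i) *\<^sub>R h i)"
  using Cb_infinity_cylinder_has_derivative[OF f, of h x]
  by (simp add: gderiv_def inner_sum_right)

lemma grad_eqI: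
  assumes "GDERIV u x :> g"
  shows "grad u x = g"
  unfolding grad_def
proof (rule the_equality)
  show "GDERIV u x :> g" by (rule assms)
next
  fix g' assume "GDERIV u x :> g'"
  then have "(\<lambda>d. d \<bullet> g') = (\<lambda>d. d \<bullet> g)"
    using assms unfolding gderiv_def by (rule has_derivative_unique)
  then show "g' = g"
    by (metis inner_commute vector_eq_ldot)
qed

section \<open>The algebra of cylindrical functions and its gradients\<close>

lemma FCb_infinityI: "f \<in> Cb_infinity m \<Longrightarrow> (\<lambda>x. f (\<lambda>i. x \<bullet> h i)) \<in> FCb_infinity"
  unfolding FCb_infinity_def by blast

lemma FCb_infinity_GDERIV:
  assumes "u \<in> FCb_infinity"
  shows "GDERIV u x :> grad u x"
proof -
  obtain m f h where f: "f \<in> Cb_infinity m" and u: "u = (\<lambda>x. f (\<lambda>i. x \<bullet> h i))"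
    using assms unfolding FCb_infinity_def by blast
  have "GDERIV u x :> (\<Sum>i<m. partial_deriv i f (\<lambda>i. x \<bullet> h i) *\<^sub>R h i)"
    unfolding u by (rule Cb_infinity_cylinder_GDERIV[OF f])
  then show ?thesis
    by (simp only: grad_eqI)
qed

lemma grad_cylinder:
  "f \<in> Cb_infinity m \<Longrightarrow>
    grad (\<lambda>x. f (\<lambda>i. x \<bullet> h i)) x = (\<Sum>i<m. partial_deriv i f (\<lambda>i. x \<bullet> h i) *\<^sub>R h i)"
  by (rule grad_eqI[OF Cb_infinity_cylinder_GDERIV])

text \<open>Concatenating the two lists of directions puts both functions over one dimension, where
  \<open>Cb_infinity\<close> is an algebra.\<close>

lemma FCb_infinity_pair:
  fixes u v :: "'a::real_inner \<Rightarrow> real"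
  assumes "u \<in> FCb_infinity" "v \<in> FCb_infinity"
  obtains m f g h where "f \<in> Cb_infinity m" "g \<in> Cb_infinity m"
    "u = (\<lambda>x. f (\<lambda>i. x \<bullet> h i))" "v = (\<lambda>x. g (\<lambda>i. x \<bullet> h i))"
proof -
  obtain m f h m' f' h' where f: "f \<in> Cb_infinity m" "u = (\<lambda>x. f (\<lambda>i. x \<bullet> h i))"
    and f': "f' \<in> Cb_infinity m'" "v = (\<lambda>x. f' (\<lambda>i. x \<bullet> h' i))"
    using assms unfolding FCb_infinity_def by blast
  define k where "k i = (if i < m then h i else h' (i - m))" for i
  have "f (\<lambda>i. x \<bullet> h i) = f (\<lambda>i. x \<bullet> k i)" for x
    using Cb_infinity_depends[OF f(1)] unfolding depends_on_first_def by (simp add: k_def)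
  moreover have "(\<lambda>i. x \<bullet> h' i) = (\<lambda>i. x \<bullet> k (m + i))" for x
    by (simp add: k_def)
  ultimately show ?thesis
    using that[OF Cb_infinity_mono[OF f(1)] Cb_infinity_shift[OF f'(1), of m], of k] f(2) f'(2)
    by simp
qed

lemma FCb_infinity_const: "(\<lambda>x. c) \<in> FCb_infinity"
  by (rule FCb_infinityI[OF Cb_infinity_const[of c 0]])

lemma FCb_infinity_add:
  assumes "u \<in> FCb_infinity" "v \<in> FCb_infinity"
  shows "(\<lambda>x. u x + v x) \<in> FCb_infinity"
proof -
  obtain m f g h where fg: "f \<in> Cb_infinity m" "g \<in> Cb_infinity m"
    and eq: "u = (\<lambda>x. f (\<lambda>i. x \<bullet> h i))" "v = (\<lambda>x. g (\<lambda>i. x \<bullet> h i))"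
    using FCb_infinity_pair[OF assms] .
  show ?thesis
    using FCb_infinityI[OF Cb_infinity_add[OF fg], of h] unfolding eq .
qed

lemma FCb_infinity_mult:
  assumes "u \<in> FCb_infinity" "v \<in> FCb_infinity"
  shows "(\<lambda>x. u x * v x) \<in> FCb_infinity"
proof -
  obtain m f g h where fg: "f \<in> Cb_infinity m" "g \<in> Cb_infinity m"
    and eq: "u = (\<lambda>x. f (\<lambda>i. x \<bullet> h i))" "v = (\<lambda>x. g (\<lambda>i. x \<bullet> h i))"
    using FCb_infinity_pair[OF assms] .
  show ?thesis
    using FCb_infinityI[OF Cb_infinity_mult[OF fg], of h] unfolding eq .
qed

lemma FCb_infinity_lincomb:
  assumes "u \<in> FCb_infinity" "v \<in> FCb_infinity"
  shows "(\<lambda>x. a * u x + b * v x) \<in> FCb_infinity"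
  by (intro FCb_infinity_add FCb_infinity_mult FCb_infinity_const assms)

lemma FCb_infinity_cos: "(\<lambda>x. cos (x \<bullet> h)) \<in> FCb_infinity"
  using FCb_infinityI[OF Cb_infinity_cos, of "\<lambda>_. h"] by simp

lemma FCb_infinity_sin: "(\<lambda>x. sin (x \<bullet> h)) \<in> FCb_infinity"
  using FCb_infinityI[OF Cb_infinity_sin, of "\<lambda>_. h"] by simp

lemma FCb_infinity_softplus:
  assumes "u \<in> FCb_infinity"
  shows "(\<lambda>x. softplus (a * u x + b)) \<in> FCb_infinity"
proof -
  obtain m f h where f: "f \<in> Cb_infinity m" and u: "u = (\<lambda>x. f (\<lambda>i. x \<bullet> h i))"
    using assms unfolding FCb_infinity_def by blast
  then show ?thesis
    using FCb_infinityI[OF Cb_infinity_softplus[OF f, of a b], of h] by simp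
qed

lemma FCb_infinity_bounded:
  assumes "u \<in> FCb_infinity"
  obtains B where "\<And>x. \<bar>u x\<bar> \<le> B"
proof -
  obtain m f h where f: "f \<in> Cb_infinity m" and u: "u = (\<lambda>x. f (\<lambda>i. x \<bullet> h i))"
    using assms unfolding FCb_infinity_def by blast
  then show ?thesis
    using Cb_infinity_bounded[OF f] that by (auto simp: bounded_iff)
qed

lemma FCb_infinity_continuous:
  assumes "u \<in> FCb_infinity"
  shows "continuous_on UNIV u"
proof -
  have "isCont u x" for x
    using FCb_infinity_GDERIV[OF assms] unfolding gderiv_def by (rule has_derivative_continuous)
  then show ?thesis
    by (simp add: continuous_on_eq_continuous_at)
qed

text \<open>Directional derivatives occur as factors of the integrands in
  \<open>Q_form_representation\<close>; being cylindrical, they are bounded and continuous.\<close>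

lemma FCb_infinity_inner_grad:
  assumes "u \<in> FCb_infinity"
  shows "(\<lambda>x. k \<bullet> grad u x) \<in> FCb_infinity"
proof -
  obtain m f h where f: "f \<in> Cb_infinity m" and u: "u = (\<lambda>x. f (\<lambda>i. x \<bullet> h i))"
    using assms unfolding FCb_infinity_def by blast
  have "(\<lambda>y. \<Sum>i<m. partial_deriv i f y * (k \<bullet> h i)) \<in> Cb_infinity m"
    by (intro Cb_infinity_sum Cb_infinity_mult Cb_infinity_const Cb_infinity_partial_deriv f) auto
  from FCb_infinityI[OF this, of h] show ?thesis
    unfolding u grad_cylinder[OF f] by (simp add: inner_sum_right)
qed

text \<open>The gradient moves in the span of finitely many fixed directions. Later arguments use
  this expansion instead of the underlying function of several real variables.\<close>

lemma FCb_infinity_grad_expansion: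
  assumes "u \<in> FCb_infinity"
  obtains m :: nat and p h where "\<And>i. i < m \<Longrightarrow> p i \<in> FCb_infinity" "grad u =
      (\<lambda>x. \<Sum>i<m. p i x *\<^sub>R h i)"
proof -
  obtain m f h where f: "f \<in> Cb_infinity m" and u: "u = (\<lambda>x. f (\<lambda>i. x \<bullet> h i))"
    using assms unfolding FCb_infinity_def by blast
  show ?thesis
    by (rule that[of m "\<lambda>i x. partial_deriv i f (\<lambda>i. x \<bullet> h i)" h])
      (auto simp: u grad_cylinder[OF f] intro!: FCb_infinityI Cb_infinity_partial_deriv f)
qed

lemma FCb_infinity_grad_continuous:
  assumes "u \<in> FCb_infinity"
  shows "continuous_on UNIV (grad u)"
proof -
  obtain m :: nat and p h where p: "\<And>i. i < m \<Longrightarrow> p i \<in> FCb_infinity"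
    and g: "grad u = (\<lambda>x. \<Sum>i<m. p i x *\<^sub>R h i)"
    using FCb_infinity_grad_expansion[OF assms] by blast
  show ?thesis
    unfolding g by (intro continuous_intros FCb_infinity_continuous p) auto
qed

lemma FCb_infinity_grad_bounded:
  assumes "u \<in> FCb_infinity"
  obtains B where "\<And>x. norm (grad u x) \<le> B"
proof -
  obtain m :: nat and p h where p: "\<And>i. i < m \<Longrightarrow> p i \<in> FCb_infinity"
    and g: "grad u = (\<lambda>x. \<Sum>i<m. p i x *\<^sub>R h i)"
    using FCb_infinity_grad_expansion[OF assms] by blast
  have "\<exists>B. \<forall>x. \<bar>p i x\<bar> \<le> B" if "i < m" for i
    by (rule FCb_infinity_bounded[OF p[OF that]]) blast
  then obtain B where "\<And>i x. i < m \<Longrightarrow> \<bar>p i x\<bar> \<le> B i"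
    by metis
  then have "norm (grad u x) \<le> (\<Sum>i<m. B i * norm (h i))" for x
    unfolding g by (intro order_trans[OF norm_sum] sum_mono) (auto intro: mult_right_mono)
  then show ?thesis
    using that by blast
qed

lemma grad_lincomb:
  assumes "u \<in> FCb_infinity" "v \<in> FCb_infinity"
  shows "grad (\<lambda>x. a * u x + b * v x) x = a *\<^sub>R grad u x + b *\<^sub>R grad v x"
proof (rule grad_eqI)
  show "GDERIV (\<lambda>x. a * u x + b * v x) x :> a *\<^sub>R grad u x + b *\<^sub>R grad v x"
    using FCb_infinity_GDERIV[OF assms(1), of x] FCb_infinity_GDERIV[OF assms(2), of x]
    unfolding gderiv_def by (auto intro!: derivative_eq_intros simp: inner_add_right)
qed

lemma grad_mult:
  assumes "u \<in> FCb_infinity" "v \<in> FCb_infinity"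
  shows "grad (\<lambda>x. u x * v x) x = u x *\<^sub>R grad v x + v x *\<^sub>R grad u x"
  by (intro grad_eqI GDERIV_mult FCb_infinity_GDERIV assms)

lemma grad_compose:
  assumes "u \<in> FCb_infinity" "(p has_real_derivative d) (at (u x))"
  shows "grad (\<lambda>x. p (u x)) x = d *\<^sub>R grad u x"
  by (intro grad_eqI GDERIV_DERIV_compose FCb_infinity_GDERIV assms)

section \<open>Bounded Borel functions as limits of trigonometric functions\<close>

text \<open>Difference quotients along a sequence are the form in which dominated convergence and
  measurability of pointwise limits apply.\<close>

lemma DERIV_sequentially:
  fixes f :: "real \<Rightarrow> real"
  assumes "(f has_real_derivative D) (at 0)"
  shows "(\<lambda>n. real (Suc n) * (f (inverse (real (Suc n))) - f 0)) \<longlonglongrightarrow> D"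
proof -
  have 1: "((\<lambda>t. (f (0 + t) - f 0) / t) \<longlongrightarrow> D) (at 0)"
    using assms by (simp only: DERIV_def)
  have 2: "filterlim (\<lambda>n. inverse (real (Suc n))) (at 0) sequentially"
    by (rule filterlim_atI[OF LIMSEQ_inverse_real_of_nat]) (simp add: always_eventually)
  show ?thesis
    using filterlim_compose[OF 1 2]
    by (simp only: divide_inverse inverse_inverse_eq add_0 mult.commute)
qed

text \<open>The rule \<open>lim\<close> has infinitely many premises, so limits may be iterated
  without end. Rule induction then acts as a functional monotone class theorem: what holds for sines
  and cosines and survives linear combinations and bounded pointwise limits holds on the whole
  set.\<close>

inductive_set trig_closure :: "('a::real_inner \<Rightarrow> real) set" where
  cos: "(\<lambda>x. cos (x \<bullet> h)) \<in> trig_closure"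
| sin: "(\<lambda>x. sin (x \<bullet> h)) \<in> trig_closure"
| lincomb: "v \<in> trig_closure \<Longrightarrow> w \<in> trig_closure \<Longrightarrow> (\<lambda>x. a * v x + b * w x) \<in> trig_closure"
| lim: "(\<And>n. W n \<in> trig_closure) \<Longrightarrow> (\<And>n x. \<bar>W n x\<bar> \<le> B) \<Longrightarrow> (\<And>x. (\<lambda>n. W n x) \<longlonglongrightarrow> w x)
    \<Longrightarrow> w \<in> trig_closure"

lemma trig_closure_bounded:
  assumes "w \<in> trig_closure"
  obtains B where "\<And>x. \<bar>w x\<bar> \<le> B"
proof -
  have "\<exists>B. \<forall>x. \<bar>w x\<bar> \<le> B"
    using assms
  proof induction
    case (lincomb v w a b)
    then obtain B C where *: "\<And>x. \<bar>v x\<bar> \<le> B" "\<And>x. \<bar>w x\<bar> \<le> C"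
      by blast
    have "\<bar>a * v x + b * w x\<bar> \<le> \<bar>a\<bar> * B + \<bar>b\<bar> * C" for x
      by (rule order_trans[OF abs_triangle_ineq])
          (auto simp: abs_mult intro!: add_mono mult_left_mono *)
    then show ?case by blast
  next
    case (lim W B w)
    then have "\<bar>w x\<bar> \<le> B" for x
      by (intro LIMSEQ_le_const2[OF tendsto_rabs[OF lim.hyps(3)]]) auto
    then show ?case by blast
  qed (auto intro: exI[of _ 1])
  then show ?thesis using that by blast
qed

lemma trig_closure_const: "(\<lambda>x::'a::real_inner. c) \<in> trig_closure"
  using trig_closure.lincomb[OF trig_closure.cos[of "0::'a"] trig_closure.cos[of "0::'a"], of c 0]
      by simp

lemma trig_closure_add:
  "v \<in> trig_closure \<Longrightarrow> w \<in> trig_closure \<Longrightarrow> (\<lambda>x. v x + w x) \<in> trig_closure"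
  using trig_closure.lincomb[of v w 1 1] by simp

lemma trig_closure_diff:
  "v \<in> trig_closure \<Longrightarrow> w \<in> trig_closure \<Longrightarrow> (\<lambda>x. v x - w x) \<in> trig_closure"
  using trig_closure.lincomb[of v w 1 "-1"] by simp

lemma trig_closure_scale:
  "w \<in> trig_closure \<Longrightarrow> (\<lambda>x. c * w x) \<in> trig_closure"
  using trig_closure.lincomb[of w w c 0] by simp

text \<open>Product-to-sum formulas settle two trigonometric factors. One induction over the second
  factor keeps the first trigonometric; another, over the first factor, then allows an arbitrary
  second one.\<close>

lemma trig_closure_mult:
  assumes v: "v \<in> trig_closure" and w: "w \<in> trig_closure"
  shows "(\<lambda>x. v x * w x) \<in> trig_closure"
proof -
  have limit: "(\<lambda>x. u x * w x) \<in> trig_closure"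
    if "\<And>n. (\<lambda>x. u x * W n x) \<in> trig_closure" "\<And>x. \<bar>u x\<bar> \<le> C"
      "\<And>n x. \<bar>W n x\<bar> \<le> B" "\<And>x. (\<lambda>n. W n x) \<longlonglongrightarrow> w x" for u W B C and w :: "'a \<Rightarrow> real"
  proof (rule trig_closure.lim)
    show "\<bar>u x * W n x\<bar> \<le> C * B" for n x
      unfolding abs_mult using that(2,3) by (intro mult_mono)
          (auto intro: order_trans[OF abs_ge_zero])
    show "(\<lambda>n. u x * W n x) \<longlonglongrightarrow> u x * w x" for x
      by (intro tendsto_intros that)
  qed (rule that(1))
  have trig: "(\<lambda>x. t x * w x) \<in> trig_closure"
    if t: "t = (\<lambda>x. cos (x \<bullet> h)) \<or> t = (\<lambda>x. sin (x \<bullet> h))" and "w \<in> trig_closure"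
        for t h and w :: "'a \<Rightarrow> real"
    using that(2)
  proof induction
    case (cos k)
    have 1: "(\<lambda>x. cos (x \<bullet> h) * cos (x \<bullet> k)) =
        (\<lambda>x. (1/2) * cos (x \<bullet> (h - k)) + (1/2) * cos (x \<bullet> (h + k)))"
      by (simp add: cos_times_cos inner_add_right inner_diff_right add_divide_distrib)
    have 2: "(\<lambda>x. sin (x \<bullet> h) * cos (x \<bullet> k)) =
        (\<lambda>x. (1/2) * sin (x \<bullet> (h + k)) + (1/2) * sin (x \<bullet> (h - k)))"
      by (simp add: sin_times_cos inner_add_right inner_diff_right add_divide_distrib)
    show ?case
      using t by (elim disjE; simp only: 1 2; intro trig_closure.intros)
  next
    case (sin k)
    have 1: "(\<lambda>x. cos (x \<bullet> h) * sin (x \<bullet> k)) =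
        (\<lambda>x. (1/2) * sin (x \<bullet> (h + k)) + (-1/2) * sin (x \<bullet> (h - k)))"
      by (simp add: cos_times_sin inner_add_right inner_diff_right diff_divide_distrib)
    have 2: "(\<lambda>x. sin (x \<bullet> h) * sin (x \<bullet> k)) =
        (\<lambda>x. (1/2) * cos (x \<bullet> (h - k)) + (-1/2) * cos (x \<bullet> (h + k)))"
      by (simp add: sin_times_sin inner_add_right inner_diff_right diff_divide_distrib)
    show ?case
      using t by (elim disjE; simp only: 1 2; intro trig_closure.intros)
  next
    case (lincomb v w a b)
    have eq: "(\<lambda>x. t x * (a * v x + b * w x)) = (\<lambda>x. a * (t x * v x) + b * (t x * w x))"
      by (simp add: algebra_simps)
    show ?case
      unfolding eq by (rule trig_closure.lincomb[OF lincomb.IH])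
  next
    case (lim W B w)
    have "\<bar>t x\<bar> \<le> 1" for x
      using t by auto
    then show ?case
      by (rule limit[OF lim.IH _ lim.hyps(2,3)])
  qed
  show ?thesis
    using v
  proof induction
    case (lincomb u v a b)
    have eq: "(\<lambda>x. (a * u x + b * v x) * w x) = (\<lambda>x. a * (u x * w x) + b * (v x * w x))"
      by (simp add: algebra_simps)
    show ?case
      unfolding eq by (rule trig_closure.lincomb[OF lincomb.IH])
  next
    case (lim W B v)
    obtain C where "\<And>x. \<bar>w x\<bar> \<le> C"
      using trig_closure_bounded[OF w] by blast
    then have "(\<lambda>x. w x * v x) \<in> trig_closure"
      using lim by (intro limit[of w W C B v]) (auto simp: mult.commute)
    then show ?case
      by (simp add: mult.commute)
  qed (use trig[OF _ w] in auto)
qed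

lemma trig_closure_polynomial:
  assumes w: "w \<in> trig_closure" and p: "real_polynomial_function p"
  shows "(\<lambda>x. p (w x)) \<in> trig_closure"
  using p
proof induction
  case (linear f)
  then interpret bounded_linear f .
  have "f (w x) = f 1 * w x" for x
    using scale[of "w x" 1] by simp
  then show ?case
    using trig_closure_scale[OF w, of "f 1"] by simp
qed (use w in \<open>auto intro: trig_closure_const trig_closure_add trig_closure_mult\<close>)

text \<open>Boundedness of \<open>w\<close> is what makes this work: polynomials approximate
  \<open>g\<close> uniformly on the compact interval \<open>{-B..B}\<close> that contains all values
  of \<open>w\<close>.\<close>

lemma trig_closure_compose:
  assumes w: "w \<in> trig_closure" and g: "continuous_on UNIV (g :: real \<Rightarrow> real)"
  shows "(\<lambda>x. g (w x)) \<in> trig_closure"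
proof -
  obtain B where B: "\<And>x. w x \<in> {-B..B}"
    using trig_closure_bounded[OF w] by (metis abs_le_iff atLeastAtMost_iff minus_le_iff)
  have "\<exists>p. real_polynomial_function p \<and> (\<forall>t\<in>{-B..B}. \<bar>g t - p t\<bar> < inverse (real (Suc n)))" for n
  proof -
    have "continuous_on {-B..B} g"
      using g continuous_on_subset by blast
    moreover have "0 < inverse (real (Suc n))"
      by simp
    ultimately show ?thesis
      by (rule Stone_Weierstrass_real_polynomial_function[OF compact_Icc]) blast
  qed
  then obtain p where p: "\<And>n. real_polynomial_function (p n)"
    "\<And>n t. t \<in> {-B..B} \<Longrightarrow> \<bar>g t - p n t\<bar> < inverse (real (Suc n))"
    by metis
  have "compact (g ` {-B..B})"
    using g by (intro compact_continuous_image) (auto intro: continuous_on_subset)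
  then obtain C where C: "\<And>t. t \<in> {-B..B} \<Longrightarrow> \<bar>g t\<bar> \<le> C"
    using compact_imp_bounded by (fastforce simp: bounded_iff)
  show ?thesis
  proof (rule trig_closure.lim)
    show "(\<lambda>x. p n (w x)) \<in> trig_closure" for n
      by (rule trig_closure_polynomial[OF w p(1)])
    show "\<bar>p n (w x)\<bar> \<le> C + 1" for n x
    proof -
      have "inverse (real (Suc n)) \<le> 1"
        by (simp add: inverse_le_1_iff)
      then show ?thesis
        using p(2)[OF B, of x n] C[OF B, of x] by linarith
    qed
    show "(\<lambda>n. p n (w x)) \<longlonglongrightarrow> g (w x)" for x
    proof (rule LIM_zero_cancel, rule Lim_null_comparison[OF _ LIMSEQ_inverse_real_of_nat])
      show "\<forall>\<^sub>F n in sequentially. norm (p n (w x) - g (w x)) \<le> inverse (real (Suc n))"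
        using p(2)[OF B, of x] by (auto simp: abs_minus_commute intro!: always_eventually
            less_imp_le)
    qed
  qed
qed

text \<open>Steeper and steeper ramps starting at \<open>a\<close> increase to the indicator. The
  inequality is strict because every ramp vanishes where \<open>w x = a\<close>.\<close>

lemma trig_closure_indicator_gt:
  assumes w: "w \<in> trig_closure"
  shows "indicator {x. a < w x} \<in> trig_closure"
proof (rule trig_closure.lim)
  let ?g = "\<lambda>n t. min 1 (max 0 (real n * (t - a)))"
  show "(\<lambda>x. ?g n (w x)) \<in> trig_closure" for n
    by (rule trig_closure_compose[OF w]) (intro continuous_intros)
  show "\<bar>?g n (w x)\<bar> \<le> 1" for n x
    by auto
  show "(\<lambda>n. ?g n (w x)) \<longlonglongrightarrow> indicator {x. a < w x} x" for x
  proof (cases "a < w x")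
    case True
    have "\<forall>\<^sub>F n in sequentially. 1 \<le> real n * (w x - a)"
    proof -
      obtain N where "1 / (w x - a) \<le> real N"
        using real_arch_simple by blast
      then have "1 \<le> real n * (w x - a)" if "n \<ge> N" for n
      proof -
        have "1 = 1 / (w x - a) * (w x - a)"
          using True by simp
        also have "\<dots> \<le> real n * (w x - a)"
          using that True \<open>1 / (w x - a) \<le> real N\<close> by (intro mult_right_mono) auto
        finally show ?thesis .
      qed
      then show ?thesis
        by (auto simp: eventually_sequentially)
    qed
    then have "\<forall>\<^sub>F n in sequentially. ?g n (w x) = 1"
      by eventually_elim auto
    then show ?thesis
      using True by (simp add: tendsto_eventually)
  next
    case False
    then have "real n * (w x - a) \<le> 0" for n
      by (simp add: mult_le_0_iff)
    then have "?g n (w x) = 0" for n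
      by (simp add: max_absorb1)
    then show ?thesis
      using False by simp
  qed
qed

text \<open>Complements are differences from 1, intersections are products of indicators, and
  countable intersections are bounded limits of finite ones.\<close>

lemma sigma_algebra_trig_closure:
  "sigma_algebra UNIV {A. indicator A \<in> (trig_closure :: ('a::real_inner \<Rightarrow> real) set)}"
proof -
  let ?M = "{A :: 'a set. indicator A \<in> (trig_closure :: ('a \<Rightarrow> real) set)}"
  have compl: "UNIV - A \<in> ?M" if "A \<in> ?M" for A
  proof -
    have "indicator (UNIV - A) = (\<lambda>x. 1 - indicator A x :: real)"
      by (auto simp: indicator_def)
    then show ?thesis
      using that trig_closure_diff[OF trig_closure_const] by auto
  qed
  have inter: "A \<inter> B \<in> ?M" if "A \<in> ?M" "B \<in> ?M" for A B
  proof -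
    have "indicator (A \<inter> B) = (\<lambda>x. indicator A x * indicator B x :: real)"
      by (auto simp: indicator_def)
    then show ?thesis
      using that trig_closure_mult by auto
  qed
  have finite_inter: "(\<Inter>i<n. A i) \<in> ?M" if "\<And>i. A i \<in> ?M" for A and n :: nat
  proof (induction n)
    case 0
    have "indicator UNIV = (\<lambda>x::'a. 1 :: real)"
      by (auto simp: indicator_def)
    then show ?case
      by (simp add: trig_closure_const)
  next
    case (Suc n)
    then show ?case
      using inter[OF that Suc] by (simp add: lessThan_Suc)
  qed
  have cinter: "(\<Inter>i. A i) \<in> ?M" if A: "\<And>i. A i \<in> ?M" for A :: "nat \<Rightarrow> 'a set"
  proof (simp, rule trig_closure.lim)
    show "indicator (\<Inter>i<n. A i) \<in> (trig_closure :: ('a \<Rightarrow> real) set)" for n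
      using finite_inter[of A n] A by simp
    show "\<bar>indicator (\<Inter>i<n. A i) x\<bar> \<le> (1::real)" for n x
      by (simp add: indicator_def)
    show "(\<lambda>n. indicator (\<Inter>i<n. A i) x :: real) \<longlonglongrightarrow> indicator (\<Inter>i. A i) x" for x
      by (rule LIMSEQ_indicator_INT)
  qed
  show ?thesis
    unfolding sigma_algebra_iff2
  proof (intro conjI ballI allI impI)
    show "{} \<in> ?M"
    proof -
      have "indicator {} = (\<lambda>x::'a. 0 :: real)"
        by auto
      then show ?thesis
        by (simp add: trig_closure_const)
    qed
    show "(\<Union>i. A i) \<in> ?M" if "range A \<subseteq> ?M" for A :: "nat \<Rightarrow> 'a set"
    proof -
      have "UNIV - (\<Inter>i. UNIV - A i) \<in> ?M"
        using that by (intro compl cinter) auto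
      moreover have "UNIV - (\<Inter>i. UNIV - A i) = (\<Union>i. A i)"
        by auto
      ultimately show ?thesis by simp
    qed
  qed (use compl in auto)
qed

text \<open>The norm is the supremum of \<open>x \<bullet> k\<close> over a countable dense set of \<open>k\<close>, weighted by \<open>norm k\<close>;
  hence half-spaces generate the closed balls, and by separability the Borel sets.\<close>

lemma norm_le_iff_dense:
  fixes y :: "'a::real_inner"
  assumes K: "closure K = UNIV" and "0 \<le> r"
  shows "norm y \<le> r \<longleftrightarrow> (\<forall>k\<in>K. y \<bullet> k \<le> r * norm k)"
proof
  assume "norm y \<le> r"
  then show "\<forall>k\<in>K. y \<bullet> k \<le> r * norm k"
    by (metis mult_right_mono norm_cauchy_schwarz norm_ge_zero order_trans)
next
  assume "\<forall>k\<in>K. y \<bullet> k \<le> r * norm k"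
  then have "K \<subseteq> {k. y \<bullet> k \<le> r * norm k}"
    by auto
  moreover have "closed {k. y \<bullet> k \<le> r * norm k}"
    by (intro closed_Collect_le continuous_intros)
  ultimately have "closure K \<subseteq> {k. y \<bullet> k \<le> r * norm k}"
    by (rule closure_minimal)
  then have "y \<bullet> y \<le> r * norm y"
    using K by auto
  then have "norm y * norm y \<le> r * norm y"
    by (simp add: dot_square_norm power2_eq_square)
  then show "norm y \<le> r"
    using \<open>0 \<le> r\<close> by (cases "norm y = 0") (auto intro: mult_right_le_imp_le)
qed

lemma trig_closure_borel_set:
  fixes A :: "'a::{real_inner, second_countable_topology} set"
  assumes "A \<in> sets borel"
  shows "indicator A \<in> trig_closure"
proof -
  let ?M = "{A :: 'a set. indicator A \<in> (trig_closure :: ('a \<Rightarrow> real) set)}"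
  define N where "N = sigma UNIV ?M"
  interpret sigma_algebra UNIV ?M
    by (rule sigma_algebra_trig_closure)
  have N: "sets N = ?M" "space N = UNIV"
    unfolding N_def by (simp_all add: sets_measure_of_eq space_measure_of_conv)
  have closure_meas: "w \<in> borel_measurable N" if "w \<in> trig_closure" for w
    unfolding borel_measurable_iff_greater
    using trig_closure_indicator_gt[OF that] by (simp add: N)
  \<comment> \<open>For nonzero \<open>h\<close> the functional is unbounded and hence outside
    \<open>trig_closure\<close>. It is still \<open>N\<close>-measurable, as the pointwise limit of
    multiples of \<open>sin\<close> that do belong to the closure.\<close>
  have meas: "(\<lambda>x. x \<bullet> h) \<in> borel_measurable N" for h
  proof (rule borel_measurable_LIMSEQ_real)
    show "(\<lambda>x. real (Suc n) * sin (x \<bullet> (inverse (real (Suc n)) *\<^sub>R h))) \<in> borel_measurable N" for n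
      by (intro borel_measurable_times borel_measurable_const closure_meas trig_closure.sin)
    show "(\<lambda>n. real (Suc n) * sin (x \<bullet> (inverse (real (Suc n)) *\<^sub>R h))) \<longlonglongrightarrow> x \<bullet> h" for x
    proof -
      have "((\<lambda>t. sin (t * (x \<bullet> h))) has_real_derivative x \<bullet> h) (at 0)"
        by (auto intro!: derivative_eq_intros)
      from DERIV_sequentially[OF this] show ?thesis
        by (simp only: inner_scaleR_right mult_zero_left sin_zero diff_zero)
    qed
  qed
  obtain K :: "'a set" where K: "countable K" "\<And>X. open X \<Longrightarrow> X \<noteq> {} \<Longrightarrow> \<exists>d\<in>K. d \<in> X"
    using countable_dense_setE by blast
  have "closure K = UNIV"
  proof (rule ccontr)
    assume "closure K \<noteq> UNIV"
    then obtain d where "d \<in> K" "d \<in> - closure K"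
      using K(2)[of "- closure K"] by auto
    then show False
      using closure_subset by auto
  qed
  have dist_meas: "(\<lambda>x. norm (x - c)) \<in> borel_measurable N" for c
    unfolding borel_measurable_iff_le
  proof
    fix r :: real
    show "{x \<in> space N. norm (x - c) \<le> r} \<in> sets N"
    proof (cases "0 \<le> r")
      case True
      have *: "norm (x - c) \<le> r \<longleftrightarrow> (\<forall>k\<in>K. x \<bullet> k - c \<bullet> k \<le> r * norm k)" for x
        unfolding norm_le_iff_dense[OF \<open>closure K = UNIV\<close> True] inner_diff_left ..
      have "(\<Inter>k\<in>K. {x \<in> space N. x \<bullet> k - c \<bullet> k \<le> r * norm k}) \<in> sets N"
        using K(1) N by (intro sets.countable_INT'' borel_measurable_le borel_measurable_diff
            meas borel_measurable_const) (auto simp: trig_closure_const)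
      moreover have "{x \<in> space N. norm (x - c) \<le> r} =
          (\<Inter>k\<in>K. {x \<in> space N. x \<bullet> k - c \<bullet> k \<le> r * norm k})"
        unfolding * by (auto simp: N)
      ultimately show ?thesis by simp
    next
      case False
      then have "\<not> norm (x - c) \<le> r" for x
        using norm_ge_zero[of "x - c"] by linarith
      then show ?thesis by simp
    qed
  qed
  have ball_N: "ball c r \<in> sets N" for c r
  proof -
    have "{x \<in> space N. norm (x - c) < r} \<in> sets N"
      by (intro borel_measurable_less dist_meas borel_measurable_const)
    moreover have "ball c r = {x \<in> space N. norm (x - c) < r}"
      by (auto simp: dist_norm norm_minus_commute N)
    ultimately show ?thesis by simp
  qed
  have "U \<in> sets N" if "open U" for U
  proof -
    \<comment> \<open>All balls inside \<open>U\<close>, in general an uncountable family;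
      Lindelof's theorem selects countably many with the same union.\<close>
    define F where "F = {ball c r | c r. ball c r \<subseteq> U}"
    obtain F' where F': "F' \<subseteq> F" "countable F'" "\<Union>F' = \<Union>F"
      using Lindelof[of F] unfolding F_def by blast
    have "\<Union>F = U"
    proof
      show "U \<subseteq> \<Union>F"
      proof
        fix x assume "x \<in> U"
        then obtain e where "0 < e" "ball x e \<subseteq> U"
          using \<open>open U\<close> openE by blast
        then show "x \<in> \<Union>F"
          unfolding F_def by (intro UnionI[of "ball x e"] CollectI exI conjI) simp_all
      qed
    qed (auto simp: F_def)
    moreover have "\<Union>F' \<in> sets N"
      using F' ball_N unfolding F_def by (intro sets.countable_Union) auto
    ultimately show ?thesis
      using F' by simp
  qed
  then have "sets borel \<subseteq> sets N"
    unfolding borel_def using sets.sigma_sets_subset[of "{S. open S}" N] by (auto simp: N)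
  then show ?thesis
    using assms by (auto simp: N)
qed

theorem bounded_borel_trig_closure:
  fixes w :: "'a::{real_inner, second_countable_topology} \<Rightarrow> real"
  assumes "w \<in> borel_measurable borel" "\<And>x. \<bar>w x\<bar> \<le> B"
  shows "w \<in> trig_closure"
proof -
  \<comment> \<open>Boundedness is part of the induction statement: for nonnegative summands and
    increasing limits, a bound of the result bounds the constituents as well.\<close>
  have nonneg: "(\<exists>B. \<forall>x. v x \<le> B) \<longrightarrow> v \<in> trig_closure"
    if "v \<in> borel_measurable borel" "\<And>x. 0 \<le> v x" for v :: "'a \<Rightarrow> real"
    using that
  proof (induction rule: borel_measurable_induct_real)
    case (set A)
    then show ?case
      by (simp add: trig_closure_borel_set)
  next
    case (mult u c)
    show ?case
    proof (intro impI, elim exE)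
      fix B assume B: "\<forall>x. c * u x \<le> B"
      show "(\<lambda>x. c * u x) \<in> trig_closure"
      proof (cases "c = 0")
        case False
        then have "u x \<le> B / c" for x
          using B \<open>0 \<le> c\<close> by (simp add: field_simps)
        then show ?thesis
          using mult by (intro trig_closure_scale) blast
      qed (simp add: trig_closure_const)
    qed
  next
    case (add u v)
    show ?case
    proof (intro impI, elim exE)
      fix B assume B: "\<forall>x. v x + u x \<le> B"
      have "u x \<le> B" "v x \<le> B" for x
        using B[rule_format, of x] \<open>\<And>x. 0 \<le> u x\<close>[of x] \<open>\<And>x. 0 \<le> v x\<close>[of x] by linarith+
      then show "(\<lambda>x. v x + u x) \<in> trig_closure"
        using add by (intro trig_closure_add) blast+
    qed
  next
    case (seq U)
    show ?case
    proof (intro impI, elim exE)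
      fix B assume B: "\<forall>x. v x \<le> B"
      have le: "U i x \<le> B" for i x
      proof -
        have "incseq (\<lambda>i. U i x)"
          using \<open>incseq U\<close> by (auto simp: incseq_def le_fun_def)
        then have "U i x \<le> v x"
          using \<open>\<And>x. x \<in> space borel \<Longrightarrow> (\<lambda>i. U i x) \<longlonglongrightarrow> v x\<close> by (intro incseq_le) auto
        then show ?thesis
          using B order_trans by blast
      qed
      show "v \<in> trig_closure"
      proof (rule trig_closure.lim)
        show "U i \<in> trig_closure" for i
          using seq.IH le by blast
        show "\<bar>U i x\<bar> \<le> B" for i x
          using le \<open>\<And>i x. 0 \<le> U i x\<close> by simp
        show "(\<lambda>i. U i x) \<longlonglongrightarrow> v x" for x
          using \<open>\<And>x. x \<in> space borel \<Longrightarrow> (\<lambda>i. U i x) \<longlonglongrightarrow> v x\<close> by simp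
      qed
    qed
  qed
  have "(\<lambda>x. w x + B) \<in> trig_closure"
  proof (rule nonneg[rule_format])
    show "0 \<le> w x + B" for x
      using assms(2)[of x] by linarith
    show "\<exists>C. \<forall>x. w x + B \<le> C"
      using assms(2) by (intro exI[of _ "B + B"]) (auto simp: abs_le_iff)
  qed (use assms in measurable)
  from trig_closure_diff[OF this trig_closure_const[of B]] show ?thesis
    by simp
qed

section \<open>Closable forms on an \<open>L\<^sup>2\<close> space\<close>

abbreviation sq_dist :: "'x form \<Rightarrow> ('x \<Rightarrow> real) \<Rightarrow> ('x \<Rightarrow> real) \<Rightarrow> real" where
  "sq_dist E u v \<equiv> E (\<lambda>x. u x - v x) (\<lambda>x. u x - v x)"

locale sym_form =
  fixes M :: "'x measure" and Dom :: "('x \<Rightarrow> real) set" and E :: "'x form"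
  assumes form: "symmetric_form M Dom E"
begin

lemma Dom_L2: "Dom \<subseteq> L2_space M"
  and zero_in: "(\<lambda>x. 0) \<in> Dom"
  and lincomb_in: "u \<in> Dom \<Longrightarrow> v \<in> Dom \<Longrightarrow> (\<lambda>x. a * u x + b * v x) \<in> Dom"
  and lincomb_left: "u \<in> Dom \<Longrightarrow> v \<in> Dom \<Longrightarrow> w \<in> Dom \<Longrightarrow>
    E (\<lambda>x. a * u x + b * v x) w = a * E u w + b * E v w"
  and symm: "u \<in> Dom \<Longrightarrow> v \<in> Dom \<Longrightarrow> E u v = E v u"
  and nonneg: "u \<in> Dom \<Longrightarrow> 0 \<le> E u u"
  using form unfolding symmetric_form_def by blast+

lemma diff_in: "u \<in> Dom \<Longrightarrow> v \<in> Dom \<Longrightarrow> (\<lambda>x. u x - v x) \<in> Dom"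
  using lincomb_in[of u v 1 "-1"] by simp

lemma diff_left: "u \<in> Dom \<Longrightarrow> v \<in> Dom \<Longrightarrow> w \<in> Dom \<Longrightarrow> E (\<lambda>x. u x - v x) w = E u w - E v w"
  using lincomb_left[of u v w 1 "-1"] by simp

lemma lincomb_right:
  assumes "u \<in> Dom" "v \<in> Dom" "w \<in> Dom"
  shows "E w (\<lambda>x. a * u x + b * v x) = a * E w u + b * E w v"
  using lincomb_left[OF assms, of a b] symm assms lincomb_in by metis

lemma diff_right: "u \<in> Dom \<Longrightarrow> v \<in> Dom \<Longrightarrow> w \<in> Dom \<Longrightarrow> E w (\<lambda>x. u x - v x) = E w u - E w v"
  using lincomb_right[of u v w 1 "-1"] by simp

lemma quadratic:
  assumes "u \<in> Dom" "v \<in> Dom"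
  shows "E (\<lambda>x. a * u x + b * v x) (\<lambda>x. a * u x + b * v x) = a\<^sup>2 * E u u + 2 * a * b * E u v + b\<^sup>2 *
      E v v"
  using assms
  by (simp add: lincomb_left lincomb_right lincomb_in symm[of v u] power2_eq_square algebra_simps)

lemma quadratic_diff:
  assumes "u \<in> Dom" "v \<in> Dom"
  shows "sq_dist E u v = E u u - 2 * E u v + E v v"
  using quadratic[OF assms, of 1 "-1"] by simp

lemma diff_swap:
  assumes "u \<in> Dom" "v \<in> Dom"
  shows "sq_dist E u v = sq_dist E v u"
  using assms by (simp add: quadratic_diff symm[of v u])

text \<open>The right side minus the left side is the value of the form at
  \<open>a * u - b * v\<close>. This takes the place of the triangle inequality; squares cost a
  factor 2.\<close>

lemma lincomb_le:
  assumes "u \<in> Dom" "v \<in> Dom"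
  shows "E (\<lambda>x. a * u x + b * v x) (\<lambda>x. a * u x + b * v x) \<le> 2 * a\<^sup>2 * E u u + 2 * b\<^sup>2 * E v v"
  using quadratic[OF assms, of a b] quadratic[OF assms, of a "-b"]
      nonneg[OF lincomb_in[OF assms, of a "-b"]]
  by (simp add: algebra_simps)

lemma triangle_le:
  assumes "u \<in> Dom" "v \<in> Dom" "w \<in> Dom"
  shows "sq_dist E u w \<le>
    2 * sq_dist E u v + 2 * sq_dist E v w"
  using lincomb_le[OF diff_in[OF assms(1,2)] diff_in[OF assms(2,3)], of 1 1] by simp

lemma Cauchy_Schwarz:
  assumes "u \<in> Dom" "v \<in> Dom"
  shows "(E u v)\<^sup>2 \<le> E u u * E v v"
proof -
  have pos: "0 \<le> a\<^sup>2 * E u u + 2 * a * b * E u v + b\<^sup>2 * E v v" for a b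
    using nonneg[OF lincomb_in[OF assms, of a b]] quadratic[OF assms] by simp
  show ?thesis
  proof (cases "E v v = 0")
    case True
    have "E u v = 0"
    proof (rule ccontr)
      assume "E u v \<noteq> 0"
      \<comment> \<open>With this second coefficient the quadratic polynomial takes the value -1,
        against its nonnegativity.\<close>
      then show False
        using pos[of 1 "- (E u u + 1) / (2 * E u v)"] nonneg[OF assms(1)] True by
            (simp add: field_simps)
    qed
    then show ?thesis
      using True by simp
  next
    case False
    then have "0 < E v v"
      using nonneg[OF assms(2)] by simp
    \<comment> \<open>The minimiser \<open>- E u v / E v v\<close> of the polynomial, multiplied by
      \<open>E v v\<close> to avoid the quotient.\<close>
    have "0 \<le> E v v * (E u u * E v v - (E u v)\<^sup>2)"
      using pos[of "E v v" "- E u v"] by (simp add: power2_eq_square algebra_simps)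
    then show ?thesis
      using \<open>0 < E v v\<close> by (simp add: zero_le_mult_iff)
  qed
qed

lemma tendsto_zero_left:
  assumes "\<And>n. U n \<in> Dom" "\<And>n. V n \<in> Dom" "(\<lambda>n. E (U n) (U n)) \<longlonglongrightarrow> 0" "\<And>n. E (V n) (V n) \<le> C"
  shows "(\<lambda>n. E (U n) (V n)) \<longlonglongrightarrow> 0"
proof -
  have "(\<lambda>n. (E (U n) (V n))\<^sup>2) \<longlonglongrightarrow> 0"
  proof (rule Lim_null_comparison)
    show "\<forall>\<^sub>F n in sequentially. norm ((E (U n) (V n))\<^sup>2) \<le> E (U n) (U n) * C"
      using assms by (auto intro!: always_eventually order_trans[OF Cauchy_Schwarz] mult_left_mono
          nonneg)
    show "(\<lambda>n. E (U n) (U n) * C) \<longlonglongrightarrow> 0"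
      using tendsto_mult_right[OF assms(3), of C] by simp
  qed
  then show ?thesis
    by simp
qed

lemma Cauchy_bounded:
  assumes U: "\<And>n. U n \<in> Dom" and "form_Cauchy E U"
  obtains C where "\<And>n. E (U n) (U n) \<le> C"
proof -
  obtain N where N: "\<And>m n. m \<ge> N \<Longrightarrow> n \<ge> N \<Longrightarrow> sq_dist E (U m) (U n) < 1"
    using assms(2) unfolding form_Cauchy_def by (meson zero_less_one)
  \<comment> \<open>The sum bounds the terms up to \<open>N\<close>. Later terms are within distance
    1 of \<open>U N\<close>, which gives \<open>2 * 1 + 2 * E (U N) (U N)\<close>.\<close>
  define C where "C = (\<Sum>n\<le>N. E (U n) (U n)) + (2 + 2 * E (U N) (U N))"
  have "E (U n) (U n) \<le> C" for n
  proof (cases "n \<le> N")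
    case True
    then have "E (U n) (U n) \<le> (\<Sum>n\<le>N. E (U n) (U n))"
      using nonneg[OF U] by (intro member_le_sum) auto
    then show ?thesis
      using nonneg[OF U[of N]] by (simp add: C_def)
  next
    case False
    have "E (U n) (U n) \<le> 2 * sq_dist E (U n) (U N) + 2 * E (U N) (U N)"
      using lincomb_le[OF diff_in[OF U[of n] U[of N]] U[of N], of 1 1] by simp
    also have "\<dots> \<le> 2 + 2 * E (U N) (U N)"
      using N[of n N] False by simp
    also have "\<dots> \<le> C"
      using nonneg[OF U] by (simp add: C_def sum_nonneg)
    finally show ?thesis .
  qed
  then show ?thesis
    using that by blast
qed

lemma form_Cauchy_lincomb:
  assumes U: "\<And>n. U n \<in> Dom" "\<And>n. V n \<in> Dom" and C: "form_Cauchy E U" "form_Cauchy E V"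
  shows "form_Cauchy E (\<lambda>n x. a * U n x + b * V n x)"
  unfolding form_Cauchy_def
proof (intro allI impI)
  fix \<epsilon> :: real assume "0 < \<epsilon>"
  \<comment> \<open>The summand 1 keeps \<open>S\<close> positive when \<open>a\<close> and
    \<open>b\<close> both vanish.\<close>
  define S where "S = 2 * a\<^sup>2 + 2 * b\<^sup>2 + 1"
  define \<delta> where "\<delta> = \<epsilon> / (2 * S)"
  have den: "0 < S"
    by (simp add: S_def add_nonneg_pos)
  then have "0 < \<delta>"
    using \<open>0 < \<epsilon>\<close> by (simp add: \<delta>_def)
  then obtain N1 N2 where N: "\<And>m n. m \<ge> N1 \<Longrightarrow> n \<ge> N1 \<Longrightarrow> sq_dist E (U m) (U n) < \<delta>"
    "\<And>m n. m \<ge> N2 \<Longrightarrow> n \<ge> N2 \<Longrightarrow> sq_dist E (V m) (V n) < \<delta>"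
    using C unfolding form_Cauchy_def by meson
  have "E (\<lambda>x. (a * U m x + b * V m x) - (a * U n x + b * V n x))
      (\<lambda>x. (a * U m x + b * V m x) - (a * U n x + b * V n x)) < \<epsilon>"
    if "m \<ge> max N1 N2" "n \<ge> max N1 N2" for m n
  proof -
    have "E (\<lambda>x. (a * U m x + b * V m x) - (a * U n x + b * V n x))
        (\<lambda>x. (a * U m x + b * V m x) - (a * U n x + b * V n x)) =
        E (\<lambda>x. a * (U m x - U n x) + b * (V m x - V n x))
            (\<lambda>x. a * (U m x - U n x) + b * (V m x - V n x))"
      by (simp add: algebra_simps)
    also have "\<dots> \<le> 2 * a\<^sup>2 * sq_dist E (U m) (U n) + 2 * b\<^sup>2 * sq_dist E (V m) (V n)"
      by (rule lincomb_le[OF diff_in[OF U(1) U(1)] diff_in[OF U(2) U(2)]])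
    also have "\<dots> \<le> 2 * a\<^sup>2 * \<delta> + 2 * b\<^sup>2 * \<delta>"
      using N(1)[of m n] N(2)[of m n] that by (intro add_mono mult_left_mono) auto
    also have "\<dots> \<le> \<delta> * S"
      using \<open>0 < \<delta>\<close> by (simp add: S_def algebra_simps)
    also have "\<dots> = \<epsilon> / 2"
      unfolding \<delta>_def using den by simp
    finally show ?thesis
      using \<open>0 < \<epsilon>\<close> by simp
  qed
  then show "\<exists>N. \<forall>m\<ge>N. \<forall>n\<ge>N. E (\<lambda>x. (a * U m x + b * V m x) - (a * U n x + b * V n x))
      (\<lambda>x. (a * U m x + b * V m x) - (a * U n x + b * V n x)) < \<epsilon>"
    by blast
qed

lemma form_Cauchy_const: "u \<in> Dom \<Longrightarrow> form_Cauchy E (\<lambda>n. u)"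
  using diff_left[of u u "\<lambda>x. 0"] zero_in by (auto simp: form_Cauchy_def)

text \<open>On the diagonal, \<open>E u u - E v v\<close> equals \<open>E\<close> applied to
  \<open>u - v\<close> and \<open>u + v\<close>, which Cauchy--Schwarz controls; polarisation gives
  the mixed terms.\<close>

lemma form_Cauchy_convergent:
  assumes U: "\<And>n. U n \<in> Dom" "\<And>n. V n \<in> Dom" and C: "form_Cauchy E U" "form_Cauchy E V"
  shows "convergent (\<lambda>n. E (U n) (V n))"
proof -
  have "convergent (\<lambda>n. E (W n) (W n))" if W: "\<And>n. W n \<in> Dom" "form_Cauchy E W" for W
  proof (rule Cauchy_convergent, rule metric_CauchyI)
    fix r :: real assume "0 < r"
    obtain B where B: "\<And>n. E (W n) (W n) \<le> B"
      using Cauchy_bounded[OF W] by blast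
    have "0 \<le> B"
      using B[of 0] nonneg[OF W(1), of 0] by linarith
    \<comment> \<open>\<open>4 * B\<close> bounds the energy of the sums \<open>W m + W n\<close>;
      the additional 1 keeps the denominator positive and makes the final inequality strict.\<close>
    define \<delta> where "\<delta> = r\<^sup>2 / (4 * B + 1)"
    have "0 < \<delta>"
      using \<open>0 < r\<close> \<open>0 \<le> B\<close> by (simp add: \<delta>_def)
    then obtain N where N: "\<And>m n. m \<ge> N \<Longrightarrow> n \<ge> N \<Longrightarrow> sq_dist E (W m) (W n) < \<delta>"
      using W(2) unfolding form_Cauchy_def by meson
    have "dist (E (W m) (W m)) (E (W n) (W n)) < r" if "m \<ge> N" "n \<ge> N" for m n
    proof -
      let ?d = "\<lambda>x. W m x - W n x" and ?s = "\<lambda>x. 1 * W m x + 1 * W n x"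
      have d: "?d \<in> Dom" and s: "?s \<in> Dom"
        by (rule diff_in[OF W(1) W(1)], rule lincomb_in[OF W(1) W(1)])
      have "E (W m) (W m) - E (W n) (W n) = E ?d ?s"
        using symm[OF W(1) W(1), of n m]
        by (simp only: diff_left[OF W(1) W(1) s] lincomb_right[OF W(1) W(1) W(1)])
      then have "(E (W m) (W m) - E (W n) (W n))\<^sup>2 \<le> E ?d ?d * E ?s ?s"
        using Cauchy_Schwarz[OF d s] by (simp only:)
      also have "\<dots> \<le> \<delta> * (4 * B)"
      proof (rule mult_mono)
        show "E ?d ?d \<le> \<delta>"
          using N[OF that] by simp
        show "E ?s ?s \<le> 4 * B"
          using lincomb_le[OF W(1)[of m] W(1)[of n], of 1 1] B[of m] B[of n] by simp
      qed (use \<open>0 < \<delta>\<close> nonneg[OF s] in auto)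
      also have "\<dots> < \<delta> * (4 * B + 1)"
        using \<open>0 < \<delta>\<close> by simp
      also have "\<dots> = r\<^sup>2"
        using \<open>0 \<le> B\<close> by (simp add: \<delta>_def)
      finally have "\<bar>E (W m) (W m) - E (W n) (W n)\<bar>\<^sup>2 < r\<^sup>2"
        by (simp only: power2_abs)
      then show ?thesis
        unfolding dist_real_def by (rule power2_less_imp_less) (use \<open>0 < r\<close> in simp)
    qed
    then show "\<exists>N. \<forall>m\<ge>N. \<forall>n\<ge>N. dist (E (W m) (W m)) (E (W n) (W n)) < r"
      by blast
  qed note diag = this
  have "convergent (\<lambda>n. (1/4) * E (\<lambda>x. 1 * U n x + 1 * V n x) (\<lambda>x. 1 * U n x + 1 * V n x)
      - (1/4) * E (\<lambda>x. 1 * U n x + (-1) * V n x) (\<lambda>x. 1 * U n x + (-1) * V n x))"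
    by (intro convergent_diff convergent_mult convergent_const diag form_Cauchy_lincomb U C
        lincomb_in)
  then show ?thesis
    by (simp only: quadratic[OF U]) (simp add: algebra_simps)
qed

end

section \<open>The space of square-integrable functions and its completeness\<close>

lemma L2_space_lincomb:
  assumes "u \<in> L2_space M" "v \<in> L2_space M"
  shows "(\<lambda>x. a * u x + b * v x) \<in> L2_space M"
proof -
  have "integrable M (\<lambda>x. (a * u x + b * v x)\<^sup>2)"
  proof (rule Bochner_Integration.integrable_bound)
    show "integrable M (\<lambda>x. 2 * (a\<^sup>2 * (u x)\<^sup>2) + 2 * (b\<^sup>2 * (v x)\<^sup>2))"
      using assms by (simp add: L2_space_def)
    have "(s + t)\<^sup>2 \<le> 2 * s\<^sup>2 + 2 * t\<^sup>2" for s t :: real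
      using zero_le_power2[of "s - t"] by (simp add: power2_sum power2_diff)
    from this[of "a * u _" "b * v _"]
    show "AE x in M. norm ((a * u x + b * v x)\<^sup>2) \<le> norm
        (2 * (a\<^sup>2 * (u x)\<^sup>2) + 2 * (b\<^sup>2 * (v x)\<^sup>2))"
      by (intro AE_I2) (simp add: power_mult_distrib)
  qed (use assms in \<open>auto simp: L2_space_def\<close>)
  then show ?thesis
    using assms by (auto simp: L2_space_def)
qed

lemma L2_space_mult_integrable:
  assumes "u \<in> L2_space M" "v \<in> L2_space M"
  shows "integrable M (\<lambda>x. u x * v x)"
proof -
  have "integrable M (\<lambda>x. (1/4) * (1 * u x + 1 * v x)\<^sup>2 - (1/4) * (1 * u x + (-1) * v x)\<^sup>2)"
    using L2_space_lincomb[OF assms, of 1 1] L2_space_lincomb[OF assms, of 1 "-1"]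
    unfolding L2_space_def by (intro Bochner_Integration.integrable_diff integrable_mult_right) auto
  then show ?thesis
    by (simp add: power2_eq_square algebra_simps)
qed

abbreviation L2_dist :: "'x measure \<Rightarrow> ('x \<Rightarrow> real) \<Rightarrow> ('x \<Rightarrow> real) \<Rightarrow> real" where
  "L2_dist M u v \<equiv> LINT x|M. (u x - v x)\<^sup>2"

text \<open>The \<open>L2\<close> inner product is made a form of its own, so that Cauchy--Schwarz
  and the triangle estimate of \<open>sym_form\<close> apply to it as well.\<close>

definition L2_form :: "'x measure \<Rightarrow> 'x form" where
  "L2_form M u v = (LINT x|M. u x * v x)"

lemma L2_form_symmetric: "symmetric_form M (L2_space M) (L2_form M)"
  unfolding symmetric_form_def
proof (intro conjI allI ballI)
  show "(\<lambda>x. 0) \<in> L2_space M"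
    by (simp add: L2_space_def)
  fix a b and u v w :: "'a \<Rightarrow> real" assume L: "u \<in> L2_space M" "v \<in> L2_space M"
  show "(\<lambda>x. a * u x + b * v x) \<in> L2_space M"
    by (rule L2_space_lincomb[OF L])
  assume w: "w \<in> L2_space M"
  have "L2_form M (\<lambda>x. a * u x + b * v x) w = (LINT x|M. a * (u x * w x) + b * (v x * w x))"
    by (simp add: L2_form_def algebra_simps)
  also have "\<dots> = a * L2_form M u w + b * L2_form M v w"
    using L2_space_mult_integrable[OF L(1) w] L2_space_mult_integrable[OF L(2) w]
    by (simp add: L2_form_def)
  finally show "L2_form M (\<lambda>x. a * u x + b * v x) w = a * L2_form M u w + b * L2_form M v w" .
qed (auto simp: L2_form_def mult.commute)

interpretation L2: sym_form M "L2_space M" "L2_form M" for M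
  by (simp add: sym_form_def L2_form_symmetric)

lemma L2_form_diff: "L2_dist M u v = sq_dist (L2_form M) u v"
  by (simp add: L2_form_def power2_eq_square)

lemma L2_converges_form: "L2_converges M U u \<longleftrightarrow> (\<lambda>n. sq_dist (L2_form M) (U n) u) \<longlonglongrightarrow> 0"
  by (simp add: L2_converges_def L2_form_diff)

lemma L2_converges_triangle:
  assumes "\<And>n. U n \<in> L2_space M" "\<And>n. V n \<in> L2_space M" "u \<in> L2_space M"
    and "(\<lambda>n. L2_dist M (U n) (V n)) \<longlonglongrightarrow> 0" "L2_converges M V u"
  shows "L2_converges M U u"
  unfolding L2_converges_form
proof (rule Lim_null_comparison)
  show "\<forall>\<^sub>F n in sequentially. norm (sq_dist (L2_form M) (U n) u) \<le>
      2 * L2_dist M (U n) (V n) + 2 * L2_dist M (V n) u"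
    using L2.triangle_le[OF assms(1,2,3)] L2.nonneg[OF L2.diff_in[OF assms(1,3)]]
    by (auto simp: L2_form_diff intro!: always_eventually)
  show "(\<lambda>n. 2 * L2_dist M (U n) (V n) + 2 * L2_dist M (V n) u) \<longlonglongrightarrow> 0"
    using tendsto_add[OF tendsto_mult_left[OF assms(4), of 2]
        tendsto_mult_left[OF assms(5)[unfolded L2_converges_def], of 2]]
    by simp
qed

lemma L2_converges_lincomb:
  assumes "\<And>n. U n \<in> L2_space M" "\<And>n. V n \<in> L2_space M" "u \<in> L2_space M" "v \<in> L2_space M"
    and "L2_converges M U u" "L2_converges M V v"
  shows "L2_converges M (\<lambda>n x. a * U n x + b * V n x) (\<lambda>x. a * u x + b * v x)"
  unfolding L2_converges_form
proof (rule Lim_null_comparison)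
  have eq: "(\<lambda>x. (a * U n x + b * V n x) - (a * u x + b * v x)) =
      (\<lambda>x. a * (U n x - u x) + b * (V n x - v x))" for n
    by (simp add: algebra_simps)
  show "\<forall>\<^sub>F n in sequentially. norm (L2_form M (\<lambda>x. (a * U n x + b * V n x) - (a * u x + b * v x))
      (\<lambda>x. (a * U n x + b * V n x) - (a * u x + b * v x))) \<le>
      2 * a\<^sup>2 * sq_dist (L2_form M) (U n) u + 2 * b\<^sup>2 * sq_dist (L2_form M) (V n) v"
    unfolding eq
    using L2.lincomb_le[OF L2.diff_in[OF assms(1,3)] L2.diff_in[OF assms(2,4)]]
      L2.nonneg[OF L2.lincomb_in[OF L2.diff_in[OF assms(1,3)] L2.diff_in[OF assms(2,4)]]]
    by (auto intro!: always_eventually)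
  show "(\<lambda>n. 2 * a\<^sup>2 * sq_dist (L2_form M) (U n) u + 2 * b\<^sup>2 * sq_dist (L2_form M) (V n) v) \<longlonglongrightarrow> 0"
    using tendsto_add[OF tendsto_mult_left[OF assms(5)[unfolded L2_converges_form], of "2 * a\<^sup>2"]
        tendsto_mult_left[OF assms(6)[unfolded L2_converges_form], of "2 * b\<^sup>2"]]
    by simp
qed

text \<open>The Riesz--Fischer argument for representatives: a rapidly Cauchy subsequence converges
  almost everywhere, and Fatou's lemma turns this into \<open>L2\<close> convergence of the whole
  sequence.\<close>

lemma (in prob_space) L2_complete:
  assumes U: "\<And>n. U n \<in> L2_space M" and C: "L2_Cauchy M U"
  obtains u where "u \<in> L2_space M" "L2_converges M U u"
proof -
  have meas [measurable]: "\<And>n. U n \<in> borel_measurable M"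
    using U by (simp add: L2_space_def)
  have sq: "integrable M (\<lambda>x. (U m x - U n x)\<^sup>2)" for m n
    using L2.diff_in[OF U U, of m n] by (simp add: L2_space_def)
  \<comment> \<open>Squared distances below \<open>(1/4)^k\<close> give norms below
    \<open>(1/2)^k\<close>, a summable bound.\<close>
  have "\<exists>N. \<forall>m\<ge>N. \<forall>n\<ge>N. L2_dist M (U m) (U n) < (1/4)^k" for k :: nat
    using C unfolding L2_Cauchy_def by simp
  from choice[OF allI, OF this] obtain N
    where "\<forall>k. \<forall>m\<ge>N k. \<forall>n\<ge>N k. L2_dist M (U m) (U n) < (1/4)^k" ..
  then have N: "\<And>k m n. N k \<le> m \<Longrightarrow> N k \<le> n \<Longrightarrow> (L2_dist M (U m) (U n)) < (1/4)^k"
    by simp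
  \<comment> \<open>Partial sums of \<open>N\<close> are nondecreasing and dominate
    \<open>N k\<close>, while \<open>N\<close> itself need not be monotone.\<close>
  define r where "r k = (\<Sum>j\<le>k. N j)" for k
  have r: "N k \<le> r k" "N k \<le> r (Suc k)" for k
    unfolding r_def by (simp_all add: member_le_sum trans_le_add1)
  define d where "d k x = \<bar>U (r (Suc k)) x - U (r k) x\<bar>" for k x
  have d_meas [measurable]: "d k \<in> borel_measurable M" for k
    unfolding d_def by measurable
  have d_int: "(\<integral>\<^sup>+x. ennreal (d k x) \<partial>M) \<le> ennreal ((1/2)^k)" for k
  proof -
    have one: "(\<lambda>x. 1) \<in> L2_space M"
      by (simp add: L2_space_def)
    have dL2: "d k \<in> L2_space M"
      using L2.diff_in[OF U U, of "r (Suc k)" "r k"] d_meas[of k] by (simp add: L2_space_def d_def)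
    \<comment> \<open>Cauchy--Schwarz against the constant 1, of norm 1 on a probability space,
      passes from \<open>L2\<close> to \<open>L1\<close>.\<close>
    have "(L2_form M (d k) (\<lambda>x. 1))\<^sup>2 \<le> L2_form M (d k) (d k) * L2_form M (\<lambda>x. 1) (\<lambda>x. 1)"
      by (rule L2.Cauchy_Schwarz[OF dL2 one])
    also have "\<dots> = (LINT x|M. (U (r (Suc k)) x - U (r k) x)\<^sup>2)"
      by (simp add: L2_form_def d_def prob_space power2_eq_square flip: abs_mult)
    also have "\<dots> \<le> ((1/2)^k)\<^sup>2"
    proof -
      have "((1/2::real)^k)\<^sup>2 = (1/4)^k"
        by (simp add: power2_eq_square flip: power_mult_distrib)
      then show ?thesis
        using N[OF r(2) r(1), of k] by simp
    qed
    finally have "L2_form M (d k) (\<lambda>x. 1) \<le> (1/2)^k"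
      by (rule power2_le_imp_le) simp
    then have "(LINT x|M. d k x) \<le> (1/2)^k"
      by (simp add: L2_form_def)
    moreover have "integrable M (d k)"
      using L2_space_mult_integrable[OF dL2 one] by simp
    ultimately show ?thesis
      by (subst nn_integral_eq_integral) (auto simp: d_def[abs_def])
  qed
  have "(\<integral>\<^sup>+x. (\<Sum>k. ennreal (d k x)) \<partial>M) = (\<Sum>k. \<integral>\<^sup>+x. ennreal (d k x) \<partial>M)"
    by (rule nn_integral_suminf) measurable
  also have "\<dots> \<le> (\<Sum>k. ennreal ((1/2)^k))"
    by (intro suminf_le d_int) auto
  also have "\<dots> < \<infinity>"
    by (subst suminf_ennreal2) (auto intro: summable_geometric)
  finally have "AE x in M. (\<Sum>k. ennreal (d k x)) \<noteq> \<infinity>"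
    by (intro nn_integral_PInf_AE) auto
  then have conv: "AE x in M. convergent (\<lambda>k. U (r k) x)"
  proof eventually_elim
    case (elim x)
    have "summable (\<lambda>k. d k x)"
      using elim by (intro summable_suminf_not_top) (auto simp: d_def)
    then have "summable (\<lambda>k. U (r (Suc k)) x - U (r k) x)"
      unfolding d_def by (rule summable_rabs_cancel)
    then have "convergent (\<lambda>n. \<Sum>k<n. U (r (Suc k)) x - U (r k) x)"
      by (simp add: summable_iff_convergent)
    then have "convergent (\<lambda>n. U (r n) x - U (r 0) x)"
      by (simp only: sum_lessThan_telescope[of "\<lambda>k. U (r k) x"])
    then have "convergent (\<lambda>n. (U (r n) x - U (r 0) x) + U (r 0) x)"
      by (intro convergent_add convergent_const)
    then show ?case
      by simp
  qed
  \<comment> \<open>Where the subsequence diverges, which is a null set, \<open>lim\<close> has no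
    specified value; \<open>u\<close> is measurable all the same.\<close>
  define u where "u x = lim (\<lambda>k. U (r k) x)" for x
  have u_meas [measurable]: "u \<in> borel_measurable M"
    unfolding u_def by measurable
  have u_lim: "AE x in M. (\<lambda>k. U (r k) x) \<longlonglongrightarrow> u x"
    using conv by eventually_elim (simp add: u_def convergent_LIMSEQ_iff)
  \<comment> \<open>The index \<open>n\<close> is fixed and the limit runs along the subsequence.
    The factor 4 is slack, since \<open>N\<close> already bounds the integrals by
    \<open>(1/4)^k\<close>.\<close>
  have Fatou: "(\<integral>\<^sup>+x. ennreal ((U n x - u x)\<^sup>2) \<partial>M) \<le> ennreal (4 * (1/4)^k)" if n: "n \<ge> N k" for n k
  proof -
    have "(\<integral>\<^sup>+x. ennreal ((U n x - u x)\<^sup>2) \<partial>M) \<le>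
        (\<integral>\<^sup>+x. liminf (\<lambda>j. ennreal ((U n x - U (r j) x)\<^sup>2)) \<partial>M)"
    proof (rule nn_integral_mono_AE)
      show "AE x in M. ennreal ((U n x - u x)\<^sup>2) \<le> liminf (\<lambda>j. ennreal ((U n x - U (r j) x)\<^sup>2))"
        using u_lim
      proof eventually_elim
        case (elim x)
        have "(\<lambda>j. ennreal ((U n x - U (r j) x)\<^sup>2)) \<longlonglongrightarrow> ennreal ((U n x - u x)\<^sup>2)"
          by (intro tendsto_ennrealI tendsto_intros elim)
        from lim_imp_Liminf[OF sequentially_bot this] show ?case
          by (simp only: order_refl)
      qed
    qed
    also have "\<dots> \<le> liminf (\<lambda>j. \<integral>\<^sup>+x. ennreal ((U n x - U (r j) x)\<^sup>2) \<partial>M)"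
      by (rule nn_integral_liminf) measurable
    also have "\<dots> \<le> limsup (\<lambda>j. \<integral>\<^sup>+x. ennreal ((U n x - U (r j) x)\<^sup>2) \<partial>M)"
      by (rule Liminf_le_Limsup) simp
    also have "\<dots> \<le> ennreal (4 * (1/4)^k)"
    proof (rule Limsup_bounded, rule eventually_sequentiallyI[of k])
      fix j assume "k \<le> j"
      then have "r k \<le> r j"
        unfolding r_def by (intro sum_mono2) auto
      then have "N k \<le> r j"
        using r(1)[of k] by simp
      then have "(LINT x|M. (U n x - U (r j) x)\<^sup>2) \<le> 4 * (1/4)^k"
        using N[OF n, of "r j"] zero_less_power[of "1/4::real" k] by linarith
      then show "(\<integral>\<^sup>+x. ennreal ((U n x - U (r j) x)\<^sup>2) \<partial>M) \<le> ennreal (4 * (1/4)^k)"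
        by (subst nn_integral_eq_integral[OF sq]) (auto intro: ennreal_leI)
    qed
    finally show ?thesis .
  qed
  have diff_sq: "integrable M (\<lambda>x. (U n x - u x)\<^sup>2)" "L2_dist M (U n) u \<le> 4 * (1/4)^k"
    if n: "n \<ge> N k" for n k
  proof -
    show int: "integrable M (\<lambda>x. (U n x - u x)\<^sup>2)"
      using Fatou[OF n] by (intro integrableI_nonneg) (auto simp: order_le_less_trans)
    show "L2_dist M (U n) u \<le> 4 * (1/4)^k"
      using Fatou[OF n] by (simp add: nn_integral_eq_integral[OF int] ennreal_le_iff)
  qed
  have "(\<lambda>x. U (N 0) x - u x) \<in> L2_space M"
    using diff_sq(1)[of 0] by (simp add: L2_space_def)
  from L2.diff_in[OF U[of "N 0"] this] have "u \<in> L2_space M"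
    by simp
  moreover have "L2_converges M U u"
    unfolding L2_converges_def
  proof (rule LIMSEQ_I)
    fix e :: real assume "0 < e"
    then obtain k where k: "(1/4)^k < e / 4"
      using real_arch_pow_inv[of "e / 4" "1/4"] by auto
    have "norm ((L2_dist M (U n) u) - 0) < e" if "n \<ge> N k" for n
      using diff_sq(2)[OF that] k by simp
    then show "\<exists>n0. \<forall>n\<ge>n0. norm ((L2_dist M (U n) u) - 0) < e"
      by blast
  qed
  ultimately show ?thesis
    by (rule that)
qed

section \<open>The closure of a closable form\<close>

locale closable_form = sym_form M Dom E + prob_space M
  for M :: "'x measure" and Dom :: "('x \<Rightarrow> real) set" and E :: "'x form" +
  assumes closable: "closable M Dom E"
begin

abbreviation "CD \<equiv> closure_domain M Dom E"
abbreviation "CE \<equiv> closure_form M Dom E"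

lemma in_L2: "u \<in> Dom \<Longrightarrow> u \<in> L2_space M"
  using Dom_L2 by blast

lemma approximatesD:
  assumes "approximates M Dom E U u"
  shows "U n \<in> Dom" "form_Cauchy E U" "L2_converges M U u"
  using assms by (simp_all add: approximates_def)

lemma approximates_const: "u \<in> Dom \<Longrightarrow> approximates M Dom E (\<lambda>n. u) u"
  by (simp add: approximates_def form_Cauchy_const L2_converges_def)

lemma approximates_lincomb:
  assumes "u \<in> L2_space M" "v \<in> L2_space M" "approximates M Dom E U u" "approximates M Dom E V v"
  shows "approximates M Dom E (\<lambda>n x. a * U n x + b * V n x) (\<lambda>x. a * u x + b * v x)"
  unfolding approximates_def
proof (intro conjI allI)
  note U = approximatesD[OF assms(3)] and V = approximatesD[OF assms(4)]
  show "(\<lambda>x. a * U n x + b * V n x) \<in> Dom" for n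
    by (rule lincomb_in[OF U(1) V(1)])
  show "form_Cauchy E (\<lambda>n x. a * U n x + b * V n x)"
    by (rule form_Cauchy_lincomb[OF U(1) V(1) U(2) V(2)])
  show "L2_converges M (\<lambda>n x. a * U n x + b * V n x) (\<lambda>x. a * u x + b * v x)"
    by (rule L2_converges_lincomb[OF in_L2[OF U(1)] in_L2[OF V(1)] assms(1,2) U(3) V(3)])
qed

lemma approximates_diff_null:
  assumes u: "u \<in> L2_space M" and "approximates M Dom E U u" "approximates M Dom E V u"
  shows "(\<lambda>n. sq_dist E (U n) (V n)) \<longlonglongrightarrow> 0"
proof -
  have "approximates M Dom E (\<lambda>n x. U n x - V n x) (\<lambda>x. 0)"
    using approximates_lincomb[OF u u assms(2,3), of 1 "-1"] by simp
  then show ?thesis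
    using closable[unfolded closable_def, THEN conjunct2, THEN spec[of _ "\<lambda>n x. U n x - V n x"]]
    by (simp only: approximates_def simp_thms)
qed

text \<open>Replaces the definite description in \<open>closure_form\<close> by a usable limit. By
  closability, two approximating sequences of one function differ by a sequence of vanishing energy;
  Cauchy--Schwarz with bounded energies makes the limits agree.\<close>

lemma closure_form_limit:
  assumes uv: "u \<in> L2_space M" "v \<in> L2_space M"
    and U: "approximates M Dom E U u" and V: "approximates M Dom E V v"
  shows "(\<lambda>n. E (U n) (V n)) \<longlonglongrightarrow> CE u v"
proof -
  obtain c where c: "(\<lambda>n. E (U n) (V n)) \<longlonglongrightarrow> c"
    using form_Cauchy_convergent[OF approximatesD(1)[OF U] approximatesD(1)[OF V]
        approximatesD(2)[OF U]
        approximatesD(2)[OF V]] unfolding convergent_def by blast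
  have all: "(\<lambda>n. E (U' n) (V' n)) \<longlonglongrightarrow> c"
    if U': "approximates M Dom E U' u" and V': "approximates M Dom E V' v" for U' V'
  proof -
    note D = approximatesD(1)[OF U] approximatesD(1)[OF V] approximatesD(1)[OF U']
        approximatesD(1)[OF V']
    obtain C1 where C1: "\<And>n. E (U n) (U n) \<le> C1"
      using Cauchy_bounded[OF approximatesD(1,2)[OF U]] by blast
    obtain C2 where C2: "\<And>n. E (V' n) (V' n) \<le> C2"
      using Cauchy_bounded[OF approximatesD(1,2)[OF V']] by blast
    have 1: "(\<lambda>n. E (\<lambda>x. U' n x - U n x) (V' n)) \<longlonglongrightarrow> 0"
      by (rule tendsto_zero_left[OF diff_in[OF D(3,1)] D(4) approximates_diff_null[OF uv(1) U' U]
          C2])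
    have 2: "(\<lambda>n. E (\<lambda>x. V' n x - V n x) (U n)) \<longlonglongrightarrow> 0"
      by (rule tendsto_zero_left[OF diff_in[OF D(4,2)] D(1) approximates_diff_null[OF uv(2) V' V]
          C1])
    have "E (U' n) (V' n) = E (\<lambda>x. U' n x - U n x) (V' n) + E (\<lambda>x. V' n x - V n x) (U n) + E (U n)
        (V n)" for n
      using symm[OF D(4) D(1), of n n] symm[OF D(2) D(1), of n n]
      by (simp add: diff_left[OF D(3) D(1) D(4)] diff_left[OF D(4) D(2) D(1)])
    then show ?thesis
      using tendsto_add[OF tendsto_add[OF 1 2] c] by simp
  qed
  have "CE u v = c"
    unfolding closure_form_def
  proof (rule the_equality)
    show "\<forall>U V. approximates M Dom E U u \<and> approximates M Dom E V v \<longrightarrow> (\<lambda>n. E (U n) (V n)) \<longlonglongrightarrow> c"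
      using all by blast
    fix c' assume "\<forall>U V. approximates M Dom E U u \<and> approximates M Dom E V v \<longrightarrow> (\<lambda>n. E (U n) (V n)) \<longlonglongrightarrow>
        c'"
    then have "(\<lambda>n. E (U n) (V n)) \<longlonglongrightarrow> c'"
      using U V by blast
    then show "c' = c"
      using c LIMSEQ_unique by blast
  qed
  then show ?thesis
    using c by simp
qed

lemma closure_domainE:
  assumes "u \<in> CD"
  obtains U where "u \<in> L2_space M" "approximates M Dom E U u"
  using assms unfolding closure_domain_def by blast

lemma closure_domainI: "u \<in> L2_space M \<Longrightarrow> approximates M Dom E U u \<Longrightarrow> u \<in> CD"
  unfolding closure_domain_def by blast

lemma Dom_subset:
  assumes "u \<in> Dom"
  shows "u \<in> CD"
  by (rule closure_domainI[OF in_L2[OF assms] approximates_const[OF assms]])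

lemma closure_form_eq:
  assumes "u \<in> Dom" "v \<in> Dom"
  shows "CE u v = E u v"
proof (rule LIMSEQ_unique)
  show "(\<lambda>n. E u v) \<longlonglongrightarrow> CE u v"
    by (rule closure_form_limit[OF in_L2[OF assms(1)] in_L2[OF assms(2)]
          approximates_const[OF assms(1)] approximates_const[OF assms(2)]])
qed (rule tendsto_const)

lemma closure_symmetric: "symmetric_form M CD CE"
  unfolding symmetric_form_def
proof (intro conjI allI ballI)
  show "CD \<subseteq> L2_space M"
    unfolding closure_domain_def by blast
  show "(\<lambda>x. 0) \<in> CD"
    by (rule Dom_subset[OF zero_in])
  fix u assume "u \<in> CD"
  then obtain U where U: "u \<in> L2_space M" "approximates M Dom E U u"
    by (rule closure_domainE)
  show "0 \<le> CE u u"
    using closure_form_limit[OF U(1,1,2,2)] nonneg[OF approximatesD(1)[OF U(2)]]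
    by (intro LIMSEQ_le_const) auto
  fix v assume "v \<in> CD"
  then obtain V where V: "v \<in> L2_space M" "approximates M Dom E V v"
    by (rule closure_domainE)
  show "CE u v = CE v u"
  proof (rule LIMSEQ_unique[OF closure_form_limit[OF U(1) V(1) U(2) V(2)]])
    show "(\<lambda>n. E (U n) (V n)) \<longlonglongrightarrow> CE v u"
      using closure_form_limit[OF V(1) U(1) V(2) U(2)]
      by (simp only: symm[OF approximatesD(1)[OF U(2)] approximatesD(1)[OF V(2)]])
  qed
  fix a b
  show "(\<lambda>x. a * u x + b * v x) \<in> CD"
    by (rule closure_domainI[OF L2_space_lincomb[OF U(1) V(1)]
        approximates_lincomb[OF U(1) V(1) U(2) V(2)]])
  fix w assume "w \<in> CD"
  then obtain W where W: "w \<in> L2_space M" "approximates M Dom E W w"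
    by (rule closure_domainE)
  show "CE (\<lambda>x. a * u x + b * v x) w = a * CE u w + b * CE v w"
  proof (rule LIMSEQ_unique[OF closure_form_limit[OF L2_space_lincomb[OF U(1) V(1)] W(1)
          approximates_lincomb[OF U(1) V(1) U(2) V(2)] W(2)]])
    show "(\<lambda>n. E (\<lambda>x. a * U n x + b * V n x) (W n)) \<longlonglongrightarrow> a * CE u w + b * CE v w"
      unfolding lincomb_left[OF approximatesD(1)[OF U(2)] approximatesD(1)[OF V(2)]
          approximatesD(1)[OF W(2)]]
      by (intro tendsto_intros closure_form_limit U V W)
  qed
qed

sublocale C: sym_form M CD CE
  by unfold_locales (rule closure_symmetric)

text \<open>For fixed \<open>n\<close> the differences \<open>U n - U m\<close> approximate
  \<open>U n - u\<close> as \<open>m\<close> grows, so the Cauchy estimate passes to the limit in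
  \<open>m\<close>.\<close>

lemma approximates_form_converges:
  assumes u: "u \<in> L2_space M" and U: "approximates M Dom E U u"
  shows "(\<lambda>n. sq_dist CE (U n) u) \<longlonglongrightarrow> 0"
proof (rule LIMSEQ_I)
  fix \<epsilon> :: real assume "0 < \<epsilon>"
  then have "0 < \<epsilon> / 2"
    by simp
  then obtain N where N: "\<And>m n. m \<ge> N \<Longrightarrow> n \<ge> N \<Longrightarrow> sq_dist E (U m) (U n) < \<epsilon> / 2"
    using approximatesD(2)[OF U] unfolding form_Cauchy_def by meson
  have "norm (sq_dist CE (U n) u - 0) < \<epsilon>" if n: "n \<ge> N" for n
  proof -
    note Un = in_L2[OF approximatesD(1)[OF U]]
    have ap: "approximates M Dom E (\<lambda>m x. U n x - U m x) (\<lambda>x. U n x - u x)"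
      using approximates_lincomb[OF Un[of n] u approximates_const[OF approximatesD(1)[OF U, of n]]
          U, of 1 "-1"] by simp
    have L2: "(\<lambda>x. U n x - u x) \<in> L2_space M"
      by (rule L2.diff_in[OF Un u])
    have "sq_dist CE (U n) u \<le> \<epsilon> / 2"
      using N[OF n] by (intro LIMSEQ_le_const2[OF closure_form_limit[OF L2 L2 ap ap]])
          (auto intro: less_imp_le)
    moreover have "0 \<le> sq_dist CE (U n) u"
      by (rule C.nonneg[OF closure_domainI[OF L2 ap]])
    ultimately show ?thesis
      using \<open>0 < \<epsilon>\<close> by simp
  qed
  then show "\<exists>n0. \<forall>n\<ge>n0. norm (sq_dist CE (U n) u - 0) < \<epsilon>"
    by blast
qed

text \<open>Each \<open>U n\<close> is replaced by a member \<open>W n\<close> of the original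
  domain within \<open>\<delta> n\<close> of it, in \<open>L2\<close> and in energy. Then
  \<open>W\<close> approximates the \<open>L2\<close> limit of \<open>U\<close>, which therefore
  lies in the closure.\<close>

lemma closure_closed: "closed_form M CD CE"
  unfolding closed_form_def
proof (intro conjI allI impI closure_symmetric)
  fix U assume *: "(\<forall>n. U n \<in> CD) \<and> form_Cauchy CE U \<and> L2_Cauchy M U"
  then have U: "\<And>n. U n \<in> CD" and UL: "\<And>n. U n \<in> L2_space M"
    using C.Dom_L2 by blast+
  obtain u where u: "u \<in> L2_space M" "L2_converges M U u"
    using L2_complete[of U, OF UL] * by blast
  define \<delta> where "\<delta> n = inverse (real (Suc n))" for n
  have \<delta>: "0 < \<delta> n" "\<delta> \<longlonglongrightarrow> 0" for n
    unfolding \<delta>_def by (simp, rule LIMSEQ_inverse_real_of_nat)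
  have "\<exists>W. W \<in> Dom \<and> L2_dist M W (U n) \<le> \<delta> n \<and> sq_dist CE W (U n) \<le> \<delta> n" for n
  proof -
    obtain V where V: "approximates M Dom E V (U n)"
      using U closure_domainE by blast
    have "\<forall>\<^sub>F k in sequentially. L2_dist M (V k) (U n) < \<delta> n"
      using approximatesD(3)[OF V] \<delta>(1) unfolding L2_converges_def by (rule order_tendstoD)
    moreover have "\<forall>\<^sub>F k in sequentially. sq_dist CE (V k) (U n) < \<delta> n"
      using approximates_form_converges[OF UL V] \<delta>(1) by (rule order_tendstoD)
    ultimately have "\<forall>\<^sub>F k in sequentially. L2_dist M (V k) (U n) < \<delta> n \<and>
        sq_dist CE (V k) (U n) < \<delta> n"
      by (rule eventually_conj)
    then obtain k where "L2_dist M (V k) (U n) < \<delta> n \<and>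
        sq_dist CE (V k) (U n) < \<delta> n"
      unfolding eventually_sequentially by blast
    then show ?thesis
      using approximatesD(1)[OF V, of k] by (intro exI[of _ "V k"]) auto
  qed
  from choice[OF allI, OF this] obtain W where "\<forall>n. W n \<in> Dom \<and> L2_dist M (W n) (U n) \<le> \<delta> n \<and>
    sq_dist CE (W n) (U n) \<le> \<delta> n" ..
  then have W: "\<And>n. W n \<in> Dom" "\<And>n. L2_dist M (W n) (U n) \<le> \<delta> n"
    "\<And>n. sq_dist CE (W n) (U n) \<le> \<delta> n"
    by simp_all
  have WC: "\<And>n. W n \<in> CD"
    by (rule Dom_subset[OF W(1)])
  have "L2_converges M W u"
  proof (rule L2_converges_triangle[OF in_L2[OF W(1)] UL u(1) _ u(2)])
    show "(\<lambda>n. L2_dist M (W n) (U n)) \<longlonglongrightarrow> 0"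
      using W(2) by (intro Lim_null_comparison[OF _ \<delta>(2)]) (auto intro: always_eventually)
  qed
  moreover have "form_Cauchy E W"
    unfolding form_Cauchy_def
  proof (intro allI impI)
    fix \<epsilon> :: real assume "0 < \<epsilon>"
    \<comment> \<open>Two uses of the triangle estimate weigh the three distances by 2, 4 and 4, at
      most 10 sixteenths in total.\<close>
    then have "0 < \<epsilon> / 16"
      by simp
    from order_tendstoD(2)[OF \<delta>(2) this] obtain N1 where N1: "\<And>n. n \<ge> N1 \<Longrightarrow> \<delta> n < \<epsilon> / 16"
      unfolding eventually_sequentially by blast
    obtain N2 where N2: "\<And>m n. m \<ge> N2 \<Longrightarrow> n \<ge> N2 \<Longrightarrow> sq_dist CE (U m) (U n) < \<epsilon> / 16"
      using * \<open>0 < \<epsilon> / 16\<close> unfolding form_Cauchy_def by meson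
    have "sq_dist E (W m) (W n) < \<epsilon>" if "m \<ge> max N1 N2" "n \<ge> max N1 N2" for m n
    proof -
      have "sq_dist E (W m) (W n) = sq_dist CE (W m) (W n)"
        by (simp add: closure_form_eq diff_in W)
      also have "\<dots> \<le> 2 * sq_dist CE (W m) (U m) + 2 * sq_dist CE (U m) (W n)"
        by (rule C.triangle_le[OF WC U WC])
      also have "sq_dist CE (U m) (W n) \<le>
          2 * sq_dist CE (U m) (U n) + 2 * sq_dist CE (U n) (W n)"
        by (rule C.triangle_le[OF U U WC])
      also have "sq_dist CE (U n) (W n) = sq_dist CE (W n) (U n)"
        by (rule C.diff_swap[OF U WC])
      finally show ?thesis
        using W(3)[of m] W(3)[of n] N1[of m] N1[of n] N2[of m n] that \<open>0 < \<epsilon>\<close> by simp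
    qed
    then show "\<exists>N. \<forall>m\<ge>N. \<forall>n\<ge>N. sq_dist E (W m) (W n) < \<epsilon>"
      by blast
  qed
  ultimately have ap: "approximates M Dom E W u"
    using W(1) by (simp add: approximates_def)
  have uC: "u \<in> CD"
    by (rule closure_domainI[OF u(1) ap])
  have "(\<lambda>n. sq_dist CE (U n) u) \<longlonglongrightarrow> 0"
  proof (rule Lim_null_comparison)
    have "norm (sq_dist CE (U n) u) \<le> 2 * \<delta> n + 2 * sq_dist CE (W n) u" for n
      using C.triangle_le[OF U[of n] WC[of n] uC] C.diff_swap[OF U[of n] WC[of n]] W(3)[of n]
        C.nonneg[OF C.diff_in[OF U[of n] uC]] by simp
    then show "\<forall>\<^sub>F n in sequentially. norm (sq_dist CE (U n) u) \<le>
        2 * \<delta> n + 2 * sq_dist CE (W n) u"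
      by simp
    show "(\<lambda>n. 2 * \<delta> n + 2 * sq_dist CE (W n) u) \<longlonglongrightarrow> 0"
      using tendsto_add[OF tendsto_mult_left[OF \<delta>(2), of 2]
          tendsto_mult_left[OF approximates_form_converges[OF u(1) ap], of 2]] by simp
  qed
  then show "\<exists>u\<in>CD. L2_converges M U u \<and> (\<lambda>n. sq_dist CE (U n) u) \<longlonglongrightarrow> 0"
    using uC u(2) by blast
qed

text \<open>Functions equal almost everywhere have the same approximating sequences, and
  \<open>closure_form\<close> sees its arguments only through these; so \<open>w\<close> may be
  arbitrary.\<close>

lemma closure_AE:
  assumes u: "u \<in> CD" and v: "v \<in> borel_measurable M" and eq: "AE x in M. u x = v x"
  shows "v \<in> CD" "CE v w = CE u w"
proof -
  obtain U where U: "u \<in> L2_space M" "approximates M Dom E U u"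
    using closure_domainE[OF u] .
  have um: "u \<in> borel_measurable M"
    using U(1) by (simp add: L2_space_def)
  have "integrable M (\<lambda>x. (v x)\<^sup>2) \<longleftrightarrow> integrable M (\<lambda>x. (u x)\<^sup>2)"
    using eq um v by (intro integrable_cong_AE) auto
  then have vL: "v \<in> L2_space M"
    using U(1) v by (simp add: L2_space_def)
  have iff: "approximates M Dom E V u \<longleftrightarrow> approximates M Dom E V v" for V
  proof -
    have "L2_dist M (V n) u = L2_dist M (V n) v" if "V n \<in> Dom" for n
    proof -
      have "V n \<in> borel_measurable M"
        using in_L2[OF that] by (simp add: L2_space_def)
      then show ?thesis
        using eq um v by (intro integral_cong_AE) auto
    qed
    then show ?thesis
      unfolding approximates_def L2_converges_def by auto
  qed
  show "v \<in> CD"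
    using closure_domainI[OF vL] U(2) iff by blast
  show "CE v w = CE u w"
    unfolding closure_form_def by (simp only: iff)
qed

text \<open>Instead of weak compactness: nearly minimise the energy over \<open>L\<^sup>2\<close>-balls shrinking to \<open>w\<close>. The
  parallelogram identity makes the near-minimisers a Cauchy sequence for the form.\<close>

lemma closure_lower_semicontinuous:
  assumes W: "\<And>n. W n \<in> Dom" and w: "w \<in> L2_space M" "L2_converges M W w"
    and a: "\<And>n. E (W n) (W n) \<le> a n" "a \<longlonglongrightarrow> A"
  shows "w \<in> CD" "CE w w \<le> A"
proof -
  define \<delta> where "\<delta> n = inverse (real (Suc n))" for n
  have \<delta>: "\<delta> \<longlonglongrightarrow> 0" "\<And>n. 0 < \<delta> n" "\<And>m n. n \<le> m \<Longrightarrow> \<delta> m \<le> \<delta> n"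
    unfolding \<delta>_def by (rule LIMSEQ_inverse_real_of_nat) auto
  define K where "K n = {v \<in> Dom. L2_dist M v w \<le> \<delta> n}" for n
  define d where "d n = (INF v\<in>K n. E v v)" for n
  have bdd: "bdd_below ((\<lambda>v. E v v) ` K n)" for n
    using nonneg by (intro bdd_belowI[of _ 0]) (auto simp: K_def)
  have K_mono: "K m \<subseteq> K n" if "n \<le> m" for m n
    using \<delta>(3)[OF that] by (auto simp: K_def)
  have ev: "\<forall>\<^sub>F k in sequentially. W k \<in> K n" for n
    using order_tendstoD(2)[OF w(2)[unfolded L2_converges_def] \<delta>(2)[of n]]
    by eventually_elim (simp add: K_def W)
  then have ne: "K n \<noteq> {}" for n
    unfolding eventually_sequentially by blast
  have d_le: "d n \<le> E v v" if "v \<in> K n" for v n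
    unfolding d_def using that by (intro cINF_lower bdd)
  have d_mono: "d n \<le> d m" if "n \<le> m" for m n
    unfolding d_def using K_mono[OF that] by (intro cINF_superset_mono ne bdd) auto
  \<comment> \<open>\<open>W k\<close> eventually enters every ball \<open>K n\<close>, so
    \<open>A\<close> bounds all the infima. They increase as the balls shrink and hence
    converge.\<close>
  have d_A: "d n \<le> A" for n
  proof (rule tendsto_lowerbound[OF a(2)])
    show "\<forall>\<^sub>F k in sequentially. d n \<le> a k"
      using ev[of n] by eventually_elim (use d_le a(1) order_trans in blast)
  qed simp
  have "\<exists>v\<in>K n. E v v < d n + \<delta> n" for n
    using cINF_less_iff[OF ne bdd, of n "d n + \<delta> n"] \<delta>(2)[of n] by (simp add: d_def)
  then obtain V where V: "\<And>n. V n \<in> K n" "\<And>n. E (V n) (V n) < d n + \<delta> n"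
    by metis
  have VD: "\<And>n. V n \<in> Dom"
    using V(1) by (simp add: K_def)
  have conv_d: "d \<longlonglongrightarrow> (SUP n. d n)"
    using d_mono d_A by (intro LIMSEQ_incseq_SUP bdd_aboveI[of _ A]) (auto simp: incseq_def)
  have mid: "(\<lambda>x. (1/2) * u x + (1/2) * v x) \<in> K n" if "u \<in> K n" "v \<in> K n" for u v n
  proof -
    have uv: "u \<in> Dom" "v \<in> Dom" "L2_dist M u w \<le> \<delta> n" "L2_dist M v w \<le> \<delta> n"
      using that by (auto simp: K_def)
    have eq: "(1/2) * u x + (1/2) * v x - w x = (1/2) * (u x - w x) + (1/2) * (v x - w x)" for x
      by (simp add: field_simps)
    have "(LINT x|M. ((1/2) * u x + (1/2) * v x - w x)\<^sup>2) =
        L2_form M (\<lambda>x. (1/2) * (u x - w x) + (1/2) * (v x - w x))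
            (\<lambda>x. (1/2) * (u x - w x) + (1/2) * (v x - w x))"
      by (simp only: L2_form_def power2_eq_square eq)
    also have "\<dots> \<le> 2 * (1/2)\<^sup>2 * sq_dist (L2_form M) u w +
        2 * (1/2)\<^sup>2 * sq_dist (L2_form M) v w"
      using in_L2[OF uv(1)] in_L2[OF uv(2)] w(1) by (intro L2.lincomb_le L2.diff_in)
    also have "\<dots> \<le> \<delta> n"
      using uv(3,4) unfolding L2_form_diff by (simp add: power2_eq_square)
    finally show ?thesis
      using lincomb_in[OF uv(1,2), of "1/2" "1/2"] by (simp add: K_def)
  qed
  \<comment> \<open>For \<open>n \<le> m\<close> both near-minimisers lie in the convex set
    \<open>K n\<close>, and so does their midpoint, whose energy is at least \<open>d n\<close>. The
    parallelogram identity turns this lower bound into an upper bound for the difference.\<close>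
  have diff: "sq_dist E (V m) (V n) \<le> 2 * (d m - d n) + 4 * \<delta> n" if "n \<le> m" for m n
  proof -
    have "V m \<in> K n"
      using V(1) K_mono[OF that] by blast
    then have "d n \<le> E (\<lambda>x. (1/2) * V m x + (1/2) * V n x) (\<lambda>x. (1/2) * V m x + (1/2) * V n x)"
      by (intro d_le mid V(1))
    also have "\<dots> = (1/2)\<^sup>2 * E (V m) (V m) + 2 * (1/2) * (1/2) * E (V m) (V n) + (1/2)\<^sup>2 * E (V n)
        (V n)"
      by (rule quadratic[OF VD VD])
    finally have "4 * d n \<le> E (V m) (V m) + 2 * E (V m) (V n) + E (V n) (V n)"
      by (simp add: power2_eq_square)
    then show ?thesis
      using quadratic_diff[OF VD[of m] VD[of n]] V(2)[of m] V(2)[of n] \<delta>(3)[OF that] by simp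
  qed
  have "form_Cauchy E V"
    unfolding form_Cauchy_def
  proof (intro allI impI)
    fix \<epsilon> :: real assume "0 < \<epsilon>"
    have "(\<lambda>n. 2 * ((SUP n. d n) - d n) + 4 * \<delta> n) \<longlonglongrightarrow> 2 * ((SUP n. d n) - (SUP n. d n)) + 4 * 0"
      by (intro tendsto_intros conv_d \<delta>)
    then have "\<forall>\<^sub>F n in sequentially. 2 * ((SUP n. d n) - d n) + 4 * \<delta> n < \<epsilon>"
      using \<open>0 < \<epsilon>\<close> by (intro order_tendstoD(2)) simp_all
    then obtain N where N: "\<And>n. n \<ge> N \<Longrightarrow> 2 * ((SUP n. d n) - d n) + 4 * \<delta> n < \<epsilon>"
      unfolding eventually_sequentially by blast
    have d_sup: "d m \<le> (SUP n. d n)" for m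
      using d_A by (intro cSUP_upper bdd_aboveI[of _ A]) auto
    have le: "sq_dist E (V m) (V n) < \<epsilon>" if "n \<ge> N" "n \<le> m" for m n
      using diff[OF that(2)] N[OF that(1)] d_sup[of m] by simp
    have "sq_dist E (V m) (V n) < \<epsilon>" if "m \<ge> N" "n \<ge> N" for m n
      using le[of n m] le[of m n] that diff_swap[OF VD[of m] VD[of n]] by (cases "n \<le> m") auto
    then show "\<exists>N. \<forall>m\<ge>N. \<forall>n\<ge>N. sq_dist E (V m) (V n) < \<epsilon>"
      by blast
  qed
  moreover have "L2_converges M V w"
    unfolding L2_converges_def
    using V(1) by (intro Lim_null_comparison[OF _ \<delta>(1)]) (auto simp: K_def intro: always_eventually)
  ultimately have ap: "approximates M Dom E V w"
    using VD by (simp add: approximates_def)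
  show "w \<in> CD"
    by (rule closure_domainI[OF w(1) ap])
  show "CE w w \<le> A"
  proof (rule LIMSEQ_le[OF closure_form_limit[OF w(1) w(1) ap ap]])
    show "(\<lambda>n. A + \<delta> n) \<longlonglongrightarrow> A"
      using tendsto_add[OF tendsto_const \<delta>(1), of A] by simp
    show "\<exists>N. \<forall>n\<ge>N. E (V n) (V n) \<le> A + \<delta> n"
    proof (intro exI allI impI)
      show "E (V n) (V n) \<le> A + \<delta> n" for n
        using V(2)[of n] d_A[of n] by simp
    qed
  qed
qed

text \<open>The functions \<open>\<phi> n (U n x)\<close> converge in \<open>L2\<close> because
  clamping is 1-Lipschitz and \<open>\<phi> n\<close> is uniformly within \<open>c n\<close> of it.
  Their energies are at most those of \<open>U n\<close>, which tend to \<open>CE u u\<close>, so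
  lower semicontinuity applies.\<close>

lemma closure_unit_contraction:
  assumes contr: "\<And>n v. v \<in> Dom \<Longrightarrow> (\<lambda>x. \<phi> n (v x)) \<in> Dom \<and> E (\<lambda>x. \<phi> n (v x)) (\<lambda>x. \<phi> n (v x)) \<le> E v v"
    and close: "\<And>n t. \<bar>\<phi> n t - min (max t 0) 1\<bar> \<le> c n" "c \<longlonglongrightarrow> (0::real)"
    and u: "u \<in> CD"
  shows "(\<lambda>x. min (max (u x) 0) 1) \<in> CD"
    "CE (\<lambda>x. min (max (u x) 0) 1) (\<lambda>x. min (max (u x) 0) 1) \<le> CE u u"
proof -
  obtain U where uL: "u \<in> L2_space M" and U: "approximates M Dom E U u"
    using closure_domainE[OF u] .
  define w where "w x = min (max (u x) 0) 1" for x
  have meas [measurable]: "u \<in> borel_measurable M"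
    using uL by (simp add: L2_space_def)
  have wm [measurable]: "w \<in> borel_measurable M"
    unfolding w_def by measurable
  have "integrable M (\<lambda>x. (w x)\<^sup>2)"
    by (rule integrable_const_bound[of _ 1]) (auto simp: w_def power_le_one)
  then have wL: "w \<in> L2_space M"
    using wm by (simp add: L2_space_def)
  have D: "(\<lambda>x. \<phi> n (U n x)) \<in> Dom" for n
    using contr[OF approximatesD(1)[OF U]] by blast
  have "L2_converges M (\<lambda>n x. \<phi> n (U n x)) w"
    unfolding L2_converges_def
  proof (rule Lim_null_comparison)
    have pt: "(\<phi> n (U n x) - w x)\<^sup>2 \<le> 2 * (c n)\<^sup>2 + 2 * (U n x - u x)\<^sup>2" for n x
    proof -
      have "\<bar>min (max (U n x) 0) 1 - w x\<bar> \<le> \<bar>U n x - u x\<bar>"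
        unfolding w_def by linarith
      then have "\<bar>\<phi> n (U n x) - w x\<bar> \<le> c n + \<bar>U n x - u x\<bar>"
        using close(1)[of n "U n x"] by linarith
      then have "(\<phi> n (U n x) - w x)\<^sup>2 \<le> (c n + \<bar>U n x - u x\<bar>)\<^sup>2"
        using power_mono[of "\<bar>\<phi> n (U n x) - w x\<bar>" "c n + \<bar>U n x - u x\<bar>" 2] by simp
      also have "\<dots> \<le> 2 * (c n)\<^sup>2 + 2 * \<bar>U n x - u x\<bar>\<^sup>2"
        using zero_le_power2[of "c n - \<bar>U n x - u x\<bar>"] by (simp only: power2_sum power2_diff)
      finally show ?thesis
        by simp
    qed
    have "(LINT x|M. (\<phi> n (U n x) - w x)\<^sup>2) \<le> 2 * (c n)\<^sup>2 + 2 * L2_dist M (U n) u" for n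
    proof -
      have "integrable M (\<lambda>x. (U n x - u x)\<^sup>2)"
        using L2.diff_in[OF in_L2[OF approximatesD(1)[OF U]] uL, of n] by (simp add: L2_space_def)
      moreover have "integrable M (\<lambda>x. (\<phi> n (U n x) - w x)\<^sup>2)"
        using L2.diff_in[OF in_L2[OF D] wL, of n] by (simp add: L2_space_def)
      ultimately have "(LINT x|M. (\<phi> n (U n x) - w x)\<^sup>2) \<le>
          (LINT x|M. 2 * (c n)\<^sup>2 + 2 * (U n x - u x)\<^sup>2)"
        using pt by (intro integral_mono) auto
      also have "\<dots> = 2 * (c n)\<^sup>2 + 2 * L2_dist M (U n) u"
        using \<open>integrable M (\<lambda>x. (U n x - u x)\<^sup>2)\<close> by (simp add: prob_space)
      finally show ?thesis .
    qed
    then show "\<forall>\<^sub>F n in sequentially. norm (LINT x|M. (\<phi> n (U n x) - w x)\<^sup>2) \<le>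
        2 * (c n)\<^sup>2 + 2 * L2_dist M (U n) u"
      by simp
    have "(\<lambda>n. 2 * (c n)\<^sup>2 + 2 * L2_dist M (U n) u) \<longlonglongrightarrow> 2 * 0\<^sup>2 + 2 * 0"
      using approximatesD(3)[OF U] unfolding L2_converges_def by (intro tendsto_intros close)
    then show "(\<lambda>n. 2 * (c n)\<^sup>2 + 2 * L2_dist M (U n) u) \<longlonglongrightarrow> 0"
      by simp
  qed
  note lsc = closure_lower_semicontinuous[OF D wL this
      conjunct2[OF contr[OF approximatesD(1)[OF U]]]
      closure_form_limit[OF uL uL U U]]
  show "(\<lambda>x. min (max (u x) 0) 1) \<in> CD"
    using lsc(1) by (simp only: w_def[abs_def])
  show "CE (\<lambda>x. min (max (u x) 0) 1) (\<lambda>x. min (max (u x) 0) 1) \<le> CE u u"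
    using lsc(2) by (simp only: w_def[abs_def])
qed

end

section \<open>Gaussian integration by parts\<close>

lemma DERIV_bounded_imp_Lipschitz:
  fixes f :: "real \<Rightarrow> real"
  assumes "\<And>t. (f has_real_derivative f' t) (at t)" "\<And>t. \<bar>f' t\<bar> \<le> B"
  shows "\<bar>f b - f a\<bar> \<le> B * \<bar>b - a\<bar>"
proof (cases a b rule: linorder_cases)
  case less
  then show ?thesis
    using MVT2[OF less assms(1)] assms(2) by (auto simp: abs_mult mult.commute intro!:
        mult_right_mono)
next
  case greater
  then show ?thesis
    using MVT2[OF greater assms(1)] assms(2)
    by (auto simp: abs_mult mult.commute abs_minus_commute[of "f b"] abs_minus_commute[of b] intro!:
        mult_right_mono)
qed simp

locale gaussian = prob_space \<mu>
  for \<mu> :: "'a::{real_inner, polish_space} measure" +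
  fixes Q :: "'a \<Rightarrow>\<^sub>L 'a"
  assumes self_adjoint: "self_adjoint Q"
    and sets_eq [measurable_cong]: "sets \<mu> = sets borel"
    and Fourier: "(CLINT x|\<mu>. iexp (x \<bullet> h)) = complex_of_real (exp (- (Q h \<bullet> h) / 2))"
begin

lemma measurable_continuous:
  fixes w :: "'a \<Rightarrow> 'c::topological_space"
  assumes "continuous_on UNIV w"
  shows "w \<in> borel_measurable \<mu>"
  using borel_measurable_continuous_onI[OF assms] by measurable

lemma inner_measurable [measurable]: "(\<lambda>x. x \<bullet> h) \<in> borel_measurable \<mu>"
  by (intro measurable_continuous continuous_intros)

lemma bounded_integrable:
  fixes w :: "'a \<Rightarrow> real"
  assumes "w \<in> borel_measurable \<mu>" "\<And>x. \<bar>w x\<bar> \<le> B"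
  shows "integrable \<mu> w"
  using assms by (intro integrable_const_bound[of _ B]) auto

lemma integral_trig:
  "(LINT x|\<mu>. cos (x \<bullet> h)) = exp (- (Q h \<bullet> h) / 2)"
  "(LINT x|\<mu>. sin (x \<bullet> h)) = 0"
proof -
  have int: "integrable \<mu> (\<lambda>x. iexp (x \<bullet> h))"
    by (intro integrable_const_bound[of _ 1]) auto
  have "(LINT x|\<mu>. cos (x \<bullet> h)) = Re (CLINT x|\<mu>. iexp (x \<bullet> h))"
    using integral_Re[OF int] by (simp add: Re_exp)
  then show "(LINT x|\<mu>. cos (x \<bullet> h)) = exp (- (Q h \<bullet> h) / 2)"
    by (simp only: Fourier Re_complex_of_real)
  have "(LINT x|\<mu>. sin (x \<bullet> h)) = Im (CLINT x|\<mu>. iexp (x \<bullet> h))"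
    using integral_Im[OF int] by (simp add: Im_exp)
  then show "(LINT x|\<mu>. sin (x \<bullet> h)) = 0"
    by (simp only: Fourier Im_complex_of_real)
qed

lemma trig_integrable: "integrable \<mu> (\<lambda>x. cos (x \<bullet> h))" "integrable \<mu> (\<lambda>x. sin (x \<bullet> h))"
  by (auto intro!: bounded_integrable[of _ 1])

text \<open>Fatou's lemma for \<open>2 n\<^sup>2 (1 - cos (x \<bullet> h / n)) \<longlonglongrightarrow> (x \<bullet> h)\<^sup>2\<close>.\<close>

lemma inner_square_integrable: "integrable \<mu> (\<lambda>x. (x \<bullet> h)\<^sup>2)"
proof (rule integrableI_nonneg)
  define s where "s = (\<lambda>n x. real (Suc n) * sin (inverse (real (Suc n)) * (x \<bullet> h)))"
  define q where "q = Q h \<bullet> h"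
  have lim: "(\<lambda>n. ennreal ((s n x)\<^sup>2)) \<longlonglongrightarrow> ennreal ((x \<bullet> h)\<^sup>2)" for x
  proof -
    have "((\<lambda>t. sin (t * (x \<bullet> h))) has_real_derivative x \<bullet> h) (at 0)"
      by (auto intro!: derivative_eq_intros)
    from DERIV_sequentially[OF this] have "(\<lambda>n. s n x) \<longlonglongrightarrow> x \<bullet> h"
      by (simp only: s_def mult_zero_left sin_zero diff_zero)
    then show ?thesis
      by (intro tendsto_ennrealI tendsto_power)
  qed
  \<comment> \<open>The absolute value makes the bound meaningful in \<open>ennreal\<close> whatever
    the sign of \<open>q\<close>.\<close>
  have bound: "(\<integral>\<^sup>+x. ennreal ((s n x)\<^sup>2) \<partial>\<mu>) \<le> ennreal \<bar>q\<bar>" for n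
  proof -
    define N where "N = real (Suc n)"
    have "N > 0" by (simp add: N_def)
    \<comment> \<open>The double-angle formula expresses the square through a cosine, whose integral
      the Fourier transform gives.\<close>
    have s_eq: "(s n x)\<^sup>2 = N\<^sup>2 / 2 * (1 - cos (x \<bullet> ((2 / N) *\<^sub>R h)))" for x
    proof -
      have "cos (x \<bullet> ((2 / N) *\<^sub>R h)) = cos (2 * (inverse N * (x \<bullet> h)))"
        by (simp add: divide_inverse mult.assoc)
      also have "\<dots> = 1 - 2 * (sin (inverse N * (x \<bullet> h)))\<^sup>2"
        by (rule cos_double_sin)
      finally show ?thesis
        by (simp add: s_def N_def power_mult_distrib)
    qed
    have int: "integrable \<mu> (\<lambda>x. (s n x)\<^sup>2)"
      unfolding s_eq by (intro integrable_mult_right Bochner_Integration.integrable_diff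
        trig_integrable integrable_const)
    have "(\<integral>\<^sup>+x. ennreal ((s n x)\<^sup>2) \<partial>\<mu>) = ennreal (LINT x|\<mu>. (s n x)\<^sup>2)"
      by (rule nn_integral_eq_integral[OF int]) simp
    also have "(LINT x|\<mu>. (s n x)\<^sup>2) = N\<^sup>2 / 2 * (LINT x|\<mu>. 1 - cos (x \<bullet> ((2 / N) *\<^sub>R h)))"
      unfolding s_eq by (rule integral_mult_right_zero)
    also have "(LINT x|\<mu>. 1 - cos (x \<bullet> ((2 / N) *\<^sub>R h))) = 1 - exp
        (- (Q ((2 / N) *\<^sub>R h) \<bullet> ((2 / N) *\<^sub>R h)) / 2)"
      unfolding Bochner_Integration.integral_diff[OF integrable_const trig_integrable(1)]
          integral_trig
      by (simp add: prob_space)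
    also have "Q ((2 / N) *\<^sub>R h) \<bullet> ((2 / N) *\<^sub>R h) = (2 / N)\<^sup>2 * q"
      by (simp only: q_def blinfun.scaleR_right inner_scaleR_left inner_scaleR_right
          power2_eq_square mult.assoc)
    \<comment> \<open>The inequality \<open>1 - exp (- t) \<le> t\<close> yields a bound in which
      \<open>N\<close> cancels.\<close>
    also have "N\<^sup>2 / 2 * (1 - exp (- ((2 / N)\<^sup>2 * q) / 2)) \<le> N\<^sup>2 / 2 * ((2 / N)\<^sup>2 * q / 2)"
      using exp_ge_add_one_self[of "- ((2 / N)\<^sup>2 * q) / 2"]
      by (intro mult_left_mono) auto
    also have "\<dots> = q"
      using \<open>N > 0\<close> by (simp add: power_divide)
    finally show ?thesis
      by (simp add: ennreal_leI order_trans)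
  qed
  have "(\<integral>\<^sup>+x. ennreal ((x \<bullet> h)\<^sup>2) \<partial>\<mu>) = (\<integral>\<^sup>+x. liminf (\<lambda>n. ennreal ((s n x)\<^sup>2)) \<partial>\<mu>)"
    by (intro nn_integral_cong lim_imp_Liminf[OF sequentially_bot lim, symmetric])
  also have "\<dots> \<le> liminf (\<lambda>n. \<integral>\<^sup>+x. ennreal ((s n x)\<^sup>2) \<partial>\<mu>)"
    unfolding s_def by (intro nn_integral_liminf) measurable
  also have "\<dots> \<le> limsup (\<lambda>n. \<integral>\<^sup>+x. ennreal ((s n x)\<^sup>2) \<partial>\<mu>)"
    by (rule Liminf_le_Limsup) simp
  also have "\<dots> \<le> ennreal \<bar>q\<bar>"
    by (rule Limsup_bounded) (simp add: bound)
  finally show "(\<integral>\<^sup>+x. ennreal ((x \<bullet> h)\<^sup>2) \<partial>\<mu>) < \<infinity>"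
    by (simp add: order_le_less_trans)
qed simp_all

lemma inner_integrable: "integrable \<mu> (\<lambda>x. x \<bullet> h)"
  using square_integrable_imp_integrable inner_square_integrable inner_measurable by blast

lemma bounded_mult_inner_integrable:
  fixes w :: "'a \<Rightarrow> real"
  assumes "w \<in> borel_measurable \<mu>" "\<And>x. \<bar>w x\<bar> \<le> B"
  shows "integrable \<mu> (\<lambda>x. w x * (x \<bullet> h))"
proof (rule Bochner_Integration.integrable_bound)
  show "integrable \<mu> (\<lambda>x. B * (x \<bullet> h))"
    by (intro integrable_mult_right inner_integrable)
  show "AE x in \<mu>. norm (w x * (x \<bullet> h)) \<le> norm (B * (x \<bullet> h))"
    using assms(2) by (intro AE_I2) (force simp: abs_mult intro!: mult_right_mono intro:
        order_trans)
qed (use assms(1) in measurable)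

text \<open>Derivatives of the Fourier transform at \<open>k\<close> in direction \<open>h\<close>.
  Differentiation under the integral is justified by the majorant
  \<open>\<bar>x \<bullet> h\<bar>\<close>, and self-adjointness merges the two mixed terms of the
  quadratic exponent.\<close>

lemma integral_inner_trig:
  "(LINT x|\<mu>. sin (x \<bullet> k) * (x \<bullet> h)) = (Q h \<bullet> k) * exp (- (Q k \<bullet> k) / 2)" (is ?sin)
  "(LINT x|\<mu>. cos (x \<bullet> k) * (x \<bullet> h)) = 0" (is ?cos)
proof -
  have swap: "Q k \<bullet> h = Q h \<bullet> k"
    using self_adjoint unfolding self_adjoint_def by (metis inner_commute)
  have DCT: "(\<lambda>n. real (Suc n) * ((LINT x|\<mu>. p (x \<bullet> (k + inverse (real (Suc n)) *\<^sub>R h))) -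
      (LINT x|\<mu>. p (x \<bullet> k))))
      \<longlonglongrightarrow> (LINT x|\<mu>. p' (x \<bullet> k) * (x \<bullet> h))"
    if p: "\<And>t. (p has_real_derivative p' t) (at t)" "\<And>t. \<bar>p' t\<bar> \<le> 1" "\<And>t. \<bar>p t\<bar> \<le> 1"
      and p'[measurable]: "p' \<in> borel_measurable borel" for p p' :: "real \<Rightarrow> real"
  proof -
    have [measurable]: "p \<in> borel_measurable borel"
      using p(1) by (intro borel_measurable_continuous_onI DERIV_continuous_on)
          (rule has_field_derivative_at_within)
    have int: "integrable \<mu> (\<lambda>x. p (x \<bullet> l))" for l
      using p(3) by (intro bounded_integrable[of _ 1]) auto
    have "(\<lambda>n. LINT x|\<mu>. real (Suc n) * (p (x \<bullet> (k + inverse (real (Suc n)) *\<^sub>R h)) - p (x \<bullet> k)))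
      \<longlonglongrightarrow> (LINT x|\<mu>. p' (x \<bullet> k) * (x \<bullet> h))"
    proof (rule integral_dominated_convergence)
      show "integrable \<mu> (\<lambda>x. \<bar>x \<bullet> h\<bar>)"
        by (intro integrable_abs inner_integrable)
      show "AE x in \<mu>. (\<lambda>n. real (Suc n) * (p (x \<bullet> (k + inverse (real (Suc n)) *\<^sub>R h)) - p (x \<bullet> k)))
          \<longlonglongrightarrow> p' (x \<bullet> k) * (x \<bullet> h)"
      proof (rule AE_I2)
        fix x
        have "((\<lambda>t. x \<bullet> k + t * (x \<bullet> h)) has_real_derivative x \<bullet> h) (at 0)"
          by (auto intro!: derivative_eq_intros)
        then have "((\<lambda>t. p (x \<bullet> k + t * (x \<bullet> h))) has_real_derivative p' (x \<bullet> k + 0 * (x \<bullet> h)) *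
            (x \<bullet> h)) (at 0)"
          by (rule DERIV_chain2[OF p(1)])
        from DERIV_sequentially[OF this]
        show "(\<lambda>n. real (Suc n) * (p (x \<bullet> (k + inverse (real (Suc n)) *\<^sub>R h)) - p (x \<bullet> k)))
          \<longlonglongrightarrow> p' (x \<bullet> k) * (x \<bullet> h)"
          by (simp add: inner_add_right)
      qed
      show "AE x in \<mu>. norm (real (Suc n) * (p (x \<bullet> (k + inverse (real (Suc n)) *\<^sub>R h)) - p
          (x \<bullet> k))) \<le> \<bar>x \<bullet> h\<bar>" for n
      proof (rule AE_I2)
        fix x
        show "norm (real (Suc n) * (p (x \<bullet> (k + inverse (real (Suc n)) *\<^sub>R h)) - p (x \<bullet> k))) \<le> \<bar>x \<bullet>
            h\<bar>"
          using mult_left_mono[OF DERIV_bounded_imp_Lipschitz[OF p(1,2),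
              of "x \<bullet> (k + inverse (real (Suc n)) *\<^sub>R h)" "x \<bullet> k"], of "real (Suc n)"]
          by (simp add: inner_add_right abs_mult mult.assoc[symmetric])
      qed
    qed measurable
    then show ?thesis
      using int by simp
  qed
  have Q_expand: "Q (k + t *\<^sub>R h) \<bullet> (k + t *\<^sub>R h) = Q k \<bullet> k + 2 * t * (Q h \<bullet> k) + t\<^sup>2 * (Q h \<bullet> h)"
      for t
    by (simp add: blinfun.add_right blinfun.scaleR_right inner_add_left inner_add_right swap
        power2_eq_square distrib_left)
  have "(\<lambda>n. real (Suc n) * (exp (- (Q (k + inverse (real (Suc n)) *\<^sub>R h) \<bullet>
      (k + inverse (real (Suc n)) *\<^sub>R h)) / 2)
      - exp (- (Q k \<bullet> k) / 2))) \<longlonglongrightarrow> - (Q h \<bullet> k) * exp (- (Q k \<bullet> k) / 2)"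
  proof -
    have "((\<lambda>t. exp (- (Q k \<bullet> k + 2 * t * (Q h \<bullet> k) + t\<^sup>2 * (Q h \<bullet> h)) / 2)) has_real_derivative
        - (Q h \<bullet> k) * exp (- (Q k \<bullet> k) / 2)) (at 0)"
      by (auto intro!: derivative_eq_intros)
    from DERIV_sequentially[OF this] show ?thesis
      unfolding Q_expand by simp
  qed
  moreover have "(\<lambda>n. real (Suc n) * (exp (- (Q (k + inverse (real (Suc n)) *\<^sub>R h) \<bullet>
      (k + inverse (real (Suc n)) *\<^sub>R h)) / 2)
      - exp (- (Q k \<bullet> k) / 2))) \<longlonglongrightarrow> (LINT x|\<mu>. - sin (x \<bullet> k) * (x \<bullet> h))"
    unfolding integral_trig(1)[symmetric]
    by (rule DCT) (auto intro!: derivative_eq_intros)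
  ultimately have "(LINT x|\<mu>. - sin (x \<bullet> k) * (x \<bullet> h)) = - (Q h \<bullet> k) * exp (- (Q k \<bullet> k) / 2)"
    using LIMSEQ_unique by blast
  then show ?sin
    by simp
  have "(\<lambda>n. real (Suc n) * (0 - 0)) \<longlonglongrightarrow> (LINT x|\<mu>. cos (x \<bullet> k) * (x \<bullet> h))"
    using DCT[of sin cos] unfolding integral_trig(2) by (auto intro!: derivative_eq_intros)
  then show ?cos
    using LIMSEQ_unique[of "\<lambda>n. 0" _ 0] by (simp add: LIMSEQ_const_iff)
qed

text \<open>Integrals over \<open>t\<close> between 0 and \<open>T\<close> are rescaled to
  \<open>t = s * T\<close>: one probability measure then serves every \<open>T\<close>, and
  \<open>T = 0\<close> is the limit needed for integration by parts.\<close>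

definition unif :: "real measure" where
  "unif = density lborel (\<lambda>s. ennreal (indicator {0..1} s))"

lemma sets_unif [measurable_cong]: "sets unif = sets borel"
  by (simp add: unif_def)

lemma prob_space_unif: "prob_space unif"
  by (rule prob_spaceI) (simp add: unif_def emeasure_density nn_integral_indicator
      ennreal_indicator)

lemma integral_unif_FTC:
  assumes "\<And>s. (F has_real_derivative f s) (at s)" "continuous_on UNIV f"
  shows "(LINT s|unif. f s) = F 1 - F 0"
proof -
  have "(LINT s|unif. f s) = (LINT s|lborel. indicator {0..1} s *\<^sub>R f s)"
    unfolding unif_def
    by (rule integral_density) (auto intro: borel_measurable_continuous_onI[OF assms(2)])
  also have "\<dots> = (LINT s|lborel. f s * indicator {0..1} s)"
    by (simp add: mult.commute)
  also have "\<dots> = F 1 - F 0"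
    using assms by (intro integral_FTC_Icc_real) (auto simp: continuous_on_eq_continuous_at)
  finally show ?thesis .
qed

lemma shift_measurable:
  fixes w :: "'a \<Rightarrow> real"
  assumes [measurable]: "w \<in> borel_measurable borel"
  shows "(\<lambda>(s, x). w (x + (s * T) *\<^sub>R d)) \<in> borel_measurable (unif \<Otimes>\<^sub>M \<mu>)"
    and "(\<lambda>x. w (x + T *\<^sub>R d)) \<in> borel_measurable \<mu>"
    and "(\<lambda>(s, x). w (x + (s * T) *\<^sub>R d) * (x \<bullet> h)) \<in> borel_measurable (unif \<Otimes>\<^sub>M \<mu>)"
  by measurable

lemma shift_inner_integrable:
  fixes w :: "'a \<Rightarrow> real"
  assumes w: "w \<in> borel_measurable borel" "\<And>x. \<bar>w x\<bar> \<le> B"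
  shows "integrable (unif \<Otimes>\<^sub>M \<mu>) (\<lambda>(s, x). \<bar>x \<bullet> h\<bar>)"
    and "integrable (unif \<Otimes>\<^sub>M \<mu>) (\<lambda>(s, x). w (x + (s * T) *\<^sub>R d) * (x \<bullet> h))"
proof -
  interpret U: prob_space unif
    by (rule prob_space_unif)
  interpret P: pair_prob_space unif \<mu> ..
  show int: "integrable (unif \<Otimes>\<^sub>M \<mu>) (\<lambda>(s, x). \<bar>x \<bullet> h\<bar>)"
    by (rule P.Fubini_integrable) (auto intro!: integrable_abs inner_integrable)
  show "integrable (unif \<Otimes>\<^sub>M \<mu>) (\<lambda>(s, x). w (x + (s * T) *\<^sub>R d) * (x \<bullet> h))"
  proof (rule Bochner_Integration.integrable_bound)
    show "integrable (unif \<Otimes>\<^sub>M \<mu>) (\<lambda>p. B * (case p of (s, x) \<Rightarrow> \<bar>x \<bullet> h\<bar>))"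
      by (intro integrable_mult_right int)
    show "(\<lambda>(s, x). w (x + (s * T) *\<^sub>R d) * (x \<bullet> h)) \<in> borel_measurable (unif \<Otimes>\<^sub>M \<mu>)"
      by (rule shift_measurable(3)[OF w(1)])
    have "0 \<le> B"
      using w(2)[of 0] by linarith
    then show "AE p in unif \<Otimes>\<^sub>M \<mu>. norm (case p of (s, x) \<Rightarrow> w (x + (s * T) *\<^sub>R d) * (x \<bullet> h)) \<le>
        norm (B * (case p of (s, x) \<Rightarrow> \<bar>x \<bullet> h\<bar>))"
      using w(2) by (intro AE_I2) (auto simp: abs_mult intro!: mult_right_mono)
  qed
qed

abbreviation shift_integral :: "('a \<Rightarrow> real) \<Rightarrow> real \<Rightarrow> 'a \<Rightarrow> real" where
  "shift_integral w T h \<equiv> \<integral>(s, x). w (x + (s * T) *\<^sub>R Q h) * (x \<bullet> h) \<partial>(unif \<Otimes>\<^sub>M \<mu>)"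

text \<open>The law of \<open>x + T Q h\<close> differs from \<open>\<mu>\<close> by the integral over \<open>t \<in> [0, T]\<close> of the shifts by
  \<open>t Q h\<close> of \<open>(x \<bullet> h) d\<mu>\<close>. Both sides of this identity are stable under bounded pointwise limits, so
  it has to be checked for trigonometric functions only.\<close>

lemma shift_identity:
  fixes w :: "'a \<Rightarrow> real"
  assumes "w \<in> borel_measurable borel" "\<And>x. \<bar>w x\<bar> \<le> B"
  shows "(LINT x|\<mu>. w (x + T *\<^sub>R Q h)) - (LINT x|\<mu>. w x) =
    T * shift_integral w T h"
proof -
  interpret U: prob_space unif
    by (rule prob_space_unif)
  interpret P: pair_prob_space unif \<mu> ..
  let ?shift = "\<lambda>w. (LINT x|\<mu>. w (x + T *\<^sub>R Q h)) - (LINT x|\<mu>. w x) =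
    T * shift_integral w T h"
  have fst: "shift_integral w T h =
      (LINT s|unif. LINT x|\<mu>. w (x + (s * T) *\<^sub>R Q h) * (x \<bullet> h))"
    if "w \<in> borel_measurable borel" "\<And>x. \<bar>w x\<bar> \<le> B" for w :: "'a \<Rightarrow> real" and B
    using P.integral_fst[OF shift_inner_integrable(2)[OF that], of T "Q h" h] by simp
  have "w \<in> trig_closure"
    using bounded_borel_trig_closure[OF assms] .
  then have "w \<in> borel_measurable borel \<and> ?shift w"
  proof induction
    case (cos k)
    \<comment> \<open>Shifting by \<open>t *\<^sub>R Q h\<close> advances the phase by
      \<open>t * a\<close>, and \<open>p\<close> is the Fourier transform at \<open>k\<close>. Both
      sides become \<open>cos (T * a) * p - p\<close>.\<close>
    define a where "a = Q h \<bullet> k"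
    define p where "p = exp (- (Q k \<bullet> k) / 2)"
    have meas: "(\<lambda>x. cos (x \<bullet> k)) \<in> borel_measurable borel"
      by measurable
    have shift: "(LINT x|\<mu>. cos ((x + t *\<^sub>R Q h) \<bullet> k)) = cos (t * a) * p" for t
      by (simp add: inner_add_left cos_add integral_trig trig_integrable a_def p_def mult.commute)
    have inner: "(LINT x|\<mu>. cos ((x + t *\<^sub>R Q h) \<bullet> k) * (x \<bullet> h)) = - sin (t * a) * (a * p)" for t
    proof -
      have "(LINT x|\<mu>. cos ((x + t *\<^sub>R Q h) \<bullet> k) * (x \<bullet> h)) =
          (LINT x|\<mu>. cos (t * a) * (cos (x \<bullet> k) * (x \<bullet> h)) - sin (t * a) * (sin (x \<bullet> k) * (x \<bullet> h)))"
        by (intro Bochner_Integration.integral_cong)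
            (auto simp: inner_add_left cos_add a_def algebra_simps)
      also have "\<dots> = - sin (t * a) * (a * p)"
        by (simp add: integral_inner_trig bounded_mult_inner_integrable[of _ 1] a_def p_def)
      finally show ?thesis .
    qed
    have "(LINT s|unif. - sin ((s * T) * a) * (a * p) * T) = cos ((1 * T) * a) * p - cos
        ((0 * T) * a) * p"
      by (rule integral_unif_FTC[where F = "\<lambda>s. cos ((s * T) * a) * p"])
        (auto intro!: derivative_eq_intros continuous_intros simp: algebra_simps)
    then have "T * (LINT s|unif. - sin ((s * T) * a) * (a * p)) = cos (T * a) * p - p"
      by (simp add: mult.commute flip: integral_mult_right_zero)
    then show ?case
      using shift[of T] shift[of 0] meas
      by (subst fst[OF meas, of 1]) (simp_all add: inner)
  next
    case (sin k)
    define a where "a = Q h \<bullet> k"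
    define p where "p = exp (- (Q k \<bullet> k) / 2)"
    have meas: "(\<lambda>x. sin (x \<bullet> k)) \<in> borel_measurable borel"
      by measurable
    have shift: "(LINT x|\<mu>. sin ((x + t *\<^sub>R Q h) \<bullet> k)) = sin (t * a) * p" for t
      by (simp add: inner_add_left sin_add integral_trig trig_integrable a_def p_def mult.commute)
    have inner: "(LINT x|\<mu>. sin ((x + t *\<^sub>R Q h) \<bullet> k) * (x \<bullet> h)) = cos (t * a) * (a * p)" for t
    proof -
      have "(LINT x|\<mu>. sin ((x + t *\<^sub>R Q h) \<bullet> k) * (x \<bullet> h)) =
          (LINT x|\<mu>. cos (t * a) * (sin (x \<bullet> k) * (x \<bullet> h)) + sin (t * a) * (cos (x \<bullet> k) * (x \<bullet> h)))"
        by (intro Bochner_Integration.integral_cong)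
            (auto simp: inner_add_left sin_add a_def algebra_simps)
      also have "\<dots> = cos (t * a) * (a * p)"
        by (simp add: integral_inner_trig bounded_mult_inner_integrable[of _ 1] a_def p_def)
      finally show ?thesis .
    qed
    have "(LINT s|unif. cos ((s * T) * a) * (a * p) * T) = sin ((1 * T) * a) * p - sin ((0 * T) * a)
        * p"
      by (rule integral_unif_FTC[where F = "\<lambda>s. sin ((s * T) * a) * p"])
        (auto intro!: derivative_eq_intros continuous_intros simp: algebra_simps)
    then have "T * (LINT s|unif. cos ((s * T) * a) * (a * p)) = sin (T * a) * p"
      by (simp add: mult.commute flip: integral_mult_right_zero)
    moreover have "(\<integral>(s, x). sin ((x + (s * T) *\<^sub>R Q h) \<bullet> k) * (x \<bullet> h) \<partial>(unif \<Otimes>\<^sub>M \<mu>)) =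
        (LINT s|unif. cos ((s * T) * a) * (a * p))"
      by (subst fst[OF meas, of 1]) (simp_all only: inner abs_sin_le_one)
    ultimately show ?case
      using meas by (simp only: shift integral_trig(2) diff_zero simp_thms)
  next
    case (lincomb v w a b)
    then have meas: "v \<in> borel_measurable borel" "w \<in> borel_measurable borel"
      by auto
    obtain B C where bdd: "\<And>x. \<bar>v x\<bar> \<le> B" "\<And>x. \<bar>w x\<bar> \<le> C"
      using trig_closure_bounded[OF lincomb.hyps(1)] trig_closure_bounded[OF lincomb.hyps(2)] by
          metis
    have int: "integrable \<mu> (\<lambda>x. v (x + t *\<^sub>R Q h))" "integrable \<mu> (\<lambda>x. w (x + t *\<^sub>R Q h))" for t
      using bdd by (auto intro!: bounded_integrable shift_measurable meas)
    have "(\<integral>(s, x). (a * v (x + (s * T) *\<^sub>R Q h) + b * w (x + (s * T) *\<^sub>R Q h)) * (x \<bullet> h)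
        \<partial>(unif \<Otimes>\<^sub>M \<mu>)) =
        (\<integral>p. a * (case p of (s, x) \<Rightarrow> v (x + (s * T) *\<^sub>R Q h) * (x \<bullet> h)) +
          b * (case p of (s, x) \<Rightarrow> w (x + (s * T) *\<^sub>R Q h) * (x \<bullet> h)) \<partial>(unif \<Otimes>\<^sub>M \<mu>))"
      by (intro Bochner_Integration.integral_cong) (auto simp: algebra_simps)
    also have "\<dots> = a * shift_integral v T h +
        b * shift_integral w T h"
      using shift_inner_integrable(2)[OF meas(1) bdd(1)]
          shift_inner_integrable(2)[OF meas(2) bdd(2)]
      by simp
    finally show ?case
      using int[of T] int[of 0] lincomb.IH meas by (simp add: algebra_simps)
  next
    case (lim W B w)
    then have meas: "\<And>n. W n \<in> borel_measurable borel"
      by auto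
    have w: "w \<in> borel_measurable borel"
      by (rule borel_measurable_LIMSEQ_real, rule lim.hyps(3), rule meas)
    have 1: "(\<lambda>n. LINT x|\<mu>. W n (x + t *\<^sub>R Q h)) \<longlonglongrightarrow> (LINT x|\<mu>. w (x + t *\<^sub>R Q h))" for t
      using lim.hyps(2,3)
      by (intro integral_dominated_convergence[where w = "\<lambda>_. B"])
          (auto intro!: shift_measurable meas w)
    have 2: "(\<lambda>n. shift_integral (W n) T h) \<longlonglongrightarrow>
        shift_integral w T h"
    proof (rule integral_dominated_convergence)
      show "integrable (unif \<Otimes>\<^sub>M \<mu>) (\<lambda>p. B * (case p of (s, x) \<Rightarrow> \<bar>x \<bullet> h\<bar>))"
        by (intro integrable_mult_right shift_inner_integrable(1)[OF meas lim.hyps(2)])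
      show "AE p in unif \<Otimes>\<^sub>M \<mu>. (\<lambda>n. case p of (s, x) \<Rightarrow> W n (x + (s * T) *\<^sub>R Q h) * (x \<bullet> h))
          \<longlonglongrightarrow> (case p of (s, x) \<Rightarrow> w (x + (s * T) *\<^sub>R Q h) * (x \<bullet> h))"
        using lim.hyps(3) by (intro AE_I2) (auto intro!: tendsto_mult_right)
      show "AE p in unif \<Otimes>\<^sub>M \<mu>. norm (case p of (s, x) \<Rightarrow> W n (x + (s * T) *\<^sub>R Q h) * (x \<bullet> h))
          \<le> B * (case p of (s, x) \<Rightarrow> \<bar>x \<bullet> h\<bar>)" for n
        using lim.hyps(2) by (intro AE_I2) (auto simp: abs_mult intro!: mult_right_mono)
    qed (rule shift_measurable(3)[OF w] shift_measurable(3)[OF meas])+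
    have "?shift w"
    proof (rule LIMSEQ_unique)
      show "(\<lambda>n. (LINT x|\<mu>. W n (x + T *\<^sub>R Q h)) - (LINT x|\<mu>. W n x)) \<longlonglongrightarrow>
          (LINT x|\<mu>. w (x + T *\<^sub>R Q h)) - (LINT x|\<mu>. w x)"
        using tendsto_diff[OF 1[of T] 1[of 0]] by simp
      show "(\<lambda>n. (LINT x|\<mu>. W n (x + T *\<^sub>R Q h)) - (LINT x|\<mu>. W n x)) \<longlonglongrightarrow>
          T * shift_integral w T h"
        using lim.IH tendsto_mult_left[OF 2, of T] by simp
    qed
    then show ?case
      using w by simp
  qed
  then show ?thesis ..
qed

text \<open>\<open>shift_identity\<close> is divided by \<open>T = t n\<close>, which tends to 0.
  The majorants are the constant \<open>norm (Q h) * C\<close> for the difference quotients and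
  \<open>B * \<bar>x \<bullet> h\<bar>\<close> for the shifted integrand.\<close>

lemma integral_grad_Q:
  assumes w: "w \<in> FCb_infinity"
  shows "(LINT x|\<mu>. Q h \<bullet> grad w x) = (LINT x|\<mu>. w x * (x \<bullet> h))"
proof -
  interpret U: prob_space unif
    by (rule prob_space_unif)
  interpret P: pair_prob_space unif \<mu> ..
  define t where "t n = inverse (real (Suc n))" for n
  have cont: "continuous_on UNIV w"
    by (rule FCb_infinity_continuous[OF w])
  have meas: "w \<in> borel_measurable borel"
    using cont by (rule borel_measurable_continuous_onI)
  obtain B where B: "\<And>x. \<bar>w x\<bar> \<le> B"
    using FCb_infinity_bounded[OF w] by blast
  obtain C where C: "\<And>x. norm (grad w x) \<le> C"
    using FCb_infinity_grad_bounded[OF w] by blast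
  have deriv: "((\<lambda>s. w (x + s *\<^sub>R Q h)) has_real_derivative Q h \<bullet> grad w (x + s *\<^sub>R Q h)) (at s)"
      for x s
  proof -
    have "((\<lambda>s. x + s *\<^sub>R Q h) has_derivative (\<lambda>s. s *\<^sub>R Q h)) (at s)"
      by (auto intro!: derivative_eq_intros)
    moreover have "(w has_derivative (\<lambda>d. d \<bullet> grad w (x + s *\<^sub>R Q h))) (at (x + s *\<^sub>R Q h))"
      using FCb_infinity_GDERIV[OF w] by (simp only: gderiv_def)
    ultimately have "((\<lambda>s. w (x + s *\<^sub>R Q h)) has_derivative
        (\<lambda>r. (r *\<^sub>R Q h) \<bullet> grad w (x + s *\<^sub>R Q h))) (at s)"
      by (rule has_derivative_compose)
    then show ?thesis
      by (simp add: has_field_derivative_def mult_commute_abs)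
  qed
  have grad_le: "\<bar>Q h \<bullet> grad w x\<bar> \<le> norm (Q h) * C" for x
    by (rule order_trans[OF Cauchy_Schwarz_ineq2]) (intro mult_left_mono C norm_ge_zero)
  have lhs: "(\<lambda>n. LINT x|\<mu>. real (Suc n) * (w (x + t n *\<^sub>R Q h) - w x)) \<longlonglongrightarrow>
      (LINT x|\<mu>. Q h \<bullet> grad w x)"
  proof (rule integral_dominated_convergence)
    show "integrable \<mu> (\<lambda>x. norm (Q h) * C)"
      by simp
    show "(\<lambda>x. Q h \<bullet> grad w x) \<in> borel_measurable \<mu>"
      by (intro measurable_continuous continuous_intros FCb_infinity_grad_continuous w)
    show "(\<lambda>x. real (Suc n) * (w (x + t n *\<^sub>R Q h) - w x)) \<in> borel_measurable \<mu>" for n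
      using meas by measurable
    show "AE x in \<mu>. (\<lambda>n. real (Suc n) * (w (x + t n *\<^sub>R Q h) - w x)) \<longlonglongrightarrow> Q h \<bullet> grad w x"
      using DERIV_sequentially[OF deriv] by (intro AE_I2) (simp add: t_def)
    show "AE x in \<mu>. norm (real (Suc n) * (w (x + t n *\<^sub>R Q h) - w x)) \<le> norm (Q h) * C" for n
    proof (rule AE_I2)
      fix x
      have "\<bar>w (x + t n *\<^sub>R Q h) - w (x + 0 *\<^sub>R Q h)\<bar> \<le> norm (Q h) * C * \<bar>t n - 0\<bar>"
        by (rule DERIV_bounded_imp_Lipschitz[OF deriv grad_le])
      then have "real (Suc n) * \<bar>w (x + t n *\<^sub>R Q h) - w x\<bar> \<le> real (Suc n) * (norm (Q h) * C * t n)"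
        by (intro mult_left_mono) (auto simp: t_def)
      also have "\<dots> = norm (Q h) * C"
        by (simp add: t_def)
      finally show "norm (real (Suc n) * (w (x + t n *\<^sub>R Q h) - w x)) \<le> norm (Q h) * C"
        by (simp add: abs_mult)
    qed
  qed
  have "(\<lambda>n. shift_integral w (t n) h) \<longlonglongrightarrow>
      shift_integral w 0 h"
  proof (rule integral_dominated_convergence)
    show "integrable (unif \<Otimes>\<^sub>M \<mu>) (\<lambda>p. B * (case p of (s, x) \<Rightarrow> \<bar>x \<bullet> h\<bar>))"
      by (intro integrable_mult_right shift_inner_integrable(1)[OF meas B])
    have "(\<lambda>n. w (x + (s * t n) *\<^sub>R Q h)) \<longlonglongrightarrow> w (x + (s * 0) *\<^sub>R Q h)" for s x
      using cont unfolding t_def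
      by (intro isCont_tendsto_compose[where g = w] tendsto_intros LIMSEQ_inverse_real_of_nat)
        (auto simp: continuous_on_eq_continuous_at)
    then show "AE p in unif \<Otimes>\<^sub>M \<mu>. (\<lambda>n. case p of (s, x) \<Rightarrow> w (x + (s * t n) *\<^sub>R Q h) * (x \<bullet> h))
        \<longlonglongrightarrow> (case p of (s, x) \<Rightarrow> w (x + (s * 0) *\<^sub>R Q h) * (x \<bullet> h))"
      by (intro AE_I2) (auto intro!: tendsto_mult_right)
    show "AE p in unif \<Otimes>\<^sub>M \<mu>. norm (case p of (s, x) \<Rightarrow> w (x + (s * t n) *\<^sub>R Q h) * (x \<bullet> h))
        \<le> B * (case p of (s, x) \<Rightarrow> \<bar>x \<bullet> h\<bar>)" for n
      using B by (intro AE_I2) (auto simp: abs_mult intro!: mult_right_mono)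
  qed (rule shift_measurable(3)[OF meas])+
  moreover have "shift_integral w 0 h = (LINT x|\<mu>. w x * (x \<bullet> h))"
    using P.integral_fst[OF shift_inner_integrable(2)[OF meas B], of 0 "Q h" h] by
        (simp add: U.prob_space)
  moreover have "(LINT x|\<mu>. real (Suc n) * (w (x + t n *\<^sub>R Q h) - w x)) =
      shift_integral w (t n) h" for n
  proof -
    have "integrable \<mu> (\<lambda>x. w (x + s *\<^sub>R Q h))" for s
      using B by (intro bounded_integrable shift_measurable meas)
    from this[of "t n"] this[of 0]
    have "(LINT x|\<mu>. real (Suc n) * (w (x + t n *\<^sub>R Q h) - w x)) =
        real (Suc n) * ((LINT x|\<mu>. w (x + t n *\<^sub>R Q h)) - (LINT x|\<mu>. w x))"
      by simp
    also have "\<dots> = real (Suc n) * t n * shift_integral w (t n) h"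
      unfolding shift_identity[OF meas B] by simp
    also have "real (Suc n) * t n = 1"
      by (simp add: t_def)
    finally show ?thesis by simp
  qed
  ultimately show ?thesis
    using LIMSEQ_unique lhs by fastforce
qed

lemma bounded_L2:
  assumes "w \<in> borel_measurable borel" "\<And>x. \<bar>w x\<bar> \<le> B"
  shows "w \<in> L2_space \<mu>"
proof -
  have w: "w \<in> borel_measurable \<mu>"
    using assms(1) by measurable
  have "integrable \<mu> (\<lambda>x. (w x)\<^sup>2)"
  proof (rule bounded_integrable)
    show "\<bar>(w x)\<^sup>2\<bar> \<le> B\<^sup>2" for x
      using power_mono[OF assms(2) abs_ge_zero, of x 2] by simp
  qed (use w in measurable)
  then show ?thesis
    using w by (simp add: L2_space_def)
qed

lemma FCb_infinity_L2: "FCb_infinity \<subseteq> L2_space \<mu>"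
proof
  fix u :: "'a \<Rightarrow> real" assume u: "u \<in> FCb_infinity"
  show "u \<in> L2_space \<mu>"
    by (rule FCb_infinity_bounded[OF u],
        rule bounded_L2[OF borel_measurable_continuous_onI[OF FCb_infinity_continuous[OF u]]])
qed

text \<open>The function \<open>l\<close> is minus the Ornstein--Uhlenbeck operator applied to \<open>v\<close>.\<close>

lemma Q_form_representation:
  assumes v: "v \<in> FCb_infinity"
  obtains l where "l \<in> L2_space \<mu>"
    "\<And>u. u \<in> FCb_infinity \<Longrightarrow> (LINT x|\<mu>. Q (grad u x) \<bullet> grad v x) = (LINT x|\<mu>. u x * l x)"
proof -
  obtain m :: nat and p h where p: "\<And>i. i < m \<Longrightarrow> p i \<in> FCb_infinity"
    and g: "grad v = (\<lambda>x. \<Sum>i<m. p i x *\<^sub>R h i)"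
    using FCb_infinity_grad_expansion[OF v] by blast
  \<comment> \<open>The \<open>L2\<close> adjoint of differentiation in direction
    \<open>Q (h i)\<close>, applied to the coefficient \<open>p i\<close>. It is square-integrable
    because \<open>p i\<close> is bounded and \<open>x \<bullet> h i\<close> has a second
    moment.\<close>
  define r where "r i x = p i x * (x \<bullet> h i) - Q (h i) \<bullet> grad (p i) x" for i x
  have dg: "(\<lambda>x. Q k \<bullet> grad w x) \<in> FCb_infinity" if "w \<in> FCb_infinity" for k w
    by (rule FCb_infinity_inner_grad[OF that])
  have meas: "w \<in> borel_measurable \<mu>" if "w \<in> FCb_infinity" for w
    by (intro measurable_continuous FCb_infinity_continuous that)
  have int: "integrable \<mu> w" if "w \<in> FCb_infinity" for w
    using FCb_infinity_bounded[OF that] bounded_integrable[OF meas[OF that]] by blast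
  have int_inner: "integrable \<mu> (\<lambda>x. w x * (x \<bullet> k))" if "w \<in> FCb_infinity" for w k
    using FCb_infinity_bounded[OF that] bounded_mult_inner_integrable[OF meas[OF that]] by blast
  have r_L2: "r i \<in> L2_space \<mu>" if i: "i < m" for i
  proof -
    obtain B where B: "\<And>x. \<bar>p i x\<bar> \<le> B"
      using FCb_infinity_bounded[OF p[OF i]] by blast
    have m: "(\<lambda>x. p i x * (x \<bullet> h i)) \<in> borel_measurable \<mu>"
      by (intro borel_measurable_times meas p i inner_measurable)
    have "integrable \<mu> (\<lambda>x. (p i x * (x \<bullet> h i))\<^sup>2)"
    proof (rule Bochner_Integration.integrable_bound)
      show "integrable \<mu> (\<lambda>x. B\<^sup>2 * (x \<bullet> h i)\<^sup>2)"
        by (intro integrable_mult_right inner_square_integrable)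
      show "AE x in \<mu>. norm ((p i x * (x \<bullet> h i))\<^sup>2) \<le> norm (B\<^sup>2 * (x \<bullet> h i)\<^sup>2)"
        using order_trans[OF B abs_ge_self]
        by (intro AE_I2) (auto simp: power_mult_distrib intro!: mult_right_mono
            abs_le_square_iff[THEN iffD1])
    qed (use m in measurable)
    then have "(\<lambda>x. p i x * (x \<bullet> h i)) \<in> L2_space \<mu>"
      using m by (simp add: L2_space_def)
    from L2.diff_in[OF this subsetD[OF FCb_infinity_L2 dg[OF p[OF i]]]] show ?thesis
      by (simp add: r_def[abs_def])
  qed
  show ?thesis
  proof (rule that[of "\<lambda>x. \<Sum>i<m. r i x"])
    have "n \<le> m \<Longrightarrow> (\<lambda>x. \<Sum>i<n. r i x) \<in> L2_space \<mu>" for n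
    proof (induction n)
      case (Suc n)
      then show ?case
        using L2.lincomb_in[OF Suc.IH r_L2[of n], of 1 1] by simp
    qed (simp add: L2.zero_in)
    then show "(\<lambda>x. \<Sum>i<m. r i x) \<in> L2_space \<mu>"
      by simp
    fix u :: "'a \<Rightarrow> real" assume u: "u \<in> FCb_infinity"
    have term_eq: "(LINT x|\<mu>. p i x * (Q (h i) \<bullet> grad u x)) = (LINT x|\<mu>. u x * r i x)"
      and term_int: "integrable \<mu> (\<lambda>x. u x * r i x)" if i: "i < m" for i
    proof -
      have FC: "(\<lambda>x. p i x * (Q (h i) \<bullet> grad u x)) \<in> FCb_infinity"
        "(\<lambda>x. u x * (Q (h i) \<bullet> grad (p i) x)) \<in> FCb_infinity" "(\<lambda>x. u x * p i x) \<in> FCb_infinity"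
        by (intro FCb_infinity_mult dg p u i)+
      have eq: "u x * r i x = u x * p i x * (x \<bullet> h i) - u x * (Q (h i) \<bullet> grad (p i) x)" for x
        by (simp add: r_def algebra_simps)
      show "integrable \<mu> (\<lambda>x. u x * r i x)"
        unfolding eq by (intro Bochner_Integration.integrable_diff int int_inner FC)
      \<comment> \<open>Integration by parts for the product of \<open>u\<close> and
        \<open>p i\<close>; the product rule separates the wanted term from the one absorbed into
        \<open>r i\<close>.\<close>
      have "(LINT x|\<mu>. u x * p i x * (x \<bullet> h i)) = (LINT x|\<mu>. Q (h i) \<bullet> grad (\<lambda>x. u x * p i x) x)"
        by (rule integral_grad_Q[OF FC(3), symmetric])
      also have "\<dots> = (LINT x|\<mu>. u x * (Q (h i) \<bullet> grad (p i) x) + p i x * (Q (h i) \<bullet> grad u x))"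
        by (simp add: grad_mult[OF u p[OF i]] inner_add_right)
      also have "\<dots> = (LINT x|\<mu>. u x * (Q (h i) \<bullet> grad (p i) x)) +
          (LINT x|\<mu>. p i x * (Q (h i) \<bullet> grad u x))"
        by (intro Bochner_Integration.integral_add int FC)
      finally show "(LINT x|\<mu>. p i x * (Q (h i) \<bullet> grad u x)) = (LINT x|\<mu>. u x * r i x)"
        unfolding eq by (subst Bochner_Integration.integral_diff) (auto intro!: int int_inner FC)
    qed
    have "Q (grad u x) \<bullet> grad v x = (\<Sum>i<m. p i x * (Q (h i) \<bullet> grad u x))" for x
      using self_adjoint unfolding self_adjoint_def g by (simp add: inner_sum_right inner_commute)
    then have "(LINT x|\<mu>. Q (grad u x) \<bullet> grad v x) = (\<Sum>i<m. LINT x|\<mu>. p i x * (Q (h i) \<bullet> grad u x))"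
      by (simp, subst Bochner_Integration.integral_sum) (auto intro!: int FCb_infinity_mult dg p u)
    also have "\<dots> = (\<Sum>i<m. LINT x|\<mu>. u x * r i x)"
      by (intro sum.cong) (simp_all add: term_eq)
    also have "\<dots> = (LINT x|\<mu>. u x * (\<Sum>i<m. r i x))"
      by (simp add: sum_distrib_left, subst Bochner_Integration.integral_sum)
          (auto intro!: term_int)
    finally show "(LINT x|\<mu>. Q (grad u x) \<bullet> grad v x) = (LINT x|\<mu>. u x * (\<Sum>i<m. r i x))" .
  qed
qed

end

section \<open>The square root of the covariance\<close>

lemma blinfun_eqI_dense:
  fixes A B :: "'a::real_normed_vector \<Rightarrow>\<^sub>L 'b::real_normed_vector"
  assumes "closure (span S) = UNIV" "\<And>x. x \<in> S \<Longrightarrow> A x = B x"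
  shows "A = B"
proof (rule blinfun_eqI)
  fix x
  have "span S \<subseteq> {x. A x = B x}"
    using assms(2) by (intro span_minimal) (auto simp: subspace_def blinfun.bilinear_simps)
  moreover have "closed {x. A x = B x}"
    by (intro closed_Collect_eq continuous_intros)
  ultimately have "closure (span S) \<subseteq> {x. A x = B x}"
    by (rule closure_minimal)
  then show "A x = B x"
    using assms(1) by auto
qed

text \<open>The factorisation of \<open>B^2 - r\<close> into \<open>B + sqrt r\<close> and
  \<open>B - sqrt r\<close>: the vector \<open>y = B v - sqrt r v\<close> is annihilated by the
  first factor, which positivity of \<open>B\<close> makes injective.\<close>

lemma positive_root_eigenvector:
  assumes B: "positive_op B" "B o\<^sub>L B = Q" and Q: "Q v = r *\<^sub>R v" "0 < r"
  shows "B v = sqrt r *\<^sub>R v"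
proof -
  define y where "y = B v - sqrt r *\<^sub>R v"
  have BB: "B (B v) = r *\<^sub>R v"
    using B(2) Q(1) by (metis blinfun_apply_blinfun_compose)
  have "B y + sqrt r *\<^sub>R y = 0"
    using Q(2) by (simp add: y_def blinfun.diff_right blinfun.scaleR_right BB scaleR_diff_right)
  then have "(B y + sqrt r *\<^sub>R y) \<bullet> y = 0"
    by simp
  then have "B y \<bullet> y + sqrt r * (y \<bullet> y) = 0"
    by (simp only: inner_add_left inner_scaleR_left)
  moreover have "0 \<le> B y \<bullet> y"
    using B(1) by (simp add: positive_op_def)
  moreover have "0 \<le> sqrt r * (y \<bullet> y)"
    using Q(2) by simp
  ultimately have "sqrt r * (y \<bullet> y) = 0"
    by linarith
  then show ?thesis
    using Q(2) by (simp add: y_def)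
qed

text \<open>Nothing is known of \<open>e k\<close> outside \<open>K\<close>, so the coefficients
  vanish there. This lets sums run over intervals of natural numbers for finite and infinite
  \<open>K\<close> alike.\<close>

lemma norm_orthogonal_sum:
  fixes e :: "nat \<Rightarrow> 'a::real_inner"
  assumes e: "\<And>j k. j \<in> K \<Longrightarrow> k \<in> K \<Longrightarrow> e j \<bullet> e k = (if j = k then 1 else 0)"
    and a: "\<And>k. k \<notin> K \<Longrightarrow> a k = 0" and "finite F"
  shows "(norm (\<Sum>k\<in>F. a k *\<^sub>R e k))\<^sup>2 = (\<Sum>k\<in>F. (a k)\<^sup>2)"
proof -
  have *: "a k * (a j * (e k \<bullet> e j)) = (if j = k then (a k)\<^sup>2 else 0)" for j k
    using e[of k j] a[of k] a[of j] by (cases "k \<in> K"; cases "j \<in> K") (auto simp: power2_eq_square)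
  have "(norm (\<Sum>k\<in>F. a k *\<^sub>R e k))\<^sup>2 = (\<Sum>k\<in>F. \<Sum>j\<in>F. a k * (a j * (e k \<bullet> e j)))"
    unfolding power2_norm_eq_inner inner_sum_left by (subst inner_sum_right)
        (simp add: mult.left_commute)
  also have "\<dots> = (\<Sum>k\<in>F. (a k)\<^sup>2)"
    unfolding * using \<open>finite F\<close> by simp
  finally show ?thesis .
qed

text \<open>The root is diagonal in the given basis. Orthogonality bounds squared differences of
  partial sums by \<open>(norm x)\<^sup>2\<close> times a section of the trace, so they form a
  Cauchy sequence at every \<open>x\<close>.\<close>

lemma positive_root_exists:
  fixes Q :: "'a::{real_inner, complete_space} \<Rightarrow>\<^sub>L 'a"
  assumes basis: "orthonormal_basis K e"
    and Q: "\<And>k. k \<in> K \<Longrightarrow> Q (e k) = q k *\<^sub>R e k" "\<And>k. k \<in> K \<Longrightarrow> 0 < q k" "q summable_on K"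
  obtains R where "positive_op R" "R o\<^sub>L R = Q"
proof -
  \<comment> \<open>Extension by 0 turns summability on \<open>K\<close> into that of an ordinary
    series and silences the vectors \<open>e k\<close> outside the basis.\<close>
  define p where "p k = (if k \<in> K then q k else 0)" for k
  have p_nonneg: "0 \<le> p k" for k
    using Q(2)[of k] by (auto simp: p_def intro: less_imp_le)
  have "p summable_on UNIV"
    using Q(3) by (rule summable_on_cong_neutral[THEN iffD1, rotated -1]) (auto simp: p_def)
  then have p_sum: "summable p"
    by (rule summable_on_imp_summable)
  have e: "\<And>j k. j \<in> K \<Longrightarrow> k \<in> K \<Longrightarrow> e j \<bullet> e k = (if j = k then 1 else 0)"
    and dense: "closure (span (e ` K)) = UNIV"
    using basis by (auto simp: orthonormal_basis_def)
  define T where "T n x = (\<Sum>k<n. (sqrt (p k) * (x \<bullet> e k)) *\<^sub>R e k)" for n and x :: 'a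
  have sq_le: "(sqrt (p k) * (x \<bullet> e k))\<^sup>2 \<le> p k * (norm x)\<^sup>2" for k x
  proof (cases "k \<in> K")
    case True
    then have "norm (e k) = 1"
      using e[of k k] by (simp add: norm_eq_sqrt_inner)
    then have "\<bar>x \<bullet> e k\<bar> \<le> norm x"
      using Cauchy_Schwarz_ineq2[of x "e k"] by simp
    then have "(x \<bullet> e k)\<^sup>2 \<le> (norm x)\<^sup>2"
      using power_mono[OF _ abs_ge_zero, of "x \<bullet> e k" "norm x" 2] by simp
    then show ?thesis
      using p_nonneg[of k] by (simp add: power_mult_distrib mult_left_mono)
  qed (simp add: p_def)
  have T_diff: "(norm (T n x - T m x))\<^sup>2 \<le> (norm x)\<^sup>2 * (\<Sum>k\<in>{m..<n}. p k)" if "m \<le> n" for m n x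
  proof -
    have "T n x - T m x = (\<Sum>k\<in>{m..<n}. (sqrt (p k) * (x \<bullet> e k)) *\<^sub>R e k)"
      using that unfolding T_def by (simp add: lessThan_atLeast0 sum_diff_nat_ivl)
    then have "(norm (T n x - T m x))\<^sup>2 = (\<Sum>k\<in>{m..<n}. (sqrt (p k) * (x \<bullet> e k))\<^sup>2)"
      using norm_orthogonal_sum[of K e "\<lambda>k. sqrt (p k) * (x \<bullet> e k)" "{m..<n}"] e by
          (simp add: p_def)
    also have "\<dots> \<le> (\<Sum>k\<in>{m..<n}. p k * (norm x)\<^sup>2)"
      by (intro sum_mono sq_le)
    finally show ?thesis
      by (subst mult.commute, subst sum_distrib_right)
  qed
  have "convergent (\<lambda>n. T n x)" for x
  proof (rule Cauchy_convergent, rule metric_CauchyI)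
    fix r :: real assume "0 < r"
    \<comment> \<open>The summand 1 covers \<open>x = 0\<close> and makes the final inequality
      strict.\<close>
    define \<delta> where "\<delta> = r\<^sup>2 / ((norm x)\<^sup>2 + 1)"
    have den: "0 < (norm x)\<^sup>2 + 1"
      by (simp add: add_nonneg_pos)
    then have "0 < \<delta>"
      using \<open>0 < r\<close> by (simp add: \<delta>_def)
    then obtain N where N: "\<And>m n. m \<ge> N \<Longrightarrow> norm (sum p {m..<n}) < \<delta>"
      using p_sum unfolding summable_Cauchy by blast
    have le: "dist (T m x) (T n x) < r" if "N \<le> m" "m \<le> n" for m n
    proof -
      have "sum p {m..<n} \<le> \<delta>"
        using N[OF that(1), of n] by (simp add: abs_less_iff)
      then have "(norm (T n x - T m x))\<^sup>2 \<le> (norm x)\<^sup>2 * \<delta>"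
        by (intro order_trans[OF T_diff[OF that(2)]] mult_left_mono) simp_all
      also have "\<dots> < ((norm x)\<^sup>2 + 1) * \<delta>"
        using \<open>0 < \<delta>\<close> by simp
      also have "\<dots> = r\<^sup>2"
        using den by (simp add: \<delta>_def)
      finally have "norm (T n x - T m x) < r"
        by (rule power2_less_imp_less) (use \<open>0 < r\<close> in simp)
      then show ?thesis
        by (simp add: dist_norm norm_minus_commute)
    qed
    have "dist (T m x) (T n x) < r" if "N \<le> m" "N \<le> n" for m n
      using le[of m n] le[of n m] that by (cases "m \<le> n") (auto simp: dist_commute)
    then show "\<exists>N. \<forall>m\<ge>N. \<forall>n\<ge>N. dist (T m x) (T n x) < r"
      by blast
  qed
  then obtain S where S: "\<And>x. (\<lambda>n. T n x) \<longlonglongrightarrow> S x"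
    unfolding convergent_def by metis
  have "bounded_linear S"
  proof (rule bounded_linear_intro[where K = "sqrt (suminf p)"])
    fix x y :: 'a and r :: real
    have "(\<lambda>n. T n (x + y)) \<longlonglongrightarrow> S x + S y"
      using tendsto_add[OF S[of x] S[of y]]
      by (simp add: T_def inner_add_left algebra_simps flip: sum.distrib)
    then show "S (x + y) = S x + S y"
      using S LIMSEQ_unique by blast
    have "(\<lambda>n. T n (r *\<^sub>R x)) \<longlonglongrightarrow> r *\<^sub>R S x"
      using tendsto_scaleR[OF tendsto_const S[of x], of r]
      by (simp add: T_def scaleR_sum_right mult_ac)
    then show "S (r *\<^sub>R x) = r *\<^sub>R S x"
      using S LIMSEQ_unique by blast
    have "norm (T n x) \<le> norm x * sqrt (suminf p)" for n
    proof -
      have "(norm (T n x))\<^sup>2 \<le> (norm x)\<^sup>2 * (\<Sum>k\<in>{0..<n}. p k)"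
        using T_diff[of 0 n x] by (simp add: T_def)
      also have "\<dots> \<le> (norm x)\<^sup>2 * suminf p"
        using p_sum p_nonneg by (intro mult_left_mono sum_le_suminf) auto
      finally show ?thesis
        using real_sqrt_le_mono by (fastforce simp: real_sqrt_mult)
    qed
    then show "norm (S x) \<le> norm x * sqrt (suminf p)"
      by (intro Lim_bounded[OF tendsto_norm[OF S]]) auto
  qed
  then have R: "blinfun_apply (Blinfun S) = S"
    by (rule bounded_linear_Blinfun_apply)
  have S_e: "S (e k) = sqrt (q k) *\<^sub>R e k" if k: "k \<in> K" for k
  proof -
    have "T n (e k) = sqrt (q k) *\<^sub>R e k" if "k < n" for n
    proof -
      have "(sqrt (p j) * (e k \<bullet> e j)) *\<^sub>R e j = (if j = k then sqrt (q k) *\<^sub>R e k else 0)" for j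
        using e[of k j] k by (cases "j \<in> K") (auto simp: p_def)
      then show ?thesis
        using that by (simp add: T_def)
    qed
    then have "(\<lambda>n. T n (e k)) \<longlonglongrightarrow> sqrt (q k) *\<^sub>R e k"
      by (intro tendsto_eventually eventually_sequentiallyI[of "Suc k"]) auto
    then show ?thesis
      using S LIMSEQ_unique by blast
  qed
  have "positive_op (Blinfun S)"
    unfolding positive_op_def self_adjoint_def R
  proof (intro conjI allI)
    fix x y
    have T_sym: "T n x \<bullet> y = x \<bullet> T n y" for n
      by (simp add: T_def inner_sum_left inner_sum_right inner_commute mult_ac)
    have "(\<lambda>n. T n x \<bullet> y) \<longlonglongrightarrow> S x \<bullet> y" "(\<lambda>n. x \<bullet> T n y) \<longlonglongrightarrow> x \<bullet> S y"
      by (intro tendsto_intros S)+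
    then show "S x \<bullet> y = x \<bullet> S y"
      unfolding T_sym by (rule LIMSEQ_unique)
    have "T n x \<bullet> x = (\<Sum>k<n. sqrt (p k) * (x \<bullet> e k)\<^sup>2)" for n
      by (simp add: T_def inner_sum_left inner_commute[of "e _"] power2_eq_square mult.assoc)
    then have "0 \<le> T n x \<bullet> x" for n
      by (simp add: sum_nonneg p_nonneg)
    then show "0 \<le> S x \<bullet> x"
      by (intro LIMSEQ_le_const[OF tendsto_inner[OF S tendsto_const]]) auto
  qed
  moreover have "Blinfun S o\<^sub>L Blinfun S = Q"
  proof (rule blinfun_eqI_dense[OF dense])
    fix x assume "x \<in> e ` K"
    then obtain k where k: "k \<in> K" "x = e k"
      by blast
    have "S (S (e k)) = (sqrt (q k) * sqrt (q k)) *\<^sub>R e k"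
      using S_e[OF k(1)] blinfun.scaleR_right[of "Blinfun S" "sqrt (q k)" "e k"] by (simp add: R)
    then show "(Blinfun S o\<^sub>L Blinfun S) x = Q x"
      using Q(1,2)[OF k(1)] by (simp add: k R)
  qed
  ultimately show ?thesis
    by (rule that)
qed

text \<open>Two positive roots agree on the eigenvectors, whose span is dense. Hence the definite
  description in \<open>op_sqrt\<close> denotes the diagonal root.\<close>

lemma op_sqrt_diagonal:
  fixes Q :: "'a::{real_inner, complete_space} \<Rightarrow>\<^sub>L 'a"
  assumes basis: "orthonormal_basis K e"
    and Q: "\<And>k. k \<in> K \<Longrightarrow> Q (e k) = q k *\<^sub>R e k" "\<And>k. k \<in> K \<Longrightarrow> 0 < q k" "q summable_on K"
  shows "positive_op (op_sqrt Q)" "op_sqrt Q o\<^sub>L op_sqrt Q = Q"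
proof -
  obtain R where R: "positive_op R" "R o\<^sub>L R = Q"
    using positive_root_exists[OF assms] by blast
  have uniq: "B = R" if "positive_op B \<and> B o\<^sub>L B = Q" for B
  proof (rule blinfun_eqI_dense)
    show "closure (span (e ` K)) = UNIV"
      using basis by (simp add: orthonormal_basis_def)
    fix x assume "x \<in> e ` K"
    then obtain k where k: "k \<in> K" "x = e k"
      by blast
    have "B (e k) = sqrt (q k) *\<^sub>R e k"
      using that Q(1,2)[OF k(1)] by (intro positive_root_eigenvector[of B Q]) simp_all
    moreover have "R (e k) = sqrt (q k) *\<^sub>R e k"
      using R Q(1,2)[OF k(1)] by (intro positive_root_eigenvector[of R Q]) simp_all
    ultimately show "B x = R x"
      by (simp add: k)
  qed
  have "op_sqrt Q = R"
    unfolding op_sqrt_def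
  proof (rule the_equality)
    show "positive_op R \<and> R o\<^sub>L R = Q"
      using R ..
  qed (rule uniq)
  then show "positive_op (op_sqrt Q)" "op_sqrt Q o\<^sub>L op_sqrt Q = Q"
    by (simp_all only: R)
qed

lemma inner_op_sqrt_diagonal:
  fixes Q :: "'a::{real_inner, complete_space} \<Rightarrow>\<^sub>L 'a"
  assumes "orthonormal_basis K e"
    and "\<And>k. k \<in> K \<Longrightarrow> Q (e k) = q k *\<^sub>R e k" "\<And>k. k \<in> K \<Longrightarrow> 0 < q k" "q summable_on K"
  shows "op_sqrt Q \<xi> \<bullet> op_sqrt Q \<eta> = Q \<xi> \<bullet> \<eta>"
proof -
  have "op_sqrt Q (op_sqrt Q \<xi>) = Q \<xi>"
    using op_sqrt_diagonal(2)[OF assms] by (metis blinfun_apply_blinfun_compose)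
  then show ?thesis
    using op_sqrt_diagonal(1)[OF assms] by (metis positive_op_def self_adjoint_def)
qed

section \<open>The Dirichlet form\<close>

lemma sigmoid_bounds: "0 < sigmoid t" "sigmoid t < 1"
  by (simp_all add: sigmoid_def add_pos_pos)

lemma sigmoid_mono: "s \<le> t \<Longrightarrow> sigmoid s \<le> sigmoid t"
  by (simp add: sigmoid_def divide_simps add_pos_pos algebra_simps)

text \<open>The gap is at most \<open>ln 2\<close>; the rounder bound 1 suffices, because
  \<open>smooth_clamp\<close> divides it by \<open>a\<close>.\<close>

lemma softplus_approx: "max t 0 \<le> softplus t" "softplus t \<le> max t 0 + 1"
proof -
  have "max t 0 = ln (exp (max t 0))"
    by simp
  also have "\<dots> \<le> ln (1 + exp t)"
    by (subst ln_le_cancel_iff) (auto simp: add_pos_pos max_def)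
  finally show "max t 0 \<le> softplus t"
    by (simp add: softplus_def)
  have e2: "2 \<le> exp (1::real)"
    using exp_ge_add_one_self[of 1] by simp
  have "1 + exp t \<le> 2 * exp (max t 0)"
    by (auto simp: max_def)
  also have "\<dots> \<le> exp 1 * exp (max t 0)"
    using e2 by (intro mult_right_mono) auto
  also have "\<dots> = exp (max t 0 + 1)"
    by (simp add: exp_add)
  finally have "ln (1 + exp t) \<le> ln (exp (max t 0 + 1))"
    by (subst ln_le_cancel_iff) (auto simp: add_pos_pos)
  then show "softplus t \<le> max t 0 + 1"
    by (simp add: softplus_def)
qed

text \<open>The unit contraction is \<open>max t 0 - max (t - 1) 0\<close>. Each positive part is
  replaced by \<open>softplus\<close> at scale \<open>a\<close>, so the derivative is a difference
  of two values of \<open>sigmoid\<close> and lies between 0 and 1 for positive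
  \<open>a\<close>.\<close>

definition smooth_clamp :: "real \<Rightarrow> real \<Rightarrow> real" where
  "smooth_clamp a t = (softplus (a * t) - softplus (a * t - a)) / a"

lemma DERIV_smooth_clamp:
  assumes "a > 0"
  shows "(smooth_clamp a has_real_derivative sigmoid (a * t) - sigmoid (a * t - a)) (at t)"
proof -
  have "((\<lambda>t. softplus (a * t)) has_real_derivative sigmoid (a * t) * a) (at t)"
    by (rule DERIV_chain2[OF DERIV_softplus]) (auto intro!: derivative_eq_intros)
  moreover have "((\<lambda>t. softplus (a * t - a)) has_real_derivative sigmoid (a * t - a) * a) (at t)"
    by (rule DERIV_chain2[OF DERIV_softplus]) (auto intro!: derivative_eq_intros)
  ultimately have "((\<lambda>t. (softplus (a * t) - softplus (a * t - a)) / a) has_real_derivative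
      (sigmoid (a * t) * a - sigmoid (a * t - a) * a) / a) (at t)"
    by (intro DERIV_cdivide DERIV_diff)
  then show ?thesis
    using assms by (simp add: smooth_clamp_def[abs_def] diff_divide_distrib)
qed

lemma smooth_clamp_deriv_bounds:
  assumes "a > 0"
  shows "0 \<le> sigmoid (a * t) - sigmoid (a * t - a)" "sigmoid (a * t) - sigmoid (a * t - a) \<le> 1"
  using sigmoid_mono[of "a * t - a" "a * t"] sigmoid_bounds[of "a * t"]
      sigmoid_bounds[of "a * t - a"] assms
  by linarith+

text \<open>Both \<open>softplus\<close> errors lie between 0 and 1, so their difference is at most
  1 in absolute value; the bound is \<open>1 / a\<close> and not twice that.\<close>

lemma smooth_clamp_close:
  assumes "a > 0"
  shows "\<bar>smooth_clamp a t - min (max t 0) 1\<bar> \<le> 1 / a"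
proof -
  have "a * min (max t 0) 1 = max (a * t) 0 - max (a * t - a) 0"
    using assms by (auto simp: max_def min_def algebra_simps mult_le_0_iff zero_le_mult_iff)
  moreover have "a * smooth_clamp a t = softplus (a * t) - softplus (a * t - a)"
    using assms by (simp add: smooth_clamp_def)
  ultimately have "\<bar>a * smooth_clamp a t - a * min (max t 0) 1\<bar> \<le> 1"
    using softplus_approx[of "a * t"] softplus_approx[of "a * t - a"] by linarith
  then have "a * \<bar>smooth_clamp a t - min (max t 0) 1\<bar> \<le> 1"
    using assms by (simp add: abs_mult flip: right_diff_distrib)
  then show ?thesis
    using assms by (simp add: field_simps)
qed

lemma FCb_infinity_smooth_clamp:
  assumes "u \<in> FCb_infinity"
  shows "(\<lambda>x. smooth_clamp a (u x)) \<in> FCb_infinity"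
proof -
  have "(\<lambda>x. (1 / a) * softplus (a * u x + 0) + (- 1 / a) * softplus (a * u x + - a)) \<in>
      FCb_infinity"
    by (intro FCb_infinity_lincomb FCb_infinity_softplus assms)
  then show ?thesis
    by (simp add: smooth_clamp_def diff_divide_distrib)
qed

section \<open>Density of the cylindrical functions in \<open>L2\<close>\<close>

context gaussian
begin

lemma L2_approximable_limit:
  assumes w: "w \<in> L2_space \<mu>" and W: "\<And>n. W n \<in> L2_space \<mu>" "L2_converges \<mu> W w"
    and "\<And>n \<epsilon>. 0 < \<epsilon> \<Longrightarrow> \<exists>v\<in>FCb_infinity. L2_dist \<mu> v (W n) < \<epsilon>" and "0 < \<epsilon>"
  shows "\<exists>v\<in>FCb_infinity. L2_dist \<mu> v w < \<epsilon>"
proof -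
  have "0 < \<epsilon> / 4"
    using \<open>0 < \<epsilon>\<close> by simp
  from order_tendstoD(2)[OF W(2)[unfolded L2_converges_def] this]
  obtain n where n: "L2_dist \<mu> (W n) w < \<epsilon> / 4"
    unfolding eventually_sequentially by blast
  obtain v where v: "v \<in> FCb_infinity" "L2_dist \<mu> v (W n) < \<epsilon> / 4"
    using assms(4)[OF \<open>0 < \<epsilon> / 4\<close>] by blast
  have "L2_dist \<mu> v w < \<epsilon>"
    using L2.triangle_le[OF subsetD[OF FCb_infinity_L2 v(1)] W(1)[of n] w] v(2) n
    unfolding L2_form_diff by linarith
  then show ?thesis
    using v(1) by blast
qed

text \<open>Rule induction over \<open>trig_closure\<close>: sines and cosines are cylindrical, and
  approximability survives linear combinations and, by dominated convergence, bounded pointwise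
  limits.\<close>

lemma bounded_approximable:
  assumes "w \<in> borel_measurable borel" "\<And>x. \<bar>w x\<bar> \<le> B" and "0 < \<epsilon>"
  shows "\<exists>v\<in>FCb_infinity. L2_dist \<mu> v w < \<epsilon>"
proof -
  have self: "\<forall>\<epsilon>>0. \<exists>v\<in>FCb_infinity. L2_dist \<mu> v w < \<epsilon>" if "w \<in> FCb_infinity" for w
    using that by (auto intro!: bexI[of _ w])
  have closure_L2: "w \<in> L2_space \<mu>" if "w \<in> trig_closure" "w \<in> borel_measurable borel" for w
    by (rule trig_closure_bounded[OF that(1)], rule bounded_L2[OF that(2)])
  have "w \<in> trig_closure"
    using bounded_borel_trig_closure[OF assms(1,2)] .
  \<comment> \<open>Measurability is carried along because the lincomb and limit steps need
    square-integrability of the functions involved.\<close>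
  then have "w \<in> borel_measurable borel \<and> (\<forall>\<epsilon>>0. \<exists>v\<in>FCb_infinity. L2_dist \<mu> v w < \<epsilon>)"
  proof induction
    case (cos h)
    show ?case
      by (intro conjI self FCb_infinity_cos) measurable
  next
    case (sin h)
    show ?case
      by (intro conjI self FCb_infinity_sin) measurable
  next
    case (lincomb v w a b)
    have L2: "v \<in> L2_space \<mu>" "w \<in> L2_space \<mu>"
      using lincomb by (auto intro: closure_L2)
    have "\<exists>g\<in>FCb_infinity. (LINT x|\<mu>. (g x - (a * v x + b * w x))\<^sup>2) < \<epsilon>" if "0 < \<epsilon>" for \<epsilon>
    proof -
      define S where "S = 2 * a\<^sup>2 + 2 * b\<^sup>2 + 1"
      have "0 < S"
        by (simp add: S_def add_nonneg_pos)
      define r where "r = \<epsilon> / S"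
      have "0 < r"
        using that \<open>0 < S\<close> by (simp add: r_def)
      then obtain v' w' where v': "v' \<in> FCb_infinity" "L2_dist \<mu> v' v < r"
        and w': "w' \<in> FCb_infinity" "L2_dist \<mu> w' w < r"
        using lincomb.IH by blast
      have eq: "(a * v' x + b * w' x) - (a * v x + b * w x) = a * (v' x - v x) + b * (w' x - w x)"
          for x
        by (simp add: algebra_simps)
      have "(LINT x|\<mu>. ((a * v' x + b * w' x) - (a * v x + b * w x))\<^sup>2) \<le>
          2 * a\<^sup>2 * L2_dist \<mu> v' v + 2 * b\<^sup>2 * L2_dist \<mu> w' w"
        unfolding L2_form_diff unfolding eq
        using v'(1) w'(1) L2 FCb_infinity_L2 by (intro L2.lincomb_le L2.diff_in) blast+
      also have "\<dots> \<le> 2 * a\<^sup>2 * r + 2 * b\<^sup>2 * r"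
        using v'(2) w'(2) by (intro add_mono mult_left_mono) auto
      also have "\<dots> < S * r"
        using \<open>0 < r\<close> by (simp add: S_def distrib_right)
      also have "\<dots> = \<epsilon>"
        using \<open>0 < S\<close> by (simp add: r_def)
      finally show ?thesis
        by (intro bexI[OF _ FCb_infinity_lincomb[OF v'(1) w'(1)]])
    qed
    then show ?case
      using lincomb.IH by auto
  next
    case (lim W B w)
    then have meas: "\<And>n. W n \<in> borel_measurable borel"
      by auto
    have w: "w \<in> borel_measurable borel"
      by (rule borel_measurable_LIMSEQ_real, rule lim.hyps(3), rule meas)
    have wB: "\<bar>w x\<bar> \<le> B" for x
      using lim.hyps(2) by (intro LIMSEQ_le_const2[OF tendsto_rabs[OF lim.hyps(3)]]) auto
    have "(\<lambda>n. L2_dist \<mu> (W n) w) \<longlonglongrightarrow> (LINT x|\<mu>. 0)"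
    proof (rule integral_dominated_convergence[where w = "\<lambda>_. (B + B)\<^sup>2"])
      show "AE x in \<mu>. (\<lambda>n. (W n x - w x)\<^sup>2) \<longlonglongrightarrow> 0"
      proof (rule AE_I2)
        fix x
        have "(\<lambda>n. (W n x - w x)\<^sup>2) \<longlonglongrightarrow> (w x - w x)\<^sup>2"
          by (intro tendsto_intros lim.hyps(3))
        then show "(\<lambda>n. (W n x - w x)\<^sup>2) \<longlonglongrightarrow> 0"
          by simp
      qed
      have "\<bar>W n x - w x\<bar>\<^sup>2 \<le> (B + B)\<^sup>2" for n x
        using lim.hyps(2)[of n x] wB[of x] by (intro power_mono) auto
      then show "AE x in \<mu>. norm ((W n x - w x)\<^sup>2) \<le> (B + B)\<^sup>2" for n
        by (intro AE_I2) simp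
    qed (use meas w in measurable)
    then have conv: "L2_converges \<mu> W w"
      by (simp add: L2_converges_def)
    show ?case
    proof (intro conjI w allI impI)
      fix \<epsilon> :: real assume "0 < \<epsilon>"
      then show "\<exists>v\<in>FCb_infinity. L2_dist \<mu> v w < \<epsilon>"
        by (rule L2_approximable_limit[OF bounded_L2[OF w wB] bounded_L2[OF meas lim.hyps(2)] conv,
            rotated])
          (use lim.IH in simp)
    qed
  qed
  then show ?thesis
    using \<open>0 < \<epsilon>\<close> by blast
qed

lemma FCb_infinity_dense:
  assumes u: "u \<in> L2_space \<mu>" and "0 < \<epsilon>"
  shows "\<exists>v\<in>FCb_infinity. L2_dist \<mu> v u < \<epsilon>"
proof -
  define W where "W n x = min (max (u x) (- real n)) (real n)" for n x
  have um: "u \<in> borel_measurable \<mu>" "integrable \<mu> (\<lambda>x. (u x)\<^sup>2)"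
    using u by (auto simp: L2_space_def)
  have "u \<in> borel_measurable borel"
    using um(1) measurable_cong_sets[OF sets_eq refl] by blast
  then have Wm: "W n \<in> borel_measurable borel" for n
    unfolding W_def by measurable
  have WB: "\<bar>W n x\<bar> \<le> real n" for n x
    by (auto simp: W_def)
  have "(\<lambda>n. L2_dist \<mu> (W n) u) \<longlonglongrightarrow> (LINT x|\<mu>. 0)"
  proof (rule integral_dominated_convergence[where w = "\<lambda>x. (u x)\<^sup>2"])
    show "AE x in \<mu>. (\<lambda>n. (W n x - u x)\<^sup>2) \<longlonglongrightarrow> 0"
    proof (rule AE_I2, rule tendsto_eventually)
      fix x
      obtain N where "\<bar>u x\<bar> \<le> real N"
        using real_arch_simple by blast
      then have "W n x = u x" if "n \<ge> N" for n
        using that by (auto simp: W_def)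
      then show "\<forall>\<^sub>F n in sequentially. (W n x - u x)\<^sup>2 = 0"
        by (intro eventually_sequentiallyI[of N]) simp
    qed
    have "\<bar>W n x - u x\<bar>\<^sup>2 \<le> \<bar>u x\<bar>\<^sup>2" for n x
      by (intro power_mono) (auto simp: W_def min_def max_def)
    then show "AE x in \<mu>. norm ((W n x - u x)\<^sup>2) \<le> (u x)\<^sup>2" for n
      by (intro AE_I2) simp
  qed (use um Wm in measurable)
  then have "L2_converges \<mu> W u"
    by (simp add: L2_converges_def)
  from L2_approximable_limit[OF u bounded_L2[OF Wm WB] this bounded_approximable[OF Wm WB] \<open>0 < \<epsilon>\<close>]
  show ?thesis .
qed

lemma FCb_infinity_L2_sequence:
  assumes "u \<in> L2_space \<mu>"
  obtains U where "\<And>n. U n \<in> FCb_infinity" "L2_converges \<mu> U u"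
proof -
  have "\<exists>v. v \<in> FCb_infinity \<and> L2_dist \<mu> v u < inverse (real (Suc n))" for n
    using FCb_infinity_dense[OF assms, of "inverse (real (Suc n))"] by auto
  from choice[OF allI, OF this] obtain U
    where U: "\<forall>n. U n \<in> FCb_infinity \<and> L2_dist \<mu> (U n) u < inverse (real (Suc n))" ..
  have "L2_converges \<mu> U u"
    unfolding L2_converges_def
    by (rule Lim_null_comparison[OF _ LIMSEQ_inverse_real_of_nat])
      (use U in \<open>auto intro!: always_eventually less_imp_le\<close>)
  then show ?thesis
    using that U by blast
qed

end

section \<open>Closability and the Markov property of the gradient form\<close>

context gaussian
begin

definition Q_form :: "'a form" where
  "Q_form u v = (LINT x|\<mu>. Q (grad u x) \<bullet> grad v x)"

text \<open>The representation makes \<open>Q_form\<close> with fixed second argument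
  \<open>v\<close> the restriction of an \<open>L2\<close>-continuous functional, which sends
  \<open>L2\<close>-null sequences to 0.\<close>

lemma Q_form_null_right:
  assumes U: "\<And>n. U n \<in> FCb_infinity" "L2_converges \<mu> U (\<lambda>x. 0)" and v: "v \<in> FCb_infinity"
  shows "(\<lambda>n. Q_form (U n) v) \<longlonglongrightarrow> 0"
proof -
  obtain l where lL2: "l \<in> L2_space \<mu>"
    and eq: "\<And>u. u \<in> FCb_infinity \<Longrightarrow> Q_form u v = L2_form \<mu> u l"
    using Q_form_representation[OF v] unfolding Q_form_def L2_form_def by blast
  have "(\<lambda>n. L2_form \<mu> (U n) l) \<longlonglongrightarrow> 0"
  proof (rule L2.tendsto_zero_left[where V = "\<lambda>n. l" and C = "L2_form \<mu> l l"])
    show "(\<lambda>n. L2_form \<mu> (U n) (U n)) \<longlonglongrightarrow> 0"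
      using U(2) by (simp add: L2_converges_form)
  qed (use U(1) FCb_infinity_L2 lL2 in auto)
  then show ?thesis
    by (simp add: eq U(1))
qed

end

text \<open>\<open>root_Q\<close> identifies the constant-coefficient form with
  \<open>Q_form\<close>, continuity makes the density measurable, and the two bounds compare the
  densities at each point.\<close>

locale gradient_form = gaussian \<mu> Q
  for \<mu> :: "'a::{real_inner, polish_space} measure" and Q :: "'a \<Rightarrow>\<^sub>L 'a" +
  fixes D :: "'a \<Rightarrow> 'a \<Rightarrow>\<^sub>L 'a" and c C :: real
  assumes root_Q: "op_sqrt Q \<xi> \<bullet> op_sqrt Q \<eta> = Q \<xi> \<bullet> \<eta>"
    and root_D_continuous: "continuous_on UNIV (\<lambda>x. op_sqrt (D x))"
    and c_pos: "0 < c"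
    and lower: "c * (norm (op_sqrt Q \<xi>))\<^sup>2 \<le> (norm (op_sqrt Q (op_sqrt (D x) \<xi>)))\<^sup>2"
    and upper: "(norm (op_sqrt Q (op_sqrt (D x) \<xi>)))\<^sup>2 \<le> C * (norm (op_sqrt Q \<xi>))\<^sup>2"
begin

abbreviation "EA \<equiv> form_A \<mu> Q D"
abbreviation "Q_grad u x \<equiv> op_sqrt Q (grad u x)"
abbreviation "A_grad u x \<equiv> op_sqrt Q (op_sqrt (D x) (grad u x))"

lemma continuous_bounded_inner_integrable:
  fixes f g :: "'a \<Rightarrow> 'a"
  assumes "continuous_on UNIV f" "continuous_on UNIV g" "\<And>x. norm (f x) \<le> A" "\<And>x. norm (g x) \<le> B"
  shows "integrable \<mu> (\<lambda>x. f x \<bullet> g x)"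
proof (rule bounded_integrable)
  show "(\<lambda>x. f x \<bullet> g x) \<in> borel_measurable \<mu>"
    by (intro measurable_continuous continuous_intros assms)
  show "\<bar>f x \<bullet> g x\<bar> \<le> A * B" for x
    using order_trans[OF norm_ge_zero assms(3)]
    by (intro order_trans[OF Cauchy_Schwarz_ineq2] mult_mono assms) auto
qed

lemma root_Q_grad:
  assumes u: "u \<in> FCb_infinity"
  shows "continuous_on UNIV (\<lambda>x. Q_grad u x)"
    and "\<exists>B. \<forall>x. norm (Q_grad u x) \<le> B"
proof -
  show "continuous_on UNIV (\<lambda>x. Q_grad u x)"
    by (intro continuous_intros FCb_infinity_grad_continuous u)
  obtain B where "\<And>x. norm (grad u x) \<le> B"
    using FCb_infinity_grad_bounded[OF u] by blast
  then have "norm (Q_grad u x) \<le> norm (op_sqrt Q) * B" for x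
    by (intro order_trans[OF norm_blinfun] mult_left_mono) auto
  then show "\<exists>B. \<forall>x. norm (Q_grad u x) \<le> B"
    by blast
qed

lemma root_QD_grad:
  assumes u: "u \<in> FCb_infinity"
  shows "continuous_on UNIV (\<lambda>x. A_grad u x)"
    and "\<exists>B. \<forall>x. norm (A_grad u x) \<le> B"
proof -
  show "continuous_on UNIV (\<lambda>x. A_grad u x)"
    by (intro continuous_intros root_D_continuous FCb_infinity_grad_continuous u)
  obtain B where B: "\<And>x. norm (Q_grad u x) \<le> B"
    using root_Q_grad(2)[OF u] by blast
  \<comment> \<open>\<open>upper\<close> bounds the density through \<open>Q\<close> alone; the
    absolute value of \<open>C\<close> keeps the product monotone in the norm.\<close>
  have "norm (A_grad u x) \<le> sqrt (\<bar>C\<bar> * B\<^sup>2)" for x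
  proof (rule real_le_rsqrt)
    have "C * (norm (Q_grad u x))\<^sup>2 \<le> \<bar>C\<bar> * B\<^sup>2"
      using B[of x] by (intro mult_mono power_mono) auto
    then show "(norm (A_grad u x))\<^sup>2 \<le> \<bar>C\<bar> * B\<^sup>2"
      by (rule order_trans[OF upper])
  qed
  then show "\<exists>B. \<forall>x. norm (A_grad u x) \<le> B"
    by blast
qed

lemma form_A_integrable:
  assumes "u \<in> FCb_infinity" "v \<in> FCb_infinity"
  shows "integrable \<mu> (form_A_density Q D u v)"
  using root_QD_grad(2)[OF assms(1)] root_QD_grad(2)[OF assms(2)]
    continuous_bounded_inner_integrable[OF root_QD_grad(1)[OF assms(1)]
        root_QD_grad(1)[OF assms(2)]]
  unfolding form_A_density_def[abs_def] by blast

lemma Q_form_integrable: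
  assumes "u \<in> FCb_infinity" "v \<in> FCb_infinity"
  shows "integrable \<mu> (\<lambda>x. Q (grad u x) \<bullet> grad v x)"
  using root_Q_grad(2)[OF assms(1)] root_Q_grad(2)[OF assms(2)]
    continuous_bounded_inner_integrable[OF root_Q_grad(1)[OF assms(1)] root_Q_grad(1)[OF assms(2)]]
  unfolding root_Q by blast

lemma Q_form_square: "Q (grad u x) \<bullet> grad u x = (norm (Q_grad u x))\<^sup>2"
  by (simp add: power2_norm_eq_inner root_Q)

lemma form_A_square: "form_A_density Q D u u x = (norm (A_grad u x))\<^sup>2"
  by (simp add: form_A_density_def power2_norm_eq_inner)

lemma form_A_bounds:
  assumes u: "u \<in> FCb_infinity"
  shows "c * Q_form u u \<le> EA u u" "EA u u \<le> C * Q_form u u"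
proof -
  note int = Q_form_integrable[OF u u] form_A_integrable[OF u u]
  have "c * Q_form u u = (LINT x|\<mu>. c * (Q (grad u x) \<bullet> grad u x))"
    by (simp add: Q_form_def)
  also have "\<dots> \<le> EA u u"
    unfolding form_A_def using int
    by (intro integral_mono integrable_mult_right) (auto simp: Q_form_square form_A_square lower)
  finally show "c * Q_form u u \<le> EA u u" .
  have "EA u u \<le> (LINT x|\<mu>. C * (Q (grad u x) \<bullet> grad u x))"
    unfolding form_A_def using int
    by (intro integral_mono integrable_mult_right) (auto simp: Q_form_square form_A_square upper)
  also have "\<dots> = C * Q_form u u"
    by (simp add: Q_form_def)
  finally show "EA u u \<le> C * Q_form u u" .
qed

text \<open>Serves \<open>EA\<close>, where \<open>T x\<close> is the product of the two roots, as
  well as \<open>Q_form\<close>, where it is the root of \<open>Q\<close>.\<close>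

lemma symmetric_form_FCb:
  assumes E: "\<And>u v. E u v = (LINT x|\<mu>. T x (grad u x) \<bullet> T x (grad v x))"
    and int: "\<And>u v. u \<in> FCb_infinity \<Longrightarrow> v \<in> FCb_infinity \<Longrightarrow> integrable \<mu>
        (\<lambda>x. T x (grad u x) \<bullet> T x (grad v x))"
    and T: "\<And>x. linear (T x)"
  shows "symmetric_form \<mu> FCb_infinity E"
  unfolding symmetric_form_def
proof (intro conjI allI ballI FCb_infinity_L2 FCb_infinity_const FCb_infinity_lincomb)
  fix u v w :: "'a \<Rightarrow> real" and a b assume FC: "u \<in> FCb_infinity" "v \<in> FCb_infinity"
  show "E u v = E v u"
    by (simp add: E inner_commute)
  show "0 \<le> E u u"
    by (simp add: E)
  assume w: "w \<in> FCb_infinity"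
  have "E (\<lambda>x. a * u x + b * v x) w =
      (LINT x|\<mu>. a * (T x (grad u x) \<bullet> T x (grad w x)) + b * (T x (grad v x) \<bullet> T x (grad w x)))"
    by (simp add: E grad_lincomb[OF FC] linear_add[OF T] linear_scale[OF T] inner_add_left)
  also have "\<dots> = a * E u w + b * E v w"
    using int[OF FC(1) w] int[OF FC(2) w] by (simp add: E)
  finally show "E (\<lambda>x. a * u x + b * v x) w = a * E u w + b * E v w" .
qed

lemma form_A_symmetric: "symmetric_form \<mu> FCb_infinity EA"
proof (rule symmetric_form_FCb[where T = "\<lambda>x \<xi>. op_sqrt Q (op_sqrt (D x) \<xi>)"])
  show "EA u v = (LINT x|\<mu>. A_grad u x \<bullet> A_grad v x)" for u v
    by (simp add: form_A_def form_A_density_def)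
  show "integrable \<mu> (\<lambda>x. A_grad u x \<bullet> A_grad v x)"
    if "u \<in> FCb_infinity" "v \<in> FCb_infinity" for u v
    using form_A_integrable[OF that] by (simp add: form_A_density_def[abs_def])
  show "linear (\<lambda>\<xi>. op_sqrt Q (op_sqrt (D x) \<xi>))" for x
    by (intro linearI) (simp_all add: blinfun.add_right blinfun.scaleR_right)
qed

lemma Q_form_symmetric: "symmetric_form \<mu> FCb_infinity Q_form"
proof (rule symmetric_form_FCb[where T = "\<lambda>x. op_sqrt Q"])
  show "Q_form u v = (LINT x|\<mu>. Q_grad u x \<bullet> Q_grad v x)" for u v
    by (simp add: Q_form_def root_Q)
  show "integrable \<mu> (\<lambda>x. Q_grad u x \<bullet> Q_grad v x)"
    if "u \<in> FCb_infinity" "v \<in> FCb_infinity" for u v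
    using Q_form_integrable[OF that] by (simp add: root_Q)
  show "linear (blinfun_apply (op_sqrt Q))"
    by (intro linearI) (simp_all add: blinfun.add_right blinfun.scaleR_right)
qed

text \<open>By the representation through the Ornstein--Uhlenbeck operator, \<open>Q_form (U n) (U N)\<close> tends
  to \<open>0\<close> for fixed \<open>N\<close>; so \<open>Q_form (U n) (U n)\<close> is asymptotically at most
  \<open>sq_dist Q_form (U n) (U N)\<close>.\<close>

lemma form_A_closable: "closable \<mu> FCb_infinity EA"
  unfolding closable_def
proof (intro conjI form_A_symmetric allI impI)
  interpret q: sym_form \<mu> FCb_infinity Q_form
    by unfold_locales (rule Q_form_symmetric)
  interpret a: sym_form \<mu> FCb_infinity EA
    by unfold_locales (rule form_A_symmetric)
  fix U assume *: "(\<forall>n. U n \<in> FCb_infinity) \<and> form_Cauchy EA U \<and> L2_converges \<mu> U (\<lambda>x. 0)"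
  then have U: "\<And>n. U n \<in> FCb_infinity" and conv: "L2_converges \<mu> U (\<lambda>x. 0)"
    by auto
  have "(\<lambda>n. Q_form (U n) (U n)) \<longlonglongrightarrow> 0"
  proof (rule LIMSEQ_I)
    fix \<epsilon> :: real assume "0 < \<epsilon>"
    \<comment> \<open>After division by \<open>c\<close>, the lower bound makes the distance for
      \<open>Q_form\<close> less than half of \<open>\<epsilon>\<close>.\<close>
    then have "0 < c * (\<epsilon> / 2)"
      using c_pos by simp
    then obtain N where N: "\<And>m n. m \<ge> N \<Longrightarrow> n \<ge> N \<Longrightarrow> sq_dist EA (U m) (U n) < c * (\<epsilon> / 2)"
      using * unfolding form_Cauchy_def by meson
    have "0 < \<epsilon> / 4"
      using \<open>0 < \<epsilon>\<close> by simp
    from order_tendstoD(2)[OF Q_form_null_right[OF U conv U[of N]] this]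
    obtain N' where N': "\<And>n. n \<ge> N' \<Longrightarrow> Q_form (U n) (U N) < \<epsilon> / 4"
      unfolding eventually_sequentially by blast
    have "norm (Q_form (U n) (U n) - 0) < \<epsilon>" if "n \<ge> max N N'" for n
    proof -
      have "c * sq_dist Q_form (U n) (U N) < c * (\<epsilon> / 2)"
        using form_A_bounds(1)[OF q.diff_in[OF U[of n] U[of N]]] N[of n N] that by simp
      then have "sq_dist Q_form (U n) (U N) < \<epsilon> / 2"
        using c_pos by simp
      moreover have "Q_form (U n) (U N) < \<epsilon> / 4"
        using N' that by simp
      \<comment> \<open>\<open>Q_form (U n) (U n)\<close> equals the squared distance plus twice the
        mixed term minus \<open>Q_form (U N) (U N)\<close>; the last term is dropped by its
        sign.\<close>
      ultimately show ?thesis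
        using q.quadratic_diff[OF U[of n] U[of N]] q.nonneg[OF U[of n]] q.nonneg[OF U[of N]] by simp
    qed
    then show "\<exists>n0. \<forall>n\<ge>n0. norm (Q_form (U n) (U n) - 0) < \<epsilon>"
      by blast
  qed
  \<comment> \<open>The upper comparison carries the convergence back to \<open>EA\<close>.\<close>
  then have "(\<lambda>n. C * Q_form (U n) (U n)) \<longlonglongrightarrow> 0"
    using tendsto_mult_left[of _ 0 _ C] by simp
  then show "(\<lambda>n. EA (U n) (U n)) \<longlonglongrightarrow> 0"
  proof (rule Lim_null_comparison[rotated])
    show "\<forall>\<^sub>F n in sequentially. norm (EA (U n) (U n)) \<le> C * Q_form (U n) (U n)"
      using form_A_bounds(2)[OF U] a.nonneg[OF U] by simp
  qed
qed

sublocale closable_form \<mu> FCb_infinity EA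
  by unfold_locales (rule form_A_symmetric, rule form_A_closable)

text \<open>By the chain rule the gradient is multiplied by a scalar between 0 and 1. A scalar
  passes through both operators, so the density at each point is multiplied by its square.\<close>

lemma form_A_contraction:
  assumes u: "u \<in> FCb_infinity" and a: "0 < a"
  shows "EA (\<lambda>x. smooth_clamp a (u x)) (\<lambda>x. smooth_clamp a (u x)) \<le> EA u u"
  unfolding form_A_def
proof (rule integral_mono)
  note v = FCb_infinity_smooth_clamp[OF u, of a]
  show "integrable \<mu> (form_A_density Q D (\<lambda>x. smooth_clamp a (u x)) (\<lambda>x. smooth_clamp a (u x)))"
    "integrable \<mu> (form_A_density Q D u u)"
    by (rule form_A_integrable[OF v v], rule form_A_integrable[OF u u])
  fix x
  define s where "s = sigmoid (a * u x) - sigmoid (a * u x - a)"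
  have g: "grad (\<lambda>x. smooth_clamp a (u x)) x = s *\<^sub>R grad u x"
    unfolding s_def by (rule grad_compose[OF u DERIV_smooth_clamp[OF a]])
  have "s\<^sup>2 \<le> 1"
    using smooth_clamp_deriv_bounds[OF a, of "u x"] unfolding s_def by (rule power_le_one)
  then have "s\<^sup>2 * form_A_density Q D u u x \<le> 1 * form_A_density Q D u u x"
    by (intro mult_right_mono) (simp_all add: form_A_square)
  then show "form_A_density Q D (\<lambda>x. smooth_clamp a (u x)) (\<lambda>x. smooth_clamp a (u x)) x \<le>
      form_A_density Q D u u x"
    unfolding form_A_square g by (simp add: blinfun.scaleR_right power_mult_distrib)
qed

lemma form_A_Dirichlet: "symmetric_Dirichlet_form \<mu> CD CE"
  unfolding symmetric_Dirichlet_form_def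
proof (intro conjI ballI impI closure_closed)
  fix u assume u: "u \<in> L2_space \<mu>"
  show "\<exists>U. (\<forall>n. U n \<in> CD) \<and> L2_converges \<mu> U u"
    by (rule FCb_infinity_L2_sequence[OF u]) (intro exI conjI allI Dom_subset)
next
  fix u v assume "u \<in> CD" "v \<in> borel_measurable \<mu>" "AE x in \<mu>. u x = v x"
  note AE = closure_AE[OF this]
  show "v \<in> CD" "CE v w = CE u w" for w
    by (rule AE(1), rule AE(2))
next
  fix u assume u: "u \<in> CD"
  \<comment> \<open>\<open>Suc n\<close> keeps the scale positive and gives the uniform error
    \<open>1 / (n + 1)\<close>.\<close>
  define \<phi> where "\<phi> n = smooth_clamp (real (Suc n))" for n
  have contr: "(\<lambda>x. \<phi> n (v x)) \<in> FCb_infinity \<and> EA (\<lambda>x. \<phi> n (v x)) (\<lambda>x. \<phi> n (v x)) \<le> EA v v"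
    if "v \<in> FCb_infinity" for n v
    unfolding \<phi>_def by (intro conjI FCb_infinity_smooth_clamp form_A_contraction that) simp
  have close: "\<bar>\<phi> n t - min (max t 0) 1\<bar> \<le> inverse (real (Suc n))" for n t
    unfolding \<phi>_def using smooth_clamp_close[of "real (Suc n)" t] by
        (simp only: inverse_eq_divide of_nat_0_less_iff zero_less_Suc)
  note contraction = closure_unit_contraction[of \<phi>, OF _ close LIMSEQ_inverse_real_of_nat u]
  show "(\<lambda>x. min (max (u x) 0) 1) \<in> CD"
    "CE (\<lambda>x. min (max (u x) 0) 1) (\<lambda>x. min (max (u x) 0) 1) \<le> CE u u"
    by (rule contraction(1), erule contr) (rule contraction(2), erule contr)
qed

end

theorem theorem3p4:
  fixes Q :: "'a::{real_inner, polish_space} \<Rightarrow>\<^sub>L 'a"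
    and \<mu>\<^sub>0 :: "'a measure"
    and K :: "nat set" and e :: "nat \<Rightarrow> 'a" and q :: "nat \<Rightarrow> real"
    and D :: "'a \<Rightarrow> 'a \<Rightarrow>\<^sub>L 'a"
    and d_minus d_plus c\<^sub>A C\<^sub>A :: real
  assumes "self_adjoint Q"
    and "orthonormal_basis K e"
    and "\<And>k. k \<in> K \<Longrightarrow> Q (e k) = q k *\<^sub>R e k"
    and "\<And>k. k \<in> K \<Longrightarrow> 0 < q k"
    and "q summable_on K"
    and "centered_gaussian \<mu>\<^sub>0 Q"
    and "\<And>x. positive_op (D x)"
    and "0 < d_minus" and "d_minus \<le> d_plus"
    and "\<And>x \<xi>. d_minus * (\<xi> \<bullet> \<xi>) \<le> D x \<xi> \<bullet> \<xi>"
    and "\<And>x \<xi>. D x \<xi> \<bullet> \<xi> \<le> d_plus * (\<xi> \<bullet> \<xi>)"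
    and "\<exists>L. L-lipschitz_on UNIV (\<lambda>x. op_sqrt (D x))"
    and "0 < c\<^sub>A" and "c\<^sub>A \<le> C\<^sub>A"
    and "\<And>x \<xi>. c\<^sub>A * (norm (op_sqrt Q \<xi>))\<^sup>2 \<le> (norm (op_sqrt Q (op_sqrt (D x) \<xi>)))\<^sup>2"
    and "\<And>x \<xi>. (norm (op_sqrt Q (op_sqrt (D x) \<xi>)))\<^sup>2 \<le> C\<^sub>A * (norm (op_sqrt Q \<xi>))\<^sup>2"
  shows "(\<forall>u\<in>FCb_infinity. \<forall>v\<in>FCb_infinity. integrable \<mu>\<^sub>0 (form_A_density Q D u v)) \<and>
    closable \<mu>\<^sub>0 FCb_infinity (form_A \<mu>\<^sub>0 Q D) \<and>
    symmetric_Dirichlet_form \<mu>\<^sub>0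
      (closure_domain \<mu>\<^sub>0 FCb_infinity (form_A \<mu>\<^sub>0 Q D))
      (closure_form \<mu>\<^sub>0 FCb_infinity (form_A \<mu>\<^sub>0 Q D)) \<and>
    (\<forall>u\<in>FCb_infinity.
      integrable \<mu>\<^sub>0 (\<lambda>x. (norm (op_sqrt Q (grad u x)))\<^sup>2) \<and>
      c\<^sub>A * (LINT x|\<mu>\<^sub>0. (norm (op_sqrt Q (grad u x)))\<^sup>2) \<le> form_A \<mu>\<^sub>0 Q D u u \<and>
      form_A \<mu>\<^sub>0 Q D u u \<le> C\<^sub>A * (LINT x|\<mu>\<^sub>0. (norm (op_sqrt Q (grad u x)))\<^sup>2))"
proof -
  have "gaussian \<mu>\<^sub>0 Q"
    using assms(1,6) unfolding gaussian_def gaussian_axioms_def centered_gaussian_def by blast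
  moreover have "continuous_on UNIV (\<lambda>x. op_sqrt (D x))"
    using assms(12) lipschitz_on_continuous_on by blast
  ultimately have "gradient_form \<mu>\<^sub>0 Q D c\<^sub>A C\<^sub>A"
    using assms(13,15,16) inner_op_sqrt_diagonal[OF assms(2,3,4,5)]
    unfolding gradient_form_def gradient_form_axioms_def by blast
  then interpret gradient_form \<mu>\<^sub>0 Q D c\<^sub>A C\<^sub>A .
  have Q_form: "Q_form u u = (LINT x|\<mu>\<^sub>0. (norm (op_sqrt Q (grad u x)))\<^sup>2)" for u
    by (simp add: Q_form_def Q_form_square)
  show ?thesis
  proof (intro conjI ballI form_A_integrable form_A_closable form_A_Dirichlet)
    fix u :: "'a \<Rightarrow> real" assume u: "u \<in> FCb_infinity"
    show "integrable \<mu>\<^sub>0 (\<lambda>x. (norm (op_sqrt Q (grad u x)))\<^sup>2)"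
      using Q_form_integrable[OF u u] by (simp only: Q_form_square)
    show "c\<^sub>A * (LINT x|\<mu>\<^sub>0. (norm (op_sqrt Q (grad u x)))\<^sup>2) \<le> form_A \<mu>\<^sub>0 Q D u u"
      "form_A \<mu>\<^sub>0 Q D u u \<le> C\<^sub>A * (LINT x|\<mu>\<^sub>0. (norm (op_sqrt Q (grad u x)))\<^sup>2)"
      using form_A_bounds[OF u] by (simp_all only: Q_form)
  qed
qed

end
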